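(* Let $\mathbf{d}\in\mathbb{R}^d$, let $\lambda>0$ be a regularization coefficient, and consider learning the symmetric two-component Gaussian mixture $\mathbf{X}\sim\frac12\mathcal{N}(\boldsymbol{\mu}_{\mathbf{X}},\Sigma_{\mathbf{X}})+\frac12\mathcal{N}(-\boldsymbol{\mu}_{\mathbf{X}},\Sigma_{\mathbf{X}})$ in $\mathbb{R}^d$ through the minimax problem $\min_{\Lambda,\boldsymbol{\mu}}\mathcal{L}(G_{\Lambda,\boldsymbol{\mu}})$ over a feasible set of generator parameters $\Lambda\in\mathbb{R}^{d\times d}$, $\boldsymbol{\mu}\in\mathbb{R}^d$, where $$\mathcal{L}(G_{\Lambda,\boldsymbol{\mu}})=\max_{A,(\mathbf{b}_i)_{i=1}^4}\ \mathbb{E}\bigl[D_{A,(\mathbf{b}_i)}(\mathbf{X})\bigr]-\mathbb{E}\bigl[D_{A,(\mathbf{b}_i)}(G_{\Lambda,\boldsymbol{\mu}}(\mathbf{Z}))\bigr]-\frac{\lambda}{2}\Bigl(\Vert A\Vert_F^2+\Vert\mathbf{b}_1-\mathbf{d}\Vert_2^2+\Vert\mathbf{b}_2+\mathbf{d}\Vert_2^2+\Vert\mathbf{b}_3-\mathbf{d}\Vert_2^2+\Vert\mathbf{b}_4+\mathbf{d}\Vert_2^2\Bigr).$$ Suppose that $(\boldsymbol{\mu}_{\mathbf{X}},\Sigma_{\mathbf{X}})$ satisfies the separability condition (defined in the context) along $\mathbf{d}$. Suppose that for every feasible $G_{\Lambda,\boldsymbol{\mu}}$ the separability condition holds for $(\boldsymbol{\mu},\Sigma)$,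 where $\Sigma=\Lambda\Lambda^T$, along every $\widetilde{\mathbf{d}}$ with $\Vert\widetilde{\mathbf{d}}-\mathbf{d}\Vert_2\le\frac{\rho}{\lambda}$, where $\rho$ is the maximum of $\mathbb{E}[\Vert G_{\Lambda,\boldsymbol{\mu}}(\mathbf{Z})\Vert_2]$ over feasible $G_{\Lambda,\boldsymbol{\mu}}$'s. Suppose $\mathbb{E}[\Vert\mathbf{X}\Vert_2^2]+\mathbb{E}[\Vert G_{\Lambda,\boldsymbol{\mu}}(\mathbf{Z})\Vert_2^2]\le\lambda$ for all feasible $\Lambda,\boldsymbol{\mu}$. Then $(\boldsymbol{\mu}_{\mathbf{X}},\Sigma_{\mathbf{X}})$ is the only stationary point $(\boldsymbol{\mu},\Sigma)$ in the feasible set, i.e. the only one with $\nabla_{\operatorname{vec}(\boldsymbol{\mu},\Lambda)}\mathcal{L}(G_{\Lambda,\boldsymbol{\mu}})=\mathbf{0}$.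
   Context: Separability condition: mean and covariance parameters $(\boldsymbol{\mu},\Sigma)$ satisfy it along a vector $\widetilde{\mathbf{d}}$ if $$2\widetilde{\mathbf{d}}^T\Sigma\widetilde{\mathbf{d}}+\sqrt{\widetilde{\mathbf{d}}^T\Sigma\widetilde{\mathbf{d}}}\le\bigl|\boldsymbol{\mu}^T\widetilde{\mathbf{d}}\bigr|.$$ The generator is the random map $G_{\Lambda,\boldsymbol{\mu}}(\mathbf{z})=Y(\Lambda\mathbf{z}+\boldsymbol{\mu})$ with $Y$ uniform on $\{-1,+1\}$, independent of $\mathbf{Z}\sim\mathcal{N}(\mathbf{0},I_{d\times d})$. The discriminator is $$D_{A,(\mathbf{b}_i)_{i=1}^4}(\mathbf{x})=\frac12\mathbf{x}^TA\mathbf{x}+\log\biggl(\frac{\exp(\mathbf{b}_1^T\mathbf{x})+\exp(\mathbf{b}_2^T\mathbf{x})}{\exp(\mathbf{b}_3^T\mathbf{x})+\exp(\mathbf{b}_4^T\mathbf{x})}\biggr),$$ with $A\in\mathbb{R}^{d\times d}$ and $\mathbf{b}_i\in\mathbb{R}^d$. $\operatorname{vec}(\cdot)$ concatenates the entries of its inputs into a vector; $\Vert\cdot\Vert_F$ is the Frobenius norm.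
   Formalization: The mean is identified only up to sign (μ = ±μ_X, as both give the same mixture); every feasible Λ is assumed invertible (else e.g. Λ=0, μ=0 is stationary), so Σ_X is nonsingular; d ≠ 0 is assumed (fails in dimension 1); the target (μ_X, Σ_X) is assumed feasible. *)

theory Defs
  imports "HOL-Probability.Probability"
begin

(* The Lebesgue density of N(mu, Sigma), meaningful for positive definite Sigma only. *)
definition gaussian_density :: "real^'n \<Rightarrow> real^'n^'n \<Rightarrow> real^'n \<Rightarrow> real" where
  "gaussian_density \<mu> \<Sigma> x =
     exp (- ((x - \<mu>) \<bullet> (matrix_inv \<Sigma> *v (x - \<mu>))) / 2) / sqrt ((2 * pi) ^ CARD('n) * det \<Sigma>)"

definition symmetric_mixture_density :: "real^'n \<Rightarrow> real^'n^'n \<Rightarrow> real^'n \<Rightarrow> real" where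
  "symmetric_mixture_density \<mu> \<Sigma> x =
     1 / 2 * gaussian_density \<mu> \<Sigma> x + 1 / 2 * gaussian_density (- \<mu>) \<Sigma> x"

definition separable_along :: "real^'n \<Rightarrow> real^'n^'n \<Rightarrow> real^'n \<Rightarrow> bool" where
  "separable_along \<mu> \<Sigma> d \<longleftrightarrow>
     2 * (d \<bullet> (\<Sigma> *v d)) + sqrt (d \<bullet> (\<Sigma> *v d)) \<le> \<bar>\<mu> \<bullet> d\<bar>"

definition generator ::
  "('w \<Rightarrow> real) \<Rightarrow> ('w \<Rightarrow> real^'n) \<Rightarrow> real^'n^'n \<Rightarrow> real^'n \<Rightarrow> 'w \<Rightarrow> real^'n" where
  "generator Y Z \<Lambda> \<mu> \<omega> = Y \<omega> *\<^sub>R (\<Lambda> *v Z \<omega> + \<mu>)"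

definition discriminator ::
  "real^'n^'n \<Rightarrow> real^'n \<Rightarrow> real^'n \<Rightarrow> real^'n \<Rightarrow> real^'n \<Rightarrow> real^'n \<Rightarrow> real" where
  "discriminator A b1 b2 b3 b4 x =
     1 / 2 * (x \<bullet> (A *v x))
     + ln ((exp (b1 \<bullet> x) + exp (b2 \<bullet> x)) / (exp (b3 \<bullet> x) + exp (b4 \<bullet> x)))"

(* norm A is the Frobenius norm: the norm of real^'n^'n is the Euclidean norm of the vector of
   Euclidean norms of the rows. *)
definition regularized_objective ::
  "'w measure \<Rightarrow> real \<Rightarrow> real^'n \<Rightarrow> ('w \<Rightarrow> real^'n) \<Rightarrow> ('w \<Rightarrow> real^'n) \<Rightarrow>
   real^'n^'n \<Rightarrow> real^'n \<Rightarrow> real^'n \<Rightarrow> real^'n \<Rightarrow> real^'n \<Rightarrow> real" where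
  "regularized_objective M lam d X G A b1 b2 b3 b4 =
     (\<integral>\<omega>. discriminator A b1 b2 b3 b4 (X \<omega>) \<partial>M)
     - (\<integral>\<omega>. discriminator A b1 b2 b3 b4 (G \<omega>) \<partial>M)
     - lam / 2 * ((norm A)\<^sup>2 + (norm (b1 - d))\<^sup>2 + (norm (b2 + d))\<^sup>2
                  + (norm (b3 - d))\<^sup>2 + (norm (b4 + d))\<^sup>2)"

(* For lam > 0 and square-integrable X, G the regularization dominates the at most linear growth
   of the two expectations in (A, b1, ..., b4), so this supremum is finite and is a maximum. *)
definition gan_loss ::
  "'w measure \<Rightarrow> real \<Rightarrow> real^'n \<Rightarrow> ('w \<Rightarrow> real^'n) \<Rightarrow> ('w \<Rightarrow> real^'n) \<Rightarrow> real" where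
  "gan_loss M lam d X G =
     (SUP (A, b1, b2, b3, b4) \<in> UNIV. regularized_objective M lam d X G A b1 b2 b3 b4)"

end

theory Submission
  imports Defs
begin

text \<open>
  The discriminator is an even function plus a linear one, and only the even part
  \<open>x \<bullet> A x / 2 + ln cosh (p \<bullet> x) - ln cosh (q \<bullet> x)\<close> contributes to the objective, so the
  random signs disappear and all expectations become integrals over one standard Gaussian vector.
  At a stationary generator a maximizing discriminator \<open>(A, p, q)\<close> touches the loss from below,
  hence the gradient of its objective vanishes as well. Stein's identity turns this into
  \<open>h(p) p = h(q) q\<close> with \<open>h(p) = E tanh u - E u E sech\<^sup>2 u\<close> for \<open>u = p \<bullet> G\<close>. The
  key inequality (positivity of \<open>stein_gap\<close>) says that under separability \<open>k h(k q)\<close> is strictly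
  monotone in \<open>k\<close>; it forces \<open>p = q\<close>, then \<open>p = q = d\<close> and \<open>A = 0\<close> by the first-order conditions
  of the discriminator. So the second moments and \<open>E x tanh (d \<bullet> x)\<close> of data and generator
  agree, and the same inequality shows that along \<open>d\<close>, at fixed second moment, \<open>E u tanh u\<close>
  determines the mean up to sign.
\<close>

section \<open>Standard Gaussian vectors\<close>

text \<open>Two different derivatives lead to the same expression
  \<open>E (\<phi>' u) - E u * E (\<phi>'' u)\<close> with \<open>\<phi> x = x * tanh x\<close>:
  that of \<open>k h(k q)\<close> in k, and, up to a factor of constant sign, that of
  \<open>E u tanh u\<close> along the circle of constant second moment. The constant 2 of the
  separability condition makes its sign accessible. Stein's identity removes the explicit mean m,
  and recentring the Gaussian of variance v leaves an odd kernel integrated against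
  \<open>sinh (a * x)\<close> with \<open>a = m / v\<close>; separability says
  \<open>a \<ge> 2\<close>. At \<open>a = 2\<close> the identity
  \<open>sinh (2 * x) * sech_sq x = 2 * tanh x\<close> clears the denominators and the integral can
  be estimated almost explicitly; larger a is compared with this case. Separability is assumed on a
  ball of radius \<open>\<rho> / lam\<close> because the discriminator's own first-order conditions
  confine p and q to it.\<close>

definition std_gauss :: "(real^'n) measure" where
  "std_gauss = density lborel (\<lambda>z. ennreal (gaussian_density 0 (mat 1) z))"

lemma matrix_inv_eqI:
  fixes A :: "real^'n^'n"
  assumes "A ** B = mat 1"
  shows "matrix_inv A = B"
proof -
  have BA: "B ** A = mat 1" using assms by (simp add: matrix_left_right_inverse)
  have "A ** matrix_inv A = mat 1 \<and> matrix_inv A ** A = mat 1"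
    unfolding matrix_inv_def by (rule someI[of _ B]) (use assms BA in auto)
  then have "B ** (A ** matrix_inv A) = B" by simp
  then show ?thesis by (simp add: matrix_mul_assoc BA)
qed

lemma gaussian_density_std:
  "gaussian_density 0 (mat 1) (z :: real^'n) = exp (- (z \<bullet> z) / 2) / sqrt ((2 * pi) ^ CARD('n))"
  by (simp add: gaussian_density_def matrix_inv_eqI)

lemma gaussian_density_std_measurable [measurable]:
  "gaussian_density 0 (mat 1) \<in> borel_measurable borel"
  unfolding gaussian_density_std[abs_def] by measurable

lemma gaussian_density_std_nonneg: "0 \<le> gaussian_density 0 (mat 1) z"
  unfolding gaussian_density_std by simp

text \<open>Factorizing over the coordinates reduces the total mass to the one-dimensional normal
  density.\<close>

lemma gaussian_density_std_prod:
  "gaussian_density 0 (mat 1) (z :: real^'n) = (\<Prod>b\<in>Basis. std_normal_density (z \<bullet> b))"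
proof -
  have "(\<Prod>b\<in>Basis. std_normal_density (z \<bullet> b))
      = (\<Prod>b\<in>(Basis::(real^'n) set). 1 / sqrt (2 * pi)) * (\<Prod>b\<in>Basis. exp (- (z \<bullet> b)\<^sup>2 / 2))"
    unfolding std_normal_density_def prod.distrib ..
  also have "(\<Prod>b\<in>Basis. exp (- (z \<bullet> b)\<^sup>2 / 2)) = exp (- (z \<bullet> z) / 2)"
    by (simp add: euclidean_inner[of z z] power2_eq_square sum_negf sum_divide_distrib flip: exp_sum)
  finally show ?thesis
    by (simp add: gaussian_density_std power_one_over power_divide flip: real_sqrt_power)
qed

lemma sets_std_gauss [measurable_cong]: "sets std_gauss = sets borel"
  and space_std_gauss [simp]: "space std_gauss = UNIV"
  by (simp_all add: std_gauss_def)

lemma prob_space_std_gauss: "prob_space (std_gauss :: (real^'n) measure)"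
proof
  have 1: "(\<integral>\<^sup>+x. ennreal (std_normal_density x) \<partial>lborel) = 1"
    by (subst nn_integral_eq_integral) auto
  have "emeasure std_gauss (space (std_gauss :: (real^'n) measure))
      = (\<integral>\<^sup>+z. (\<Prod>b\<in>Basis. ennreal (std_normal_density ((z::real^'n) \<bullet> b))) \<partial>lborel)"
    by (simp add: std_gauss_def emeasure_density gaussian_density_std_prod prod_ennreal)
  also have "\<dots> = 1"
    by (subst nn_integral_lborel_prod) (auto simp: 1)
  finally show "emeasure std_gauss (space (std_gauss :: (real^'n) measure)) = 1" .
qed

interpretation std_gauss: prob_space std_gauss by (rule prob_space_std_gauss)

lemma integral_std_gauss:
  fixes f :: "real^'n \<Rightarrow> real"
  assumes "f \<in> borel_measurable borel"
  shows "(\<integral>z. f z \<partial>std_gauss) = (\<integral>z. gaussian_density 0 (mat 1) z * f z \<partial>lborel)"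
    and "integrable std_gauss f \<longleftrightarrow> integrable lborel (\<lambda>z. gaussian_density 0 (mat 1) z * f z)"
  using integral_density[of f lborel "gaussian_density 0 (mat 1)"]
    integrable_density[of f lborel "gaussian_density 0 (mat 1)"] assms
  by (simp_all add: std_gauss_def gaussian_density_std_nonneg)

text \<open>The Cameron-Martin formula, by completing the square in the density. It yields the
  exponential moments, Stein's identity and the recentring in \<open>stein_gap_pos\<close>.\<close>

lemma std_gauss_translate:
  fixes f :: "real^'n \<Rightarrow> real"
  assumes [measurable]: "f \<in> borel_measurable borel"
  shows "(\<integral>z. f (z + a) \<partial>std_gauss) = (\<integral>z. f z * exp (a \<bullet> z - a \<bullet> a / 2) \<partial>std_gauss)"
    and "integrable std_gauss (\<lambda>z. f (z + a)) \<longleftrightarrow>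
         integrable std_gauss (\<lambda>z. f z * exp (a \<bullet> z - a \<bullet> a / 2))"
proof -
  let ?g = "\<lambda>z. gaussian_density 0 (mat 1) z * f (z + a)"
  have eq: "gaussian_density 0 (mat 1) (- a + z) * f z = gaussian_density 0 (mat 1) z * (f z * exp (a \<bullet> z - a \<bullet> a / 2))" for z
  proof -
    have "- ((- a + z) \<bullet> (- a + z)) / 2 = - (z \<bullet> z) / 2 + (a \<bullet> z - a \<bullet> a / 2)"
      by (simp add: inner_simps inner_commute field_simps)
    then show ?thesis
      unfolding gaussian_density_std by (simp only: exp_add) simp
  qed
  have "integral\<^sup>L lborel ?g = integral\<^sup>L (distr lborel borel ((+) (- a))) ?g"
    by (simp only: lborel_distr_plus)
  also have "\<dots> = (\<integral>z. gaussian_density 0 (mat 1) z * (f z * exp (a \<bullet> z - a \<bullet> a / 2)) \<partial>lborel)"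
    by (subst integral_distr) (auto simp: eq simp del: add_uminus_conv_diff uminus_add_conv_diff)
  finally show "(\<integral>z. f (z + a) \<partial>std_gauss) = (\<integral>z. f z * exp (a \<bullet> z - a \<bullet> a / 2) \<partial>std_gauss)"
    by (simp add: integral_std_gauss)
  have "integrable lborel ?g \<longleftrightarrow> integrable (distr lborel borel ((+) (- a))) ?g"
    by (simp only: lborel_distr_plus)
  also have "\<dots> \<longleftrightarrow> integrable lborel (\<lambda>z. gaussian_density 0 (mat 1) z * (f z * exp (a \<bullet> z - a \<bullet> a / 2)))"
    by (subst integrable_distr_eq) (auto simp: eq simp del: add_uminus_conv_diff uminus_add_conv_diff)
  finally show "integrable std_gauss (\<lambda>z. f (z + a)) \<longleftrightarrow>
         integrable std_gauss (\<lambda>z. f z * exp (a \<bullet> z - a \<bullet> a / 2))"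
    by (simp add: integral_std_gauss)
qed

lemma integrable_std_gauss_exp_inner: "integrable std_gauss (\<lambda>z. exp (a \<bullet> z))"
proof -
  have "integrable std_gauss (\<lambda>z. 1 * exp (a \<bullet> z - a \<bullet> a / 2))"
    by (subst std_gauss_translate(2)[symmetric]) auto
  then have "integrable std_gauss (\<lambda>z. exp (a \<bullet> a / 2) * (1 * exp (a \<bullet> z - a \<bullet> a / 2)))"
    by (rule integrable_mult_right)
  then show ?thesis
    by (simp flip: exp_add)
qed

lemma integral_std_gauss_exp_inner:
  fixes a :: "real^'n"
  shows "(\<integral>z. exp (a \<bullet> z) \<partial>std_gauss) = exp (a \<bullet> a / 2)"
proof -
  have "(\<integral>z. exp (a \<bullet> z - a \<bullet> a / 2) \<partial>std_gauss) = 1"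
    using std_gauss_translate(1)[of "\<lambda>_. 1" a] by (simp add: std_gauss.prob_space[simplified])
  then show ?thesis by (simp add: exp_diff)
qed

text \<open>A majorant for unbounded integrands, with two directions because a product such as
  \<open>(a \<bullet> z) * f (w \<bullet> z)\<close> grows along both. The exponential is at most
  the sum over the four choices of signs.\<close>

lemma integrable_std_gauss_exp_abs:
  "integrable std_gauss (\<lambda>z. exp (\<bar>a \<bullet> z\<bar> + \<bar>b \<bullet> z\<bar>))"
proof (rule Bochner_Integration.integrable_bound)
  show "integrable std_gauss (\<lambda>z. exp ((a + b) \<bullet> z) + exp ((a - b) \<bullet> z)
          + exp ((b - a) \<bullet> z) + exp ((- a - b) \<bullet> z))"
    by (intro Bochner_Integration.integrable_add integrable_std_gauss_exp_inner)
  have "exp (\<bar>x\<bar> + \<bar>y\<bar>) \<le> exp (x + y) + exp (x - y) + exp (y - x) + exp (- x - y)" for x y :: real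
    by (cases "x \<ge> 0"; cases "y \<ge> 0") (auto simp: add_increasing add_increasing2 add.commute)
  then show "AE z in std_gauss. norm (exp (\<bar>a \<bullet> z\<bar> + \<bar>b \<bullet> z\<bar>)) \<le> norm (exp ((a + b) \<bullet> z)
          + exp ((a - b) \<bullet> z) + exp ((b - a) \<bullet> z) + exp ((- a - b) \<bullet> z))"
    by (intro AE_I2) (simp add: inner_simps)
qed measurable

lemma integrable_std_gauss_dominated:
  assumes [measurable]: "f \<in> borel_measurable borel"
    and bound: "\<And>z. \<bar>f z\<bar> \<le> C * exp (\<bar>a \<bullet> z\<bar> + \<bar>b \<bullet> z\<bar>)"
  shows "integrable std_gauss f"
proof (rule Bochner_Integration.integrable_bound)
  show "integrable std_gauss (\<lambda>z. C * exp (\<bar>a \<bullet> z\<bar> + \<bar>b \<bullet> z\<bar>))"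
    by (intro integrable_mult_right integrable_std_gauss_exp_abs)
  show "AE z in std_gauss. norm (f z) \<le> norm (C * exp (\<bar>a \<bullet> z\<bar> + \<bar>b \<bullet> z\<bar>))"
    using bound by (intro AE_I2) (metis abs_ge_self order_trans real_norm_def)
qed simp

lemma integrable_std_gauss_bounded:
  fixes f :: "real^'n \<Rightarrow> real"
  assumes "f \<in> borel_measurable borel" "\<And>z. \<bar>f z\<bar> \<le> C"
  shows "integrable std_gauss f"
  using integrable_std_gauss_dominated[of f C 0 0] assms by simp

lemma integrable_std_gauss_norm_squared: "integrable (std_gauss :: (real^'n) measure) (\<lambda>z. (norm z)\<^sup>2)"
proof -
  have "integrable std_gauss (\<lambda>z. (z \<bullet> b)\<^sup>2)" for b :: "real^'n"
  proof (rule integrable_std_gauss_dominated)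
    fix z :: "real^'n"
    have "\<bar>z \<bullet> b\<bar> \<le> exp \<bar>z \<bullet> b\<bar>" using exp_ge_add_one_self[of "\<bar>z \<bullet> b\<bar>"] by linarith
    then have "\<bar>z \<bullet> b\<bar>\<^sup>2 \<le> (exp \<bar>z \<bullet> b\<bar>)\<^sup>2" by (intro power_mono) auto
    then show "\<bar>(z \<bullet> b)\<^sup>2\<bar> \<le> 1 * exp (\<bar>b \<bullet> z\<bar> + \<bar>b \<bullet> z\<bar>)"
      by (simp add: power2_eq_square inner_commute flip: exp_add)
  qed measurable
  then have "integrable std_gauss (\<lambda>z::real^'n. \<Sum>b\<in>Basis. (z \<bullet> b)\<^sup>2)"
    by (intro Bochner_Integration.integrable_sum)
  moreover have "(norm z)\<^sup>2 = (\<Sum>b\<in>Basis. (z \<bullet> b)\<^sup>2)" for z :: "(real, 'n) vec"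
    unfolding power2_norm_eq_inner by (subst euclidean_inner) (simp add: power2_eq_square)
  ultimately show ?thesis
    by simp
qed

lemma le_one_add_square: "x \<le> 1 + (x::real)\<^sup>2"
  using sum_squares_bound[of x 1] zero_le_power2[of x] by (simp; linarith)

lemma integrable_std_gauss_norm: "integrable (std_gauss :: (real^'n) measure) norm"
proof (rule Bochner_Integration.integrable_bound)
  show "integrable std_gauss (\<lambda>z :: real^'n. 1 + (norm z)\<^sup>2)"
    by (intro Bochner_Integration.integrable_add integrable_std_gauss_norm_squared) simp
  show "AE z in std_gauss. norm (norm z) \<le> norm (1 + (norm z)\<^sup>2)"
    by (intro AE_I2) (simp add: le_one_add_square)
qed measurable

section \<open>Differentiation under the integral and Stein's identity\<close>

text \<open>Dominated convergence along sequences tending to \<open>t0\<close>; the mean value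
  inequality bounds the difference quotients by the majorant \<open>g\<close> of the
  derivatives.\<close>

lemma has_real_derivative_integral:
  fixes F :: "real \<Rightarrow> 'a \<Rightarrow> real"
  assumes "e > 0"
    and int: "\<And>t. \<bar>t - t0\<bar> < e \<Longrightarrow> integrable P (F t)"
    and deriv: "\<And>t z. \<bar>t - t0\<bar> < e \<Longrightarrow> z \<in> space P \<Longrightarrow> ((\<lambda>t. F t z) has_real_derivative F' t z) (at t)"
    and bound: "\<And>t z. \<bar>t - t0\<bar> < e \<Longrightarrow> z \<in> space P \<Longrightarrow> \<bar>F' t z\<bar> \<le> g z"
    and g: "integrable P g"
    and meas: "F' t0 \<in> borel_measurable P"
  shows "((\<lambda>t. \<integral>z. F t z \<partial>P) has_real_derivative (\<integral>z. F' t0 z \<partial>P)) (at t0)"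
proof -
  have "((\<lambda>t. ((\<integral>z. F t z \<partial>P) - (\<integral>z. F t0 z \<partial>P)) / (t - t0)) \<longlongrightarrow> (\<integral>z. F' t0 z \<partial>P)) (at t0)"
    unfolding tendsto_at_iff_sequentially comp_def
  proof (intro allI impI)
    fix X :: "nat \<Rightarrow> real"
    assume X: "\<forall>i. X i \<in> UNIV - {t0}" "X \<longlonglongrightarrow> t0"
    have "eventually (\<lambda>i. \<bar>X i - t0\<bar> < e) sequentially"
      using X(2) \<open>e > 0\<close> by (auto simp: tendsto_iff dist_real_def)
    then obtain N where N: "\<And>i. i \<ge> N \<Longrightarrow> \<bar>X i - t0\<bar> < e"
      by (auto simp: eventually_sequentially)
    \<comment> \<open>Dropping the first N terms keeps every point inside the neighbourhood in which
      the hypotheses hold, without changing the limit.\<close>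
    define Y where "Y i = X (i + N)" for i
    have Y: "\<bar>Y i - t0\<bar> < e" "Y i \<noteq> t0" for i
      using N X(1) by (auto simp: Y_def)
    have Ylim: "Y \<longlonglongrightarrow> t0"
      unfolding Y_def using X(2) by (rule LIMSEQ_ignore_initial_segment)
    have "(\<lambda>i. \<integral>z. (F (Y i) z - F t0 z) / (Y i - t0) \<partial>P) \<longlonglongrightarrow> (\<integral>z. F' t0 z \<partial>P)"
    proof (rule integral_dominated_convergence[where w = g])
      show "AE z in P. (\<lambda>i. (F (Y i) z - F t0 z) / (Y i - t0)) \<longlonglongrightarrow> F' t0 z"
      proof (rule AE_I2)
        fix z assume "z \<in> space P"
        then have "((\<lambda>t. F t z) has_real_derivative F' t0 z) (at t0)"
          using deriv[of t0] \<open>e > 0\<close> by simp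
        then have "((\<lambda>t. (F t z - F t0 z) / (t - t0)) \<longlongrightarrow> F' t0 z) (at t0)"
          by (simp add: has_field_derivative_iff)
        then show "(\<lambda>i. (F (Y i) z - F t0 z) / (Y i - t0)) \<longlonglongrightarrow> F' t0 z"
          unfolding tendsto_at_iff_sequentially comp_def using Y(2) Ylim by auto
      qed
      show "AE z in P. norm ((F (Y i) z - F t0 z) / (Y i - t0)) \<le> g z" for i
      proof (rule AE_I2)
        fix z assume z: "z \<in> space P"
        have "norm (F (Y i) z - F t0 z) \<le> g z * norm (Y i - t0)"
        proof (rule field_differentiable_bound[where S = "{t. \<bar>t - t0\<bar> < e}"])
          show "convex {t. \<bar>t - t0\<bar> < e}"
          proof -
            have "{t. \<bar>t - t0\<bar> < e} = ball t0 e" by (auto simp: dist_real_def)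
            then show ?thesis by (metis convex_ball)
          qed
        qed (use Y(1) \<open>e > 0\<close> z in \<open>auto intro!: bound DERIV_subset[OF deriv]\<close>)
        then show "norm ((F (Y i) z - F t0 z) / (Y i - t0)) \<le> g z"
          using Y(2)[of i] by (simp add: divide_le_eq)
      qed
    qed (use int[OF Y(1)] int[of t0] \<open>e > 0\<close> g meas in auto)
    moreover have "(\<integral>z. (F (Y i) z - F t0 z) / (Y i - t0) \<partial>P)
        = ((\<integral>z. F (Y i) z \<partial>P) - (\<integral>z. F t0 z \<partial>P)) / (Y i - t0)" for i
      using Bochner_Integration.integral_diff[OF int[OF Y(1)] int[of t0], of i] \<open>e > 0\<close> by simp
    ultimately have "(\<lambda>i. ((\<integral>z. F (Y i) z \<partial>P) - (\<integral>z. F t0 z \<partial>P)) / (Y i - t0)) \<longlonglongrightarrow> (\<integral>z. F' t0 z \<partial>P)"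
      by (simp only:)
    then show "(\<lambda>i. ((\<integral>z. F (X i) z \<partial>P) - (\<integral>z. F t0 z \<partial>P)) / (X i - t0)) \<longlonglongrightarrow> (\<integral>z. F' t0 z \<partial>P)"
      unfolding Y_def by (rule LIMSEQ_offset)
  qed
  then show ?thesis
    by (simp add: has_field_derivative_iff)
qed

lemma bounded_derivative_imp_lipschitz:
  fixes f :: "real \<Rightarrow> real"
  assumes "\<And>x. (f has_real_derivative f' x) (at x)" "\<And>x. \<bar>f' x\<bar> \<le> B"
  shows "\<bar>f x - f y\<bar> \<le> B * \<bar>x - y\<bar>"
  using field_differentiable_bound[of UNIV f f' B x y] assms by auto

lemma abs_le_exp_abs: "\<bar>x\<bar> \<le> exp \<bar>x::real\<bar>"
  using exp_ge_add_one_self[of "\<bar>x\<bar>"] by linarith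

lemma affine_le_exp_abs:
  fixes x :: real
  assumes "0 \<le> C" "0 \<le> B" shows "C + B * \<bar>x\<bar> \<le> (C + B) * exp \<bar>x\<bar>"
proof -
  have "C * 1 + B * \<bar>x\<bar> \<le> C * exp \<bar>x\<bar> + B * exp \<bar>x\<bar>"
    using assms abs_le_exp_abs by (intro add_mono mult_left_mono) auto
  then show ?thesis by (simp add: algebra_simps)
qed

text \<open>Both sides are the derivative at \<open>t = 0\<close> of \<open>E f (m + w \<bullet> (z + t a))\<close>, on the right
  before and on the left after the translation \<open>z + t a \<mapsto> z\<close>.\<close>

lemma std_gauss_stein:
  fixes w a :: "real^'n"
  assumes deriv: "\<And>x. (f has_real_derivative f' x) (at x)"
    and bound: "\<And>x. \<bar>f' x\<bar> \<le> B"
    and [measurable]: "f' \<in> borel_measurable borel"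
  shows "(\<integral>z. (a \<bullet> z) * f (m + w \<bullet> z) \<partial>std_gauss) = (a \<bullet> w) * (\<integral>z. f' (m + w \<bullet> z) \<partial>std_gauss)"
    and "integrable std_gauss (\<lambda>z. (a \<bullet> z) * f (m + w \<bullet> z))"
proof -
  have "continuous_on UNIV f"
    using deriv DERIV_isCont by (blast intro: continuous_at_imp_continuous_on)
  then have [measurable]: "f \<in> borel_measurable borel"
    by (rule borel_measurable_continuous_onI)
  have B: "0 \<le> B" using bound[of 0] by linarith
  define C where "C = \<bar>f m\<bar>"
  have C: "0 \<le> C" by (simp add: C_def)
  have growth: "\<bar>f (m + x)\<bar> \<le> (C + B) * exp \<bar>x\<bar>" for x
    using bounded_derivative_imp_lipschitz[OF deriv bound, of "m + x" m]
      affine_le_exp_abs[of C B x] B C by (simp add: C_def)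
  define k where "k = a \<bullet> a"
  have k: "0 \<le> k" by (simp add: k_def)
  show int_a: "integrable std_gauss (\<lambda>z. (a \<bullet> z) * f (m + w \<bullet> z))"
  proof (rule integrable_std_gauss_dominated)
    show "\<bar>(a \<bullet> z) * f (m + w \<bullet> z)\<bar> \<le> (C + B) * exp (\<bar>a \<bullet> z\<bar> + \<bar>w \<bullet> z\<bar>)" for z
      using mult_mono[OF abs_le_exp_abs[of "a \<bullet> z"] growth[of "w \<bullet> z"]]
      by (simp add: abs_mult exp_add mult_ac)
  qed measurable
  have "((\<lambda>t. \<integral>z. f (m + w \<bullet> z + t * (a \<bullet> w)) \<partial>std_gauss) has_real_derivative
      (\<integral>z. f' (m + w \<bullet> z + 0 * (a \<bullet> w)) * (a \<bullet> w) \<partial>std_gauss)) (at 0)"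
  proof (rule has_real_derivative_integral[where e = 1 and g = "\<lambda>_. B * \<bar>a \<bullet> w\<bar>"])
    fix t
    show "integrable std_gauss (\<lambda>z. f (m + w \<bullet> z + t * (a \<bullet> w)))"
    proof (rule integrable_std_gauss_dominated)
      fix z
      have "\<bar>f (m + (w \<bullet> z + t * (a \<bullet> w)))\<bar> \<le> (C + B) * exp (\<bar>w \<bullet> z\<bar> + \<bar>t * (a \<bullet> w)\<bar>)"
        using B C by (intro order_trans[OF growth]) (auto intro!: mult_left_mono)
      then show "\<bar>f (m + w \<bullet> z + t * (a \<bullet> w))\<bar>
          \<le> ((C + B) * exp \<bar>t * (a \<bullet> w)\<bar>) * exp (\<bar>w \<bullet> z\<bar> + \<bar>0 \<bullet> z\<bar>)"
        by (simp add: exp_add add.assoc mult_ac)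
    qed measurable
    show "((\<lambda>t. f (m + w \<bullet> z + t * (a \<bullet> w))) has_real_derivative
        f' (m + w \<bullet> z + t * (a \<bullet> w)) * (a \<bullet> w)) (at t)" for z
      by (rule DERIV_chain2[OF deriv]) (auto intro!: derivative_eq_intros)
    show "\<bar>f' (m + w \<bullet> z + t * (a \<bullet> w)) * (a \<bullet> w)\<bar> \<le> B * \<bar>a \<bullet> w\<bar>" for z
      by (simp add: abs_mult bound mult_right_mono)
  qed auto
  then have D1: "((\<lambda>t. \<integral>z. f (m + w \<bullet> z + t * (a \<bullet> w)) \<partial>std_gauss) has_real_derivative
      (a \<bullet> w) * (\<integral>z. f' (m + w \<bullet> z) \<partial>std_gauss)) (at 0)"
    by (simp add: mult.commute)
  \<comment> \<open>Cameron-Martin with the shift \<open>t *\<^sub>R a\<close>: the parameter t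
    moves from f into the density, where differentiation brings down the factor
    \<open>a \<bullet> z\<close>.\<close>
  have shift: "(\<integral>z. f (m + w \<bullet> z + t * (a \<bullet> w)) \<partial>std_gauss)
      = (\<integral>z. f (m + w \<bullet> z) * exp (t * (a \<bullet> z) - t\<^sup>2 * k / 2) \<partial>std_gauss)" for t
    using std_gauss_translate(1)[of "\<lambda>z. f (m + w \<bullet> z)" "t *\<^sub>R a"]
    by (simp add: inner_simps inner_commute k_def power2_eq_square mult_ac add.assoc)
  have "((\<lambda>t. \<integral>z. f (m + w \<bullet> z) * exp (t * (a \<bullet> z) - t\<^sup>2 * k / 2) \<partial>std_gauss) has_real_derivative
      (\<integral>z. f (m + w \<bullet> z) * (exp (0 * (a \<bullet> z) - 0\<^sup>2 * k / 2) * (a \<bullet> z - 0 * k)) \<partial>std_gauss)) (at 0)"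
  \<comment> \<open>For \<open>\<bar>t\<bar> < 1\<close> the density factor costs
    \<open>exp \<bar>a \<bullet> z\<bar>\<close>, and so does the linear factor
    \<open>a \<bullet> z - t * k\<close>; together they produce the direction
    \<open>2 *\<^sub>R a\<close>.\<close>
  proof (rule has_real_derivative_integral[where e = 1
        and g = "\<lambda>z. ((C + B) * (1 + k)) * exp (\<bar>w \<bullet> z\<bar> + \<bar>(2 *\<^sub>R a) \<bullet> z\<bar>)"])
    fix t :: real assume t: "\<bar>t - 0\<bar> < 1"
    have exp_le: "exp (t * (a \<bullet> z) - t\<^sup>2 * k / 2) \<le> exp \<bar>a \<bullet> z\<bar>" for z
    proof -
      have "t * (a \<bullet> z) \<le> \<bar>t\<bar> * \<bar>a \<bullet> z\<bar>" by (metis abs_ge_self abs_mult)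
      also have "\<dots> \<le> 1 * \<bar>a \<bullet> z\<bar>" using t by (intro mult_right_mono) auto
      moreover have "0 \<le> t\<^sup>2 * k / 2" using k by simp
      ultimately show ?thesis by simp
    qed
    show "integrable std_gauss (\<lambda>z. f (m + w \<bullet> z) * exp (t * (a \<bullet> z) - t\<^sup>2 * k / 2))"
    proof (rule integrable_std_gauss_dominated)
      show "\<bar>f (m + w \<bullet> z) * exp (t * (a \<bullet> z) - t\<^sup>2 * k / 2)\<bar>
          \<le> (C + B) * exp (\<bar>w \<bullet> z\<bar> + \<bar>a \<bullet> z\<bar>)" for z
        using mult_mono[OF growth[of "w \<bullet> z"] exp_le] B C
        by (simp add: abs_mult exp_add mult_ac)
    qed measurable
    show "((\<lambda>t. f (m + w \<bullet> z) * exp (t * (a \<bullet> z) - t\<^sup>2 * k / 2)) has_real_derivative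
        f (m + w \<bullet> z) * (exp (t * (a \<bullet> z) - t\<^sup>2 * k / 2) * (a \<bullet> z - t * k))) (at t)" for z
      by (auto intro!: derivative_eq_intros)
    show "\<bar>f (m + w \<bullet> z) * (exp (t * (a \<bullet> z) - t\<^sup>2 * k / 2) * (a \<bullet> z - t * k))\<bar>
        \<le> ((C + B) * (1 + k)) * exp (\<bar>w \<bullet> z\<bar> + \<bar>(2 *\<^sub>R a) \<bullet> z\<bar>)" for z
    proof -
      have "\<bar>a \<bullet> z - t * k\<bar> \<le> k + 1 * \<bar>a \<bullet> z\<bar>"
      proof -
        have "\<bar>t * k\<bar> \<le> 1 * k" using t k by (simp add: abs_mult mult_left_le_one_le)
        then show ?thesis by linarith
      qed
      also have "\<dots> \<le> (1 + k) * exp \<bar>a \<bullet> z\<bar>"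
        using affine_le_exp_abs[of k 1 "a \<bullet> z"] k by (simp add: add.commute)
      finally have *: "\<bar>a \<bullet> z - t * k\<bar> \<le> (1 + k) * exp \<bar>a \<bullet> z\<bar>" .
      have "\<bar>f (m + w \<bullet> z)\<bar> * (exp (t * (a \<bullet> z) - t\<^sup>2 * k / 2) * \<bar>a \<bullet> z - t * k\<bar>)
          \<le> ((C + B) * exp \<bar>w \<bullet> z\<bar>) * (exp \<bar>a \<bullet> z\<bar> * ((1 + k) * exp \<bar>a \<bullet> z\<bar>))"
        using B C by (intro mult_mono growth exp_le * mult_nonneg_nonneg) auto
      also have "\<dots> = ((C + B) * (1 + k)) * exp (\<bar>w \<bullet> z\<bar> + \<bar>(2 *\<^sub>R a) \<bullet> z\<bar>)"
        by (simp add: exp_add abs_mult exp_double power2_eq_square)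
      finally show ?thesis by (simp add: abs_mult)
    qed
  qed (auto intro!: integrable_mult_right integrable_std_gauss_exp_abs simp del: inner_scaleR_left)
  then have D2: "((\<lambda>t. \<integral>z. f (m + w \<bullet> z + t * (a \<bullet> w)) \<partial>std_gauss) has_real_derivative
      (\<integral>z. (a \<bullet> z) * f (m + w \<bullet> z) \<partial>std_gauss)) (at 0)"
    unfolding shift by (simp add: mult.commute)
  show "(\<integral>z. (a \<bullet> z) * f (m + w \<bullet> z) \<partial>std_gauss) = (a \<bullet> w) * (\<integral>z. f' (m + w \<bullet> z) \<partial>std_gauss)"
    by (rule DERIV_unique[OF D2 D1])
qed

section \<open>Linear changes of variables and rotation invariance\<close>

lemma nn_integral_lborel_translate:
  fixes h :: "real^'n \<Rightarrow> ennreal"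
  assumes [measurable]: "h \<in> borel_measurable borel"
  shows "(\<integral>\<^sup>+x. h (a + x) \<partial>lborel) = (\<integral>\<^sup>+x. h x \<partial>lborel)"
  using nn_integral_distr[of "(+) a" lborel borel h] by (simp add: lborel_distr_plus)

text \<open>Uniqueness of Haar measure. The determinant formula for the constant is in the library only for
  index types of class \<open>wellorder\<close>; below the constant is always determined by normalization.\<close>

lemma nn_integral_lborel_linear:
  fixes \<Lambda> :: "real^'n^'n"
  assumes "invertible \<Lambda>"
  obtains c where "\<And>f :: real^'n \<Rightarrow> ennreal. f \<in> borel_measurable borel \<Longrightarrow>
    (\<integral>\<^sup>+x. f (\<Lambda> *v x) \<partial>lborel) = c * (\<integral>\<^sup>+x. f x \<partial>lborel)"
proof -
  obtain V where V: "\<Lambda> ** V = mat 1" using assms by (auto simp: invertible_def)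
  have lin [measurable]: "(*v) A \<in> borel_measurable borel" for A :: "real^'n^'n"
    by (intro borel_measurable_continuous_onI linear_continuous_on) (simp add: linear_linear)
  define g :: "real^'n \<Rightarrow> ennreal" where "g = indicator (cbox 0 One)"
  have [measurable]: "g \<in> borel_measurable borel" by (simp add: g_def)
  have "(\<integral>\<^sup>+y. g y \<partial>lborel) = 1" by (simp add: g_def)
  note trans = nn_integral_lborel_translate
  show thesis
  proof
    fix f :: "real^'n \<Rightarrow> ennreal"
    assume [measurable]: "f \<in> borel_measurable borel"
    \<comment> \<open>The inserted factor is 1 by translation invariance. After Fubini, shifting x
      by \<open>V *v y\<close> makes g independent of y, and the integral of
      \<open>g (- (\<Lambda> *v x))\<close> remains as the constant.\<close>
    have "(\<integral>\<^sup>+x. f (\<Lambda> *v x) \<partial>lborel) = (\<integral>\<^sup>+x. f (\<Lambda> *v x) * (\<integral>\<^sup>+y. g (- (\<Lambda> *v x) + y) \<partial>lborel) \<partial>lborel)"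
      using \<open>(\<integral>\<^sup>+y. g y \<partial>lborel) = 1\<close> by (simp add: trans del: add_uminus_conv_diff uminus_add_conv_diff)
    also have "\<dots> = (\<integral>\<^sup>+x. (\<integral>\<^sup>+y. f (\<Lambda> *v x) * g (- (\<Lambda> *v x) + y) \<partial>lborel) \<partial>lborel)"
      by (intro nn_integral_cong nn_integral_cmult[symmetric]) measurable
    also have "\<dots> = (\<integral>\<^sup>+y. (\<integral>\<^sup>+x. f (\<Lambda> *v x) * g (- (\<Lambda> *v x) + y) \<partial>lborel) \<partial>lborel)"
      by (rule lborel_pair.Fubini') measurable
    also have "\<dots> = (\<integral>\<^sup>+y. (\<integral>\<^sup>+x. f (\<Lambda> *v (V *v y + x)) * g (- (\<Lambda> *v (V *v y + x)) + y) \<partial>lborel) \<partial>lborel)"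
      by (intro nn_integral_cong trans[symmetric]) measurable
    also have "\<dots> = (\<integral>\<^sup>+y. (\<integral>\<^sup>+x. f (\<Lambda> *v x + y) * g (- (\<Lambda> *v x)) \<partial>lborel) \<partial>lborel)"
      by (simp add: matrix_vector_right_distrib matrix_vector_mul_assoc V add.commute)
    also have "\<dots> = (\<integral>\<^sup>+x. (\<integral>\<^sup>+y. f (\<Lambda> *v x + y) * g (- (\<Lambda> *v x)) \<partial>lborel) \<partial>lborel)"
      by (rule lborel_pair.Fubini') measurable
    also have "\<dots> = (\<integral>\<^sup>+x. (\<integral>\<^sup>+y. f y \<partial>lborel) * g (- (\<Lambda> *v x)) \<partial>lborel)"
      by (simp add: nn_integral_multc trans)
    also have "\<dots> = (\<integral>\<^sup>+x. g (- (\<Lambda> *v x)) \<partial>lborel) * (\<integral>\<^sup>+y. f y \<partial>lborel)"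
      by (simp add: nn_integral_cmult mult.commute)
    finally show "(\<integral>\<^sup>+x. f (\<Lambda> *v x) \<partial>lborel) = (\<integral>\<^sup>+x. g (- (\<Lambda> *v x)) \<partial>lborel) * (\<integral>\<^sup>+x. f x \<partial>lborel)" .
  qed
qed

lemma matrix_vector_mult_measurable [measurable]:
  "(*v) (A :: real^'n^'m) \<in> borel_measurable borel"
  by (intro borel_measurable_continuous_onI linear_continuous_on) (simp add: linear_linear)

lemma nn_integral_std_gauss:
  assumes [measurable]: "f \<in> borel_measurable borel"
  shows "(\<integral>\<^sup>+z. f z \<partial>std_gauss) = (\<integral>\<^sup>+z. ennreal (gaussian_density 0 (mat 1) z) * f z \<partial>lborel)"
  by (simp add: std_gauss_def nn_integral_density)

text \<open>The density depends only on \<open>z \<bullet> z\<close>, which an orthogonal map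
  preserves; the constant of the linear substitution is 1, as the constant function 1 shows.\<close>

lemma nn_integral_std_gauss_orthogonal:
  fixes g :: "real^'n \<Rightarrow> real^'n"
  assumes g: "orthogonal_transformation g" and [measurable]: "f \<in> borel_measurable borel"
  shows "(\<integral>\<^sup>+z. f (g z) \<partial>std_gauss) = (\<integral>\<^sup>+z. f z \<partial>std_gauss)"
proof -
  define Q where "Q = matrix g"
  have Q: "Q *v z = g z" for z
    unfolding Q_def using orthogonal_transformation_linear[OF g] by simp
  have "orthogonal_matrix Q"
    using g unfolding Q_def orthogonal_transformation_matrix by blast
  then have "invertible Q" by (auto simp: orthogonal_matrix_def invertible_def)
  then obtain c where c: "\<And>f :: real^'n \<Rightarrow> ennreal. f \<in> borel_measurable borel \<Longrightarrow>
      (\<integral>\<^sup>+x. f (g x) \<partial>lborel) = c * (\<integral>\<^sup>+x. f x \<partial>lborel)"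
    by (rule nn_integral_lborel_linear) (unfold Q, blast)
  have iso: "g z \<bullet> g z = z \<bullet> z" for z
    using g by (simp add: orthogonal_transformation_def)
  have [measurable]: "g \<in> borel_measurable borel"
    using matrix_vector_mult_measurable[of Q] by (simp add: Q[abs_def])
  have *: "(\<integral>\<^sup>+z. h (g z) \<partial>std_gauss) = c * (\<integral>\<^sup>+z. h z \<partial>std_gauss)"
    if [measurable]: "h \<in> borel_measurable borel" for h :: "real^'n \<Rightarrow> ennreal"
    using c[of "\<lambda>z. ennreal (gaussian_density 0 (mat 1) z) * h z"]
    by (simp add: nn_integral_std_gauss gaussian_density_std iso)
  from *[of "\<lambda>_. 1"] have "c = 1" by (simp add: std_gauss.emeasure_space_1[simplified])
  with *[of f] show ?thesis by simp
qed

text \<open>\<open>ennreal\<close> truncates negative values to 0, so \<open>s = 1\<close> and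
  \<open>s = -1\<close> give the positive and the negative part. Non-integrable functions are
  covered too: both integrals are then 0 by convention.\<close>

lemma integral_eq_of_nn_integral_eq:
  fixes X :: "'a \<Rightarrow> 'c::euclidean_space" and X' :: "'b \<Rightarrow> 'c" and f :: "'c \<Rightarrow> real"
  assumes [measurable]: "X \<in> borel_measurable M" "X' \<in> borel_measurable M'" "f \<in> borel_measurable borel"
    and eq: "\<And>s. s \<in> {1, -1 :: real} \<Longrightarrow>
      (\<integral>\<^sup>+x. ennreal (s * f (X x)) \<partial>M) = (\<integral>\<^sup>+x. ennreal (s * f (X' x)) \<partial>M')"
  shows "integrable M (\<lambda>x. f (X x)) \<longleftrightarrow> integrable M' (\<lambda>x. f (X' x))"
    and "(\<integral>x. f (X x) \<partial>M) = (\<integral>x. f (X' x) \<partial>M')"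
proof -
  show iff: "integrable M (\<lambda>x. f (X x)) \<longleftrightarrow> integrable M' (\<lambda>x. f (X' x))"
    using eq[of 1] eq[of "-1"] by (simp add: real_integrable_def)
  show "(\<integral>x. f (X x) \<partial>M) = (\<integral>x. f (X' x) \<partial>M')"
    using eq[of 1] eq[of "-1"] iff
    by (cases "integrable M (\<lambda>x. f (X x))") (simp_all add: real_lebesgue_integral_def not_integrable_integral_eq)
qed

text \<open>An orthogonal map carries w to w', and \<open>std_gauss\<close> is invariant under it.
  Below, w therefore acts as a mere standard deviation.\<close>

lemma integral_std_gauss_inner_eq:
  fixes w w' :: "real^'n" and f :: "real \<Rightarrow> real"
  assumes "norm w = norm w'" and [measurable]: "f \<in> borel_measurable borel"
  shows "(\<integral>z. f (w \<bullet> z) \<partial>std_gauss) = (\<integral>z. f (w' \<bullet> z) \<partial>std_gauss)"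
proof -
  obtain g where g: "orthogonal_transformation g" "g w = w'"
    using orthogonal_transformation_exists[OF assms(1)] by blast
  have eq: "w' \<bullet> g z = w \<bullet> z" for z
    using g by (metis orthogonal_transformation_def)
  show ?thesis
  proof (rule integral_eq_of_nn_integral_eq(2))
    show "(\<integral>\<^sup>+z. ennreal (s * f (w \<bullet> z)) \<partial>std_gauss) = (\<integral>\<^sup>+z. ennreal (s * f (w' \<bullet> z)) \<partial>std_gauss)" for s
      using nn_integral_std_gauss_orthogonal[OF g(1), of "\<lambda>z. ennreal (s * f (w' \<bullet> z))"] by (simp add: eq)
  qed measurable
qed

section \<open>Laws of the data and of the generator\<close>

lemma nn_integral_std_gauss_uminus:
  assumes [measurable]: "f \<in> borel_measurable (borel :: (real^'n) measure)"
  shows "(\<integral>\<^sup>+z. f (- z) \<partial>std_gauss) = (\<integral>\<^sup>+z. f z \<partial>std_gauss)"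
  by (rule nn_integral_std_gauss_orthogonal) (simp_all add: orthogonal_transformation_def linear_uminus)

text \<open>\<open>X\<close> has the law of \<open>U\<close> multiplied by an independent uniform random sign.\<close>

definition has_symmetrized_law :: "'a measure \<Rightarrow> ('a \<Rightarrow> real^'n) \<Rightarrow> (real^'n \<Rightarrow> real^'n) \<Rightarrow> bool" where
  "has_symmetrized_law M X U \<longleftrightarrow> X \<in> borel_measurable M \<and> U \<in> borel_measurable borel \<and>
     (\<forall>f \<in> borel_measurable borel. (\<integral>\<^sup>+\<omega>. f (X \<omega>) \<partial>M) =
        ennreal (1/2) * (\<integral>\<^sup>+z. f (U z) \<partial>std_gauss) + ennreal (1/2) * (\<integral>\<^sup>+z. f (- U z) \<partial>std_gauss))"

lemma ennreal_half_plus_half: "ennreal (1/2) * x + ennreal (1/2) * x = x"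
proof -
  have "ennreal (1/2) * x + ennreal (1/2) * x = (ennreal (1/2) + ennreal (1/2)) * x"
    by (rule distrib_right[symmetric])
  also have "ennreal (1/2) + ennreal (1/2) = 1" by (subst ennreal_plus[symmetric]) auto
  finally show ?thesis by simp
qed

lemma has_symmetrized_law_nn_integral:
  assumes "has_symmetrized_law M X U" "f \<in> borel_measurable borel"
  shows "(\<integral>\<^sup>+\<omega>. f (X \<omega>) \<partial>M) =
    ennreal (1/2) * (\<integral>\<^sup>+z. f (U z) \<partial>std_gauss) + ennreal (1/2) * (\<integral>\<^sup>+z. f (- U z) \<partial>std_gauss)"
  using assms by (simp only: has_symmetrized_law_def)

lemma has_symmetrized_law_even:
  fixes f :: "real^'n \<Rightarrow> real"
  assumes law: "has_symmetrized_law M X U"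
    and [measurable]: "f \<in> borel_measurable borel" and even: "\<And>x. f (- x) = f x"
  shows "integrable M (\<lambda>\<omega>. f (X \<omega>)) \<longleftrightarrow> integrable std_gauss (\<lambda>z. f (U z))"
    and "(\<integral>\<omega>. f (X \<omega>) \<partial>M) = (\<integral>z. f (U z) \<partial>std_gauss)"
proof -
  have [measurable]: "X \<in> borel_measurable M" "U \<in> borel_measurable borel"
    using law by (auto simp: has_symmetrized_law_def)
  have eq: "(\<integral>\<^sup>+\<omega>. ennreal (s * f (X \<omega>)) \<partial>M) = (\<integral>\<^sup>+z. ennreal (s * f (U z)) \<partial>std_gauss)" for s
    by (subst has_symmetrized_law_nn_integral[OF law, of "\<lambda>x. ennreal (s * f x)"])
       (simp_all only: even ennreal_half_plus_half, measurable)
  have U: "U \<in> borel_measurable std_gauss" by measurable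
  show "integrable M (\<lambda>\<omega>. f (X \<omega>)) \<longleftrightarrow> integrable std_gauss (\<lambda>z. f (U z))"
    and "(\<integral>\<omega>. f (X \<omega>) \<partial>M) = (\<integral>z. f (U z) \<partial>std_gauss)"
    using integral_eq_of_nn_integral_eq[of X M U std_gauss f] U eq by auto
qed

text \<open>X and its negative have the same law, so the integral equals its own negative.\<close>

lemma has_symmetrized_law_odd:
  fixes f :: "real^'n \<Rightarrow> real"
  assumes law: "has_symmetrized_law M X U"
    and [measurable]: "f \<in> borel_measurable borel" and odd: "\<And>x. f (- x) = - f x"
  shows "(\<integral>\<omega>. f (X \<omega>) \<partial>M) = 0"
proof -
  have [measurable]: "X \<in> borel_measurable M" "U \<in> borel_measurable borel"
    using law by (auto simp: has_symmetrized_law_def)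
  have eq: "(\<integral>\<^sup>+\<omega>. ennreal (s * f (X \<omega>)) \<partial>M) = (\<integral>\<^sup>+\<omega>. ennreal (s * f (- X \<omega>)) \<partial>M)" for s
  proof -
    have 1: "(\<lambda>x. ennreal (s * f x)) \<in> borel_measurable borel"
         "(\<lambda>x. ennreal (s * f (- x))) \<in> borel_measurable borel" by measurable
    show ?thesis
      unfolding has_symmetrized_law_nn_integral[OF law 1(1)] has_symmetrized_law_nn_integral[OF law 1(2)]
      by (simp only: minus_minus add.commute)
  qed
  have "(\<integral>\<omega>. f (X \<omega>) \<partial>M) = (\<integral>\<omega>. f (- X \<omega>) \<partial>M)"
    by (rule integral_eq_of_nn_integral_eq(2)) (use eq in auto)
  then show ?thesis by (simp add: odd)
qed

text \<open>The constant K, in fact \<open>1 / \<bar>det \<Lambda>\<bar>\<close>, is identified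
  later with the constant of the linear substitution by normalization.\<close>

lemma gaussian_density_affine:
  fixes \<Lambda> :: "real^'n^'n"
  assumes "invertible \<Lambda>"
  obtains K where "K > 0"
    "\<And>z \<mu>. gaussian_density \<mu> (\<Lambda> ** transpose \<Lambda>) (\<Lambda> *v z + \<mu>) = K * gaussian_density 0 (mat 1) z"
proof -
  let ?\<Sigma> = "\<Lambda> ** transpose \<Lambda>"
  obtain V where V: "\<Lambda> ** V = mat 1" "V ** \<Lambda> = mat 1" using assms by (auto simp: invertible_def)
  have tV: "transpose \<Lambda> ** transpose V = mat 1" "transpose V ** transpose \<Lambda> = mat 1"
    by (simp_all flip: matrix_transpose_mul add: V)
  have "?\<Sigma> ** (transpose V ** V) = \<Lambda> ** (transpose \<Lambda> ** transpose V) ** V"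
    by (simp add: matrix_mul_assoc)
  also have "\<dots> = mat 1" by (simp add: tV V)
  finally have inv: "matrix_inv ?\<Sigma> = transpose V ** V" by (rule matrix_inv_eqI)
  have quad: "(\<Lambda> *v z) \<bullet> (matrix_inv ?\<Sigma> *v (\<Lambda> *v z)) = z \<bullet> z" for z
  proof -
    have "matrix_inv ?\<Sigma> *v (\<Lambda> *v z) = transpose V *v z"
      unfolding inv by (simp add: matrix_vector_mul_assoc matrix_mul_assoc[symmetric] V)
    then show ?thesis
      by (metis V(2) dot_lmul_matrix matrix_vector_mul_assoc matrix_vector_mul_lid transpose_matrix_vector inner_commute)
  qed
  have det: "det ?\<Sigma> > 0"
    using assms by (simp add: det_mul det_transpose invertible_det_nz zero_less_mult_iff linorder_neq_iff) auto
  show thesis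
  proof
    show "sqrt ((2 * pi) ^ CARD('n)) / sqrt ((2 * pi) ^ CARD('n) * det ?\<Sigma>) > 0"
      using det by simp
    show "gaussian_density \<mu> ?\<Sigma> (\<Lambda> *v z + \<mu>)
        = sqrt ((2 * pi) ^ CARD('n)) / sqrt ((2 * pi) ^ CARD('n) * det ?\<Sigma>) * gaussian_density 0 (mat 1) z" for z \<mu>
      by (simp add: gaussian_density_std quad gaussian_density_def[of \<mu>] del: real_sqrt_power)
  qed
qed

lemma gaussian_density_nonneg: "0 \<le> det \<Sigma> \<Longrightarrow> 0 \<le> gaussian_density \<mu> \<Sigma> x"
  by (simp add: gaussian_density_def)

lemma gaussian_density_measurable [measurable]: "gaussian_density \<mu> \<Sigma> \<in> borel_measurable borel"
  unfolding gaussian_density_def[abs_def] by measurable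

lemma symmetric_mixture_has_symmetrized_law:
  fixes \<Lambda> :: "real^'n^'n"
  assumes "prob_space M"
    and X: "distributed M lborel X (\<lambda>x. ennreal (symmetric_mixture_density \<mu> (\<Lambda> ** transpose \<Lambda>) x))"
    and inv: "invertible \<Lambda>"
  shows "has_symmetrized_law M X (\<lambda>z. \<Lambda> *v z + \<mu>)"
proof -
  interpret prob_space M by fact
  let ?\<Sigma> = "\<Lambda> ** transpose \<Lambda>"
  have [measurable]: "X \<in> borel_measurable M" using distributed_measurable[OF X] by simp
  obtain K where K: "K > 0"
    "\<And>z \<mu>. gaussian_density \<mu> ?\<Sigma> (\<Lambda> *v z + \<mu>) = K * gaussian_density 0 (mat 1) z"
    using gaussian_density_affine[OF inv] by blast
  obtain c where c: "\<And>f :: real^'n \<Rightarrow> ennreal. f \<in> borel_measurable borel \<Longrightarrow>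
      (\<integral>\<^sup>+x. f (\<Lambda> *v x) \<partial>lborel) = c * (\<integral>\<^sup>+x. f x \<partial>lborel)"
    by (rule nn_integral_lborel_linear[OF inv]) blast
  have nonneg: "0 \<le> gaussian_density \<nu> ?\<Sigma> x" for \<nu> x
    by (rule gaussian_density_nonneg) (simp add: det_mul det_transpose)
  note trans = nn_integral_lborel_translate
  have comp: "ennreal K * (\<integral>\<^sup>+z. f (\<Lambda> *v z + \<nu>) \<partial>std_gauss)
      = c * (\<integral>\<^sup>+x. ennreal (gaussian_density \<nu> ?\<Sigma> x) * f x \<partial>lborel)"
    if [measurable]: "f \<in> borel_measurable borel" for f :: "real^'n \<Rightarrow> ennreal" and \<nu>
  proof -
    have "ennreal K * (\<integral>\<^sup>+z. f (\<Lambda> *v z + \<nu>) \<partial>std_gauss)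
        = (\<integral>\<^sup>+z. ennreal K * (ennreal (gaussian_density 0 (mat 1) z) * f (\<Lambda> *v z + \<nu>)) \<partial>lborel)"
      by (simp add: nn_integral_std_gauss nn_integral_cmult)
    also have "\<dots> = (\<integral>\<^sup>+z. ennreal (gaussian_density \<nu> ?\<Sigma> (\<Lambda> *v z + \<nu>)) * f (\<Lambda> *v z + \<nu>) \<partial>lborel)"
      using K(1) by (simp add: K(2) ennreal_mult gaussian_density_std_nonneg mult.assoc)
    also have "\<dots> = c * (\<integral>\<^sup>+x. ennreal (gaussian_density \<nu> ?\<Sigma> (x + \<nu>)) * f (x + \<nu>) \<partial>lborel)"
      by (rule c) measurable
    also have "(\<integral>\<^sup>+x. ennreal (gaussian_density \<nu> ?\<Sigma> (x + \<nu>)) * f (x + \<nu>) \<partial>lborel)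
        = (\<integral>\<^sup>+x. ennreal (gaussian_density \<nu> ?\<Sigma> x) * f x \<partial>lborel)"
      using trans[of "\<lambda>x. ennreal (gaussian_density \<nu> ?\<Sigma> x) * f x" \<nu>] by (simp add: add.commute)
    finally show ?thesis .
  qed
  have mix: "ennreal K * (ennreal (1/2) * (\<integral>\<^sup>+z. f (\<Lambda> *v z + \<mu>) \<partial>std_gauss)
        + ennreal (1/2) * (\<integral>\<^sup>+z. f (- (\<Lambda> *v z + \<mu>)) \<partial>std_gauss))
      = c * (\<integral>\<^sup>+\<omega>. f (X \<omega>) \<partial>M)"
    if [measurable]: "f \<in> borel_measurable borel" for f :: "real^'n \<Rightarrow> ennreal"
  proof -
    let ?g = "\<lambda>\<nu> x. ennreal (gaussian_density \<nu> ?\<Sigma> x) * f x"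
    \<comment> \<open>Replacing z by \<open>- z\<close> turns the reflected sample into one with
      mean \<open>- \<mu>\<close>.\<close>
    have refl: "(\<integral>\<^sup>+z. f (- (\<Lambda> *v z + \<mu>)) \<partial>std_gauss) = (\<integral>\<^sup>+z. f (\<Lambda> *v z + - \<mu>) \<partial>std_gauss)"
      using nn_integral_std_gauss_uminus[of "\<lambda>z. f (\<Lambda> *v z + - \<mu>)"]
      by (simp add: linear_neg[OF matrix_vector_mul_linear])
    have "ennreal K * (ennreal (1/2) * (\<integral>\<^sup>+z. f (\<Lambda> *v z + \<mu>) \<partial>std_gauss)
        + ennreal (1/2) * (\<integral>\<^sup>+z. f (\<Lambda> *v z + - \<mu>) \<partial>std_gauss))
        = ennreal (1/2) * (ennreal K * (\<integral>\<^sup>+z. f (\<Lambda> *v z + \<mu>) \<partial>std_gauss))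
        + ennreal (1/2) * (ennreal K * (\<integral>\<^sup>+z. f (\<Lambda> *v z + - \<mu>) \<partial>std_gauss))"
      by (simp only: distrib_left mult_ac)
    also have "\<dots> = ennreal (1/2) * (c * (\<integral>\<^sup>+x. ?g \<mu> x \<partial>lborel)) + ennreal (1/2) * (c * (\<integral>\<^sup>+x. ?g (- \<mu>) x \<partial>lborel))"
      by (simp only: comp[OF that])
    also have "\<dots> = c * (ennreal (1/2) * (\<integral>\<^sup>+x. ?g \<mu> x \<partial>lborel) + ennreal (1/2) * (\<integral>\<^sup>+x. ?g (- \<mu>) x \<partial>lborel))"
      by (simp only: distrib_left mult_ac)
    also have "ennreal (1/2) * (\<integral>\<^sup>+x. ?g \<mu> x \<partial>lborel) + ennreal (1/2) * (\<integral>\<^sup>+x. ?g (- \<mu>) x \<partial>lborel)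
        = (\<integral>\<^sup>+x. ennreal (1/2) * ?g \<mu> x + ennreal (1/2) * ?g (- \<mu>) x \<partial>lborel)"
      by (subst nn_integral_add) (auto simp: nn_integral_cmult)
    also have "\<dots> = (\<integral>\<^sup>+x. ennreal (symmetric_mixture_density \<mu> ?\<Sigma> x) * f x \<partial>lborel)"
      unfolding symmetric_mixture_density_def
      by (intro nn_integral_cong)
         (simp only: ennreal_plus ennreal_mult nonneg distrib_right mult.assoc mult_nonneg_nonneg
           zero_le_divide_1_iff zero_le_numeral)
    also have "\<dots> = (\<integral>\<^sup>+\<omega>. f (X \<omega>) \<partial>M)"
      by (rule distributed_nn_integral[OF X]) simp
    finally show ?thesis by (simp only: refl)
  qed
  \<comment> \<open>Both laws have total mass 1, so testing with the constant function matches the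
    two constants.\<close>
  have "ennreal K = c"
    using mix[of "\<lambda>_. 1"] ennreal_half_plus_half[of 1]
    by (simp add: emeasure_space_1 std_gauss.emeasure_space_1[simplified])
  have "(\<integral>\<^sup>+\<omega>. f (X \<omega>) \<partial>M) = ennreal (1/2) * (\<integral>\<^sup>+z. f (\<Lambda> *v z + \<mu>) \<partial>std_gauss)
        + ennreal (1/2) * (\<integral>\<^sup>+z. f (- (\<Lambda> *v z + \<mu>)) \<partial>std_gauss)"
    if "f \<in> borel_measurable borel" for f :: "real^'n \<Rightarrow> ennreal"
    using mix[OF that] K(1) unfolding \<open>ennreal K = c\<close>[symmetric]
    by (subst (asm) ennreal_mult_cancel_left) auto
  then show ?thesis
    by (simp add: has_symmetrized_law_def)
qed

lemma generator_has_symmetrized_law: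
  fixes Z :: "'w \<Rightarrow> real^'n"
  assumes "prob_space M"
    and Z_law: "distributed M lborel Z (\<lambda>z. ennreal (gaussian_density 0 (mat 1) z))"
    and Y_meas [measurable]: "Y \<in> borel_measurable M"
    and Y_pos: "measure M {\<omega> \<in> space M. Y \<omega> = 1} = 1 / 2"
    and Y_neg: "measure M {\<omega> \<in> space M. Y \<omega> = - 1} = 1 / 2"
    and YZ_indep: "prob_space.indep_set M
                     {Y -` S \<inter> space M | S. S \<in> sets borel}
                     {Z -` S \<inter> space M | S. S \<in> sets borel}"
  shows "has_symmetrized_law M (generator Y Z \<Lambda> \<mu>) (\<lambda>z. \<Lambda> *v z + \<mu>)"
proof -
  interpret prob_space M by fact
  have [measurable]: "Z \<in> borel_measurable M" using distributed_measurable[OF Z_law] by simp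
  have Zd: "distr M borel Z = std_gauss"
    using distributed_distr_eq_density[OF Z_law] unfolding std_gauss_def
    by (simp cong: distr_cong)
  \<comment> \<open>Independence enters here: on an event \<open>Y = c\<close> of probability 1/2
    the law of Z is half of \<open>std_gauss\<close>.\<close>
  have restrict: "(\<integral>\<^sup>+\<omega>. h (Z \<omega>) * indicator {\<omega> \<in> space M. Y \<omega> = c} \<omega> \<partial>M)
      = ennreal (1/2) * (\<integral>\<^sup>+z. h z \<partial>std_gauss)"
    if c: "measure M {\<omega> \<in> space M. Y \<omega> = c} = 1 / 2" and [measurable]: "h \<in> borel_measurable borel"
    for c and h :: "real^'n \<Rightarrow> ennreal"
  proof -
    let ?A = "{\<omega> \<in> space M. Y \<omega> = c}"
    have A: "?A = Y -` {c} \<inter> space M" by auto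
    have [measurable]: "?A \<in> sets M" by measurable
    have "distr (density M (indicator ?A)) borel Z = scale_measure (ennreal (1/2)) std_gauss"
    proof (rule measure_eqI)
      fix S assume "S \<in> sets (distr (density M (indicator ?A)) borel Z)"
      then have S [measurable]: "S \<in> sets borel" by simp
      have "emeasure (distr (density M (indicator ?A)) borel Z) S = emeasure M (?A \<inter> (Z -` S \<inter> space M))"
        by (simp add: emeasure_distr emeasure_density flip: indicator_inter_arith)
      also have "\<dots> = ennreal (prob ?A * prob (Z -` S \<inter> space M))"
        unfolding A emeasure_eq_measure
        by (subst indep_setD[OF YZ_indep _ _]) (use S in \<open>blast intro: borel_singleton sets.empty_sets\<close>, use S in blast, rule refl)
      also have "\<dots> = ennreal (1/2) * ennreal (prob (Z -` S \<inter> space M))"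
        unfolding c by (rule ennreal_mult) auto
      also have "ennreal (prob (Z -` S \<inter> space M)) = emeasure (distr M borel Z) S"
        by (simp add: emeasure_distr emeasure_eq_measure)
      finally show "emeasure (distr (density M (indicator ?A)) borel Z) S
          = emeasure (scale_measure (ennreal (1/2)) std_gauss) S"
        by (simp only: Zd emeasure_scale_measure)
    qed (simp add: sets_std_gauss)
    then have "(\<integral>\<^sup>+z. h z \<partial>distr (density M (indicator ?A)) borel Z) = (\<integral>\<^sup>+z. h z \<partial>scale_measure (ennreal (1/2)) std_gauss)"
      by simp
    then show ?thesis
      by (simp add: nn_integral_distr nn_integral_density nn_integral_scale_measure mult.commute)
  qed
  let ?P = "{\<omega> \<in> space M. Y \<omega> = 1}" and ?N = "{\<omega> \<in> space M. Y \<omega> = - 1}"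
  \<comment> \<open>Y may take further values, but only on a null set, since these two events
    already exhaust the probability.\<close>
  have "prob (?P \<union> ?N) = 1"
    by (subst finite_measure_Union) (auto simp: Y_pos Y_neg)
  then have AE: "AE \<omega> in M. \<omega> \<in> ?P \<union> ?N"
    by (intro AE_prob_1) auto
  have "(\<integral>\<^sup>+\<omega>. f (generator Y Z \<Lambda> \<mu> \<omega>) \<partial>M)
      = ennreal (1/2) * (\<integral>\<^sup>+z. f (\<Lambda> *v z + \<mu>) \<partial>std_gauss)
      + ennreal (1/2) * (\<integral>\<^sup>+z. f (- (\<Lambda> *v z + \<mu>)) \<partial>std_gauss)"
    if [measurable]: "f \<in> borel_measurable borel" for f :: "real^'n \<Rightarrow> ennreal"
  proof -
    have "(\<integral>\<^sup>+\<omega>. f (generator Y Z \<Lambda> \<mu> \<omega>) \<partial>M)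
        = (\<integral>\<^sup>+\<omega>. f (\<Lambda> *v Z \<omega> + \<mu>) * indicator ?P \<omega> + f (- (\<Lambda> *v Z \<omega> + \<mu>)) * indicator ?N \<omega> \<partial>M)"
      using AE by (intro nn_integral_cong_AE) (auto simp: indicator_def generator_def)
    also have "\<dots> = (\<integral>\<^sup>+\<omega>. f (\<Lambda> *v Z \<omega> + \<mu>) * indicator ?P \<omega> \<partial>M)
        + (\<integral>\<^sup>+\<omega>. f (- (\<Lambda> *v Z \<omega> + \<mu>)) * indicator ?N \<omega> \<partial>M)"
      by (rule nn_integral_add) auto
    also have "\<dots> = ennreal (1/2) * (\<integral>\<^sup>+z. f (\<Lambda> *v z + \<mu>) \<partial>std_gauss)
        + ennreal (1/2) * (\<integral>\<^sup>+z. f (- (\<Lambda> *v z + \<mu>)) \<partial>std_gauss)"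
      by (intro arg_cong2[where f = "(+)"] restrict[OF Y_pos, of "\<lambda>z. f (\<Lambda> *v z + \<mu>)"]
          restrict[OF Y_neg, of "\<lambda>z. f (- (\<Lambda> *v z + \<mu>))"]) measurable
    finally show ?thesis .
  qed
  then show ?thesis
    by (simp add: has_symmetrized_law_def generator_def[abs_def])
qed

section \<open>Hyperbolic functions\<close>

text \<open>The derivative of \<open>tanh\<close>, written as a polynomial in \<open>tanh\<close> so
  that identities between such products become polynomial ones.\<close>

definition sech_sq :: "real \<Rightarrow> real" where
  "sech_sq x = 1 - (tanh x)\<^sup>2"

lemma tanh_measurable [measurable]: "(tanh :: real \<Rightarrow> real) \<in> borel_measurable borel"
  by (intro borel_measurable_continuous_onI continuous_intros) (simp add: cosh_real_nonzero)

lemma sech_sq_measurable [measurable]: "sech_sq \<in> borel_measurable borel"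
  unfolding sech_sq_def[abs_def] by measurable

lemma sech_sq_minus [simp]: "sech_sq (- x) = sech_sq x"
  by (simp add: sech_sq_def)

lemma abs_tanh_le_1: "\<bar>tanh x\<bar> \<le> (1::real)"
  using tanh_real_lt_1[of x] tanh_real_gt_neg1[of x] by linarith

lemma sech_sq_eq: "sech_sq x = 1 / (cosh x)\<^sup>2"
proof -
  have "(cosh x)\<^sup>2 \<noteq> 0" using cosh_real_pos[of x] by simp
  then have "sech_sq x * (cosh x)\<^sup>2 = (cosh x)\<^sup>2 - (sinh x)\<^sup>2"
    by (simp add: sech_sq_def tanh_def power_divide left_diff_distrib)
  then show ?thesis
    using \<open>(cosh x)\<^sup>2 \<noteq> 0\<close> by (simp add: nonzero_eq_divide_eq hyperbolic_pythagoras)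
qed

lemma sech_sq_pos: "0 < sech_sq x"
  using cosh_real_pos[of x] by (simp add: sech_sq_eq)

lemma sech_sq_le_1: "sech_sq x \<le> 1"
  by (simp add: sech_sq_def)

lemma has_field_derivative_tanh_sech_sq:
  "(tanh has_real_derivative sech_sq x) (at x)"
  unfolding sech_sq_def by (auto intro!: derivative_eq_intros simp: cosh_real_nonzero)

lemma has_field_derivative_tanh_chain [derivative_intros]:
  "(g has_real_derivative g') (at x within S) \<Longrightarrow>
    ((\<lambda>x. tanh (g x :: real)) has_real_derivative sech_sq (g x) * g') (at x within S)"
  by (rule DERIV_chain2[OF has_field_derivative_tanh_sech_sq])

lemma has_field_derivative_sech_sq [derivative_intros]:
  "(g has_real_derivative g') (at x within S) \<Longrightarrow>
    ((\<lambda>x. sech_sq (g x)) has_real_derivative - 2 * tanh (g x) * sech_sq (g x) * g') (at x within S)"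
  unfolding sech_sq_def[abs_def]
  by (auto intro!: derivative_eq_intros simp: cosh_real_nonzero sech_sq_def)

lemma has_field_derivative_ln_cosh [derivative_intros]:
  "(g has_real_derivative g') (at x within S) \<Longrightarrow>
    ((\<lambda>x. ln (cosh (g x :: real))) has_real_derivative tanh (g x) * g') (at x within S)"
  by (auto intro!: derivative_eq_intros simp: cosh_real_pos tanh_def)

lemma abs_sinh_ge: "\<bar>x\<bar> \<le> \<bar>sinh x :: real\<bar>"
proof -
  have *: "x \<le> sinh x" if "0 \<le> x" for x :: real
  proof -
    have "sinh 0 - 0 \<le> sinh x - x"
      by (rule DERIV_nonneg_imp_nondecreasing[OF that, of "\<lambda>x. sinh x - x"])
         (auto intro!: exI derivative_eq_intros simp: cosh_real_ge_1)
    then show ?thesis by simp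
  qed
  show ?thesis using *[of x] *[of "- x"] by (cases "0 \<le> x") auto
qed

text \<open>\<open>(cosh x)\<^sup>2 = 1 + (sinh x)\<^sup>2\<close> combined with
  \<open>\<bar>x\<bar> \<le> \<bar>sinh x\<bar>\<close>. It bounds \<open>x * sech_sq x\<close> and
  \<open>x\<^sup>2 * sech_sq x\<close>, and through them the kernel and its ingredients.\<close>

lemma sech_sq_quadratic_bound: "(1 + x\<^sup>2) * sech_sq x \<le> 1"
proof -
  have "x\<^sup>2 \<le> (sinh x)\<^sup>2" using abs_sinh_ge[of x] by (simp add: abs_le_square_iff)
  then have "1 + x\<^sup>2 \<le> (cosh x)\<^sup>2" by (simp add: cosh_square_eq)
  then show ?thesis using cosh_real_pos[of x] by (simp add: sech_sq_eq divide_le_eq_1)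
qed

lemma square_sech_sq_le_1: "x\<^sup>2 * sech_sq x \<le> 1"
  using sech_sq_quadratic_bound[of x] sech_sq_pos[of x] by (simp add: algebra_simps)

lemma abs_sech_sq_le_1: "\<bar>x\<bar> * sech_sq x \<le> 1"
proof -
  have "\<bar>x\<bar> \<le> 1 + x\<^sup>2"
    using le_one_add_square[of "\<bar>x\<bar>"] by simp
  then have "\<bar>x\<bar> * sech_sq x \<le> (1 + x\<^sup>2) * sech_sq x"
    using sech_sq_pos[of x] by (intro mult_right_mono) auto
  with sech_sq_quadratic_bound[of x] show ?thesis by linarith
qed

lemma tanh_le_self: "0 \<le> x \<Longrightarrow> tanh x \<le> (x::real)"
proof -
  assume "0 \<le> x"
  have "tanh 0 - 0 \<ge> tanh x - x"
    by (rule DERIV_nonpos_imp_nonincreasing[OF \<open>0 \<le> x\<close>, of "\<lambda>x. tanh x - x"])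
       (auto intro!: exI derivative_eq_intros simp: sech_sq_le_1)
  then show ?thesis by simp
qed

lemma abs_tanh_le_abs: "\<bar>tanh x\<bar> \<le> \<bar>x::real\<bar>"
  using tanh_le_self[of x] tanh_le_self[of "- x"] by (cases "0 \<le> x") auto

lemma tanh_square_le: "(tanh x)\<^sup>2 \<le> x * tanh (x::real)"
proof -
  have "(tanh x)\<^sup>2 = \<bar>tanh x\<bar> * \<bar>tanh x\<bar>" by (simp add: power2_eq_square)
  also have "\<dots> \<le> \<bar>x\<bar> * \<bar>tanh x\<bar>" by (intro mult_right_mono abs_tanh_le_abs) auto
  also have "\<dots> = x * tanh x" by (cases "0 \<le> x") auto
  finally show ?thesis .
qed

text \<open>Multiplication by \<open>sinh (2 * x)\<close> clears \<open>sech_sq\<close>; this makes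
  the weight with the factor 2 computable.\<close>

lemma sinh_double_sech_sq: "sinh (2 * x) * sech_sq x = 2 * tanh (x::real)"
  using cosh_real_pos[of x] by (simp add: sinh_double sech_sq_eq tanh_def power2_eq_square)

lemma tanh_sinh_double: "tanh x * sinh (2 * x) = cosh (2 * x) - (1::real)"
  using cosh_real_pos[of x] cosh_square_eq[of x]
  by (simp add: sinh_double tanh_def cosh_double power2_eq_square)

text \<open>Stein's identity for \<open>gap_factor\<close> turns the integrand of \<open>stein_gap\<close> below into \<open>gap_kernel v\<close>,
  where \<open>v\<close> is the variance.\<close>

definition gap_factor :: "real \<Rightarrow> real" where "gap_factor x = sech_sq x * (x * tanh x - 1)"
definition gap_factor_deriv :: "real \<Rightarrow> real" where
  "gap_factor_deriv x = sech_sq x * (3 * tanh x + x * sech_sq x - 2 * x * (tanh x)\<^sup>2)"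
definition gap_kernel :: "real \<Rightarrow> real \<Rightarrow> real" where
  "gap_kernel v x = tanh x + x * sech_sq x + 2 * x * gap_factor x - 2 * v * gap_factor_deriv x"

lemma gap_factor_measurable [measurable]: "gap_factor \<in> borel_measurable borel"
  unfolding gap_factor_def[abs_def] by measurable
lemma gap_factor_deriv_measurable [measurable]: "gap_factor_deriv \<in> borel_measurable borel"
  unfolding gap_factor_deriv_def[abs_def] by measurable
lemma gap_kernel_measurable [measurable]: "gap_kernel v \<in> borel_measurable borel"
  unfolding gap_kernel_def[abs_def] by measurable

lemma gap_kernel_minus: "gap_kernel v (- x) = - gap_kernel v x"
  by (simp add: gap_kernel_def gap_factor_def gap_factor_deriv_def algebra_simps)

lemma gap_factor_has_derivative: "(gap_factor has_real_derivative gap_factor_deriv x) (at x)"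
  unfolding gap_factor_def[abs_def] gap_factor_deriv_def
  by (auto intro!: derivative_eq_intros simp: algebra_simps power2_eq_square)

lemma abs_mult_tanh_le: "\<bar>a * tanh x\<bar> \<le> \<bar>a::real\<bar>"
  using mult_left_mono[OF abs_tanh_le_1[of x], of "\<bar>a\<bar>"] by (simp add: abs_mult)

lemma gap_factor_bound: "\<bar>gap_factor x\<bar> \<le> 2"
proof -
  have "\<bar>x * sech_sq x * tanh x\<bar> \<le> 1"
    using abs_mult_tanh_le[of "x * sech_sq x" x] abs_sech_sq_le_1[of x] sech_sq_pos[of x]
    by (simp only: abs_mult abs_of_pos)
  moreover have "gap_factor x = x * sech_sq x * tanh x - sech_sq x"
    by (simp add: gap_factor_def algebra_simps)
  ultimately show ?thesis using sech_sq_pos[of x] sech_sq_le_1[of x] by linarith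
qed

lemma gap_factor_deriv_bound: "\<bar>gap_factor_deriv x\<bar> \<le> 6"
proof -
  have s: "0 \<le> sech_sq x" "sech_sq x \<le> 1" using sech_sq_pos[of x] sech_sq_le_1[of x] by auto
  have 1: "\<bar>sech_sq x * tanh x\<bar> \<le> 1" using abs_mult_tanh_le[of "sech_sq x" x] s by linarith
  have 2: "\<bar>x * sech_sq x * sech_sq x\<bar> \<le> 1"
    using mult_mono[OF abs_sech_sq_le_1[of x] s(2)] s by (simp add: abs_mult)
  have "\<bar>x * sech_sq x\<bar> \<le> 1" using abs_sech_sq_le_1[of x] s by (simp add: abs_mult)
  then have 3: "\<bar>x * sech_sq x * tanh x * tanh x\<bar> \<le> 1"
    using abs_mult_tanh_le[of "x * sech_sq x * tanh x" x] abs_mult_tanh_le[of "x * sech_sq x" x] by linarith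
  have "gap_factor_deriv x = 3 * (sech_sq x * tanh x) + x * sech_sq x * sech_sq x - 2 * (x * sech_sq x * tanh x * tanh x)"
    by (simp add: gap_factor_deriv_def algebra_simps power2_eq_square)
  then show ?thesis using 1 2 3 by linarith
qed

lemma gap_kernel_bound: "\<bar>gap_kernel v x\<bar> \<le> 6 + 12 * \<bar>v\<bar>"
proof -
  have s: "0 \<le> sech_sq x" "sech_sq x \<le> 1" using sech_sq_pos[of x] sech_sq_le_1[of x] by auto
  have 1: "\<bar>x * sech_sq x\<bar> \<le> 1" using abs_sech_sq_le_1[of x] s by (simp add: abs_mult)
  have 2: "\<bar>x\<^sup>2 * sech_sq x * tanh x\<bar> \<le> 1"
    using abs_mult_tanh_le[of "x\<^sup>2 * sech_sq x" x] square_sech_sq_le_1[of x] s by simp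
  have 3: "\<bar>v * gap_factor_deriv x\<bar> \<le> \<bar>v\<bar> * 6"
    by (simp add: abs_mult gap_factor_deriv_bound mult_left_mono)
  have "gap_kernel v x = tanh x + x * sech_sq x + 2 * (x\<^sup>2 * sech_sq x * tanh x) - 2 * (x * sech_sq x) - 2 * (v * gap_factor_deriv x)"
    by (simp add: gap_kernel_def gap_factor_def algebra_simps power2_eq_square)
  then show ?thesis using abs_tanh_le_1[of x] 1 2 3 by linarith
qed

section \<open>Monotonicity of hyperbolic quotients\<close>

lemma tanh_over_self_antimono:
  assumes "0 < x" "x \<le> y" shows "tanh y / y \<le> tanh x / (x::real)"
proof (rule DERIV_nonpos_imp_nonincreasing[OF assms(2)])
  fix u assume "x \<le> u" "u \<le> y"
  with assms have u: "0 < u" by linarith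
  \<comment> \<open>The numerator of the derivative is \<open>u * sech_sq u - tanh u\<close>; its
    sign follows from this inequality multiplied by \<open>sech_sq u\<close>.\<close>
  have "2 * u \<le> sinh (2 * u)" using abs_sinh_ge[of "2 * u"] u by simp
  then have "2 * u * sech_sq u \<le> sinh (2 * u) * sech_sq u"
    using sech_sq_pos[of u] by (intro mult_right_mono) auto
  then have "sech_sq u * u - tanh u \<le> 0" unfolding sinh_double_sech_sq by (simp add: algebra_simps)
  moreover have "((\<lambda>x. tanh x / x) has_real_derivative (sech_sq u * u - tanh u) / (u * u)) (at u)"
    using u by (auto intro!: derivative_eq_intros)
  ultimately show "\<exists>D. ((\<lambda>x. tanh x / x) has_real_derivative D) (at u) \<and> D \<le> 0"
    by (meson divide_nonpos_nonneg zero_le_square)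
qed

lemma sinh_over_self_mono:
  assumes "0 < x" "x \<le> y" shows "sinh x / (x::real) \<le> sinh y / y"
proof (rule DERIV_nonneg_imp_nondecreasing[OF assms(2)])
  fix u assume "x \<le> u" "u \<le> y"
  with assms have u: "0 < u" by linarith
  have "tanh u * cosh u \<le> u * cosh u"
    using tanh_le_self[of u] u cosh_real_pos[of u] by (intro mult_right_mono) auto
  then have "0 \<le> cosh u * u - sinh u" using cosh_real_pos[of u] by (simp add: tanh_def mult.commute)
  moreover have "((\<lambda>x. sinh x / x) has_real_derivative (cosh u * u - sinh u) / (u * u)) (at u)"
    using u by (auto intro!: derivative_eq_intros)
  ultimately show "\<exists>D. ((\<lambda>x. sinh x / x) has_real_derivative D) (at u) \<and> 0 \<le> D"
    by (meson divide_nonneg_nonneg zero_le_square)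
qed

text \<open>The kernel divided by the positive factor \<open>x * sech_sq x\<close>, meant for x > 0;
  the first term comes from \<open>tanh x / sech_sq x = sinh (2 * x) / 2\<close>.\<close>

definition gap_kernel_quotient :: "real \<Rightarrow> real \<Rightarrow> real" where
  "gap_kernel_quotient v x = sinh (2 * x) / (2 * x) - 1 + 2 * (x * tanh x) - v * (6 * (tanh x / x) - 4 + 6 * sech_sq x)"

lemma gap_kernel_eq: "x > 0 \<Longrightarrow> gap_kernel v x = sech_sq x * x * gap_kernel_quotient v x"
proof -
  assume x: "x > 0"
  have "sech_sq x * x * gap_kernel_quotient v x = sinh (2 * x) * sech_sq x / 2 - sech_sq x * x + 2 * x\<^sup>2 * sech_sq x * tanh x
      - v * sech_sq x * (6 * tanh x - 4 * x + 6 * x * sech_sq x)"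
    using x by (simp add: gap_kernel_quotient_def field_simps power2_eq_square)
  also have "\<dots> = tanh x - sech_sq x * x + 2 * x\<^sup>2 * sech_sq x * tanh x
      - v * sech_sq x * (6 * tanh x - 4 * x + 6 * x * sech_sq x)"
    by (simp only: sinh_double_sech_sq)
  also have "\<dots> = gap_kernel v x"
  proof -
    have t: "(tanh x)\<^sup>2 = 1 - sech_sq x" by (simp add: sech_sq_def)
    show ?thesis
      unfolding gap_kernel_def gap_factor_def gap_factor_deriv_def t by (simp add: algebra_simps power2_eq_square)
  qed
  finally show ?thesis by simp
qed

text \<open>Termwise: \<open>sinh (2 * x) / (2 * x)\<close> and \<open>x * tanh x\<close> increase,
  while \<open>tanh x / x\<close> and \<open>sech_sq x\<close> decrease and carry the factor
  \<open>- v\<close>.\<close>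

lemma gap_kernel_quotient_mono:
  assumes "0 \<le> v" "0 < x" "x \<le> y" shows "gap_kernel_quotient v x \<le> gap_kernel_quotient v y"
proof -
  have t: "tanh x \<le> tanh y" "0 \<le> tanh x" using assms by auto
  have "sinh (2 * x) / (2 * x) \<le> sinh (2 * y) / (2 * y)" using assms by (intro sinh_over_self_mono) auto
  moreover have "x * tanh x \<le> y * tanh y" using assms t by (intro mult_mono) auto
  moreover have "v * (6 * (tanh y / y) - 4 + 6 * sech_sq y) \<le> v * (6 * (tanh x / x) - 4 + 6 * sech_sq x)"
  proof (rule mult_left_mono[OF _ assms(1)])
    have "sech_sq y \<le> sech_sq x" using t by (simp add: sech_sq_def power_mono)
    then show "6 * (tanh y / y) - 4 + 6 * sech_sq y \<le> 6 * (tanh x / x) - 4 + 6 * sech_sq x"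
      using tanh_over_self_antimono[OF assms(2,3)] by linarith
  qed
  ultimately show ?thesis unfolding gap_kernel_quotient_def by linarith
qed

text \<open>The numerator \<open>?P\<close> of the derivative vanishes at 0, and its own derivative
  \<open>(a\<^sup>2 - 2\<^sup>2) * (sinh (a * r) * sinh (2 * r))\<close> is nonnegative.\<close>

lemma sinh_ratio_mono:
  fixes a x y :: real
  assumes "2 \<le> a" "0 < x" "x \<le> y"
  shows "sinh (a * x) / sinh (2 * x) \<le> sinh (a * y) / sinh (2 * y)"
proof (rule DERIV_nonneg_imp_nondecreasing[OF assms(3)])
  fix u assume "x \<le> u" "u \<le> y"
  with assms have u: "0 < u" by linarith
  let ?P = "\<lambda>u. a * cosh (a * u) * sinh (2 * u) - 2 * sinh (a * u) * cosh (2 * u)"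
  have "?P 0 \<le> ?P u"
  proof (rule DERIV_nonneg_imp_nondecreasing[where f = ?P])
    fix r assume r: "0 \<le> r" "r \<le> u"
    have "(?P has_real_derivative (a\<^sup>2 - 2\<^sup>2) * (sinh (a * r) * sinh (2 * r))) (at r)"
      by (auto intro!: derivative_eq_intros simp: algebra_simps power2_eq_square)
    moreover have "0 \<le> (a\<^sup>2 - 2\<^sup>2) * (sinh (a * r) * sinh (2 * r))"
      using assms(1) r power_mono[of 2 a 2] by (intro mult_nonneg_nonneg) auto
    ultimately show "\<exists>D. (?P has_real_derivative D) (at r) \<and> 0 \<le> D" by blast
  qed (use u in simp)
  then have "0 \<le> ?P u" by simp
  moreover have "((\<lambda>x. sinh (a * x) / sinh (2 * x)) has_real_derivative
      ?P u / (sinh (2 * u) * sinh (2 * u))) (at u)"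
    using u by (auto intro!: derivative_eq_intros simp: algebra_simps)
  ultimately show "\<exists>D. ((\<lambda>x. sinh (a * x) / sinh (2 * x)) has_real_derivative D) (at u) \<and> 0 \<le> D"
    by (meson divide_nonneg_nonneg zero_le_square)
qed

section \<open>The key inequality for separable Gaussians\<close>

lemma sinh_measurable [measurable]: "(sinh :: real \<Rightarrow> real) \<in> borel_measurable borel"
  by (intro borel_measurable_continuous_onI continuous_intros)

lemma integrable_std_gauss_lipschitz:
  assumes deriv: "\<And>x. (f has_real_derivative f' x) (at x)"
    and bound: "\<And>x. \<bar>f' x\<bar> \<le> B"
  shows "integrable std_gauss (\<lambda>z. f (m + w \<bullet> z))"
proof (rule integrable_std_gauss_dominated)
  have "continuous_on UNIV f"
    using deriv DERIV_isCont by (blast intro: continuous_at_imp_continuous_on)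
  then have [measurable]: "f \<in> borel_measurable borel"
    by (rule borel_measurable_continuous_onI)
  show "(\<lambda>z. f (m + w \<bullet> z)) \<in> borel_measurable borel" by measurable
  have B: "0 \<le> B" using bound[of 0] by linarith
  show "\<bar>f (m + w \<bullet> z)\<bar> \<le> (\<bar>f m\<bar> + B) * exp (\<bar>w \<bullet> z\<bar> + \<bar>0 \<bullet> z\<bar>)" for z
    using bounded_derivative_imp_lipschitz[OF deriv bound, of "m + w \<bullet> z" m]
      affine_le_exp_abs[of "\<bar>f m\<bar>" B "w \<bullet> z"] B by simp
qed

text \<open>Expressed in \<open>sech_sq\<close> alone, so that Stein's identity leads back to the
  first two moments of \<open>sech_sq\<close>.\<close>

lemma has_field_derivative_tanh_sech_sq':
  "((\<lambda>x. tanh x * sech_sq x) has_real_derivative 3 * (sech_sq x)\<^sup>2 - 2 * sech_sq x) (at x)"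
proof -
  have "((\<lambda>x. tanh x * sech_sq x) has_real_derivative
      sech_sq x * sech_sq x - 2 * (tanh x)\<^sup>2 * sech_sq x) (at x)"
    by (auto intro!: derivative_eq_intros simp: power2_eq_square)
  moreover have "(tanh x)\<^sup>2 = 1 - sech_sq x" by (simp add: sech_sq_def)
  then have "sech_sq x * sech_sq x - 2 * (tanh x)\<^sup>2 * sech_sq x = 3 * (sech_sq x)\<^sup>2 - 2 * sech_sq x"
    by (simp only:) (simp add: power2_eq_square algebra_simps)
  ultimately show ?thesis by simp
qed

lemma mult_tanh_deriv:
  "((\<lambda>x. x * tanh x) has_real_derivative tanh x + x * sech_sq x) (at x)"
  by (auto intro!: derivative_eq_intros)

lemma abs_tanh_add_bound: "\<bar>tanh x + x * sech_sq x\<bar> \<le> 2"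
  using abs_tanh_le_1[of x] abs_sech_sq_le_1[of x] sech_sq_pos[of x]
  by (intro order_trans[OF abs_triangle_ineq]) (simp add: abs_mult)

text \<open>The weight turns the integrand into \<open>cosh (2 * x)\<close> plus products of x,
  \<open>tanh\<close> and \<open>sech_sq\<close>. Stein's identity then reduces the integral to
  \<open>exp (2 * v)\<close> and the expectations of \<open>sech_sq\<close> and its square, for
  which elementary bounds suffice.\<close>

lemma integral_gap_kernel_sinh_double_pos:
  fixes w :: "real^'n"
  assumes "w \<noteq> 0"
  shows "0 < (\<integral>z. gap_kernel (w \<bullet> w) (w \<bullet> z) * sinh (2 * (w \<bullet> z)) \<partial>std_gauss)"
proof -
  define v where "v = w \<bullet> w"
  have v: "0 < v" using assms by (simp add: v_def)
  define E where "E h = (\<integral>z. h (w \<bullet> z) \<partial>std_gauss)" for h :: "real \<Rightarrow> real"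
  define I where "I h \<longleftrightarrow> integrable std_gauss (\<lambda>z. h (w \<bullet> z))" for h :: "real \<Rightarrow> real"
  have I_bounded: "I h" if "h \<in> borel_measurable borel" "\<And>x. \<bar>h x\<bar> \<le> C" for h C
    unfolding I_def by (rule integrable_std_gauss_bounded[where C = C]) (use that in auto)
  have I_add: "I (\<lambda>x. f x + g x)" "E (\<lambda>x. f x + g x) = E f + E g" if "I f" "I g" for f g
    using that by (auto simp: I_def E_def)
  have I_cmult: "I (\<lambda>x. c * f x)" "E (\<lambda>x. c * f x) = c * E f" if "I f" for c f
    using that by (auto simp: I_def E_def)
  have E1: "E (\<lambda>x. 1) = 1" and I1: "I (\<lambda>x. 1)"
    by (auto simp: E_def I_def std_gauss.prob_space[simplified])
  have stein: "E (\<lambda>x. x * f x) = v * E f'" "I (\<lambda>x. x * f x)"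
    if "\<And>x. (f has_real_derivative f' x) (at x)" "\<And>x. \<bar>f' x\<bar> \<le> B" "f' \<in> borel_measurable borel"
    for f f' B
    using std_gauss_stein[OF that, of w 0 w] by (simp_all add: E_def I_def v_def)
  let ?s = sech_sq
  have s01: "0 \<le> ?s x" "?s x \<le> 1" for x using sech_sq_pos[of x] sech_sq_le_1[of x] by auto
  have s2: "0 \<le> (?s x)\<^sup>2" "(?s x)\<^sup>2 \<le> ?s x" for x
    using s01[of x] by (auto simp: power2_eq_square mult_left_le)
  have Is: "I ?s" by (rule I_bounded[where C = 1]) (use s01 in \<open>auto simp: abs_le_iff\<close>)
  have Is2: "I (\<lambda>x. (?s x)\<^sup>2)"
    by (rule I_bounded[where C = 1]) (use s01 s2 in \<open>auto intro: order_trans\<close>)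
  have xt: "E (\<lambda>x. x * tanh x) = v * E ?s" "I (\<lambda>x. x * tanh x)"
    using stein[OF has_field_derivative_tanh_sech_sq, of 1] s01 by auto
  have bd: "\<bar>3 * (?s x)\<^sup>2 - 2 * ?s x\<bar> \<le> 3" for x
    using s01[of x] s2[of x] by linarith
  have xts: "E (\<lambda>x. x * (tanh x * ?s x)) = v * E (\<lambda>x. 3 * (?s x)\<^sup>2 + (-2) * ?s x)"
      "I (\<lambda>x. x * (tanh x * ?s x))"
    using stein[OF has_field_derivative_tanh_sech_sq' bd] by simp_all
  have "E (\<lambda>x. 3 * (?s x)\<^sup>2 + (-2) * ?s x) = 3 * E (\<lambda>x. (?s x)\<^sup>2) + (-2) * E ?s"
    by (simp only: I_add I_cmult Is Is2)
  with xts have xts': "E (\<lambda>x. x * (tanh x * ?s x)) = v * (3 * E (\<lambda>x. (?s x)\<^sup>2) - 2 * E ?s)"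
    by simp
  \<comment> \<open>Collects the terms that cancel: by Stein \<open>2 * (x * f1 x)\<close>
    contributes \<open>2 * v * E f1'\<close>, and the remaining part of the integrand contains
    exactly \<open>- 2 * v * f1'\<close>.\<close>
  define f1 where "f1 x = 2 * tanh x * (x * tanh x - 1)" for x :: real
  define f1' where "f1' x = 2 * ?s x * (x * tanh x - 1) + 2 * tanh x * (tanh x + x * ?s x)" for x
  have f1: "(f1 has_real_derivative f1' x) (at x)" for x
    unfolding f1_def[abs_def] f1'_def by (auto intro!: derivative_eq_intros simp: algebra_simps)
  have f1'_bound: "\<bar>f1' x\<bar> \<le> 8" for x
  proof -
    have 1: "\<bar>x * ?s x * tanh x\<bar> \<le> 1"
      using abs_mult_tanh_le[of "x * ?s x" x] abs_sech_sq_le_1[of x] s01[of x] by (simp add: abs_mult)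
    have 2: "\<bar>(tanh x + x * ?s x) * tanh x\<bar> \<le> 2"
      using abs_mult_tanh_le[of "tanh x + x * ?s x" x] abs_tanh_add_bound[of x] by linarith
    have "f1' x = 2 * (x * ?s x * tanh x) - 2 * ?s x + 2 * ((tanh x + x * ?s x) * tanh x)"
      by (simp add: f1'_def algebra_simps)
    then show ?thesis using 1 2 s01[of x] by linarith
  qed
  have [measurable]: "f1' \<in> borel_measurable borel" unfolding f1'_def[abs_def] by measurable
  have xf1: "E (\<lambda>x. x * f1 x) = v * E f1'" "I (\<lambda>x. x * f1 x)"
    using stein[OF f1 f1'_bound] by auto
  have If1': "I f1'" by (rule I_bounded[OF _ f1'_bound]) simp
  have C: "I (\<lambda>x. cosh (2 * x))" "E (\<lambda>x. cosh (2 * x)) = exp (2 * v)"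
  proof -
    have eq: "cosh (2 * (w \<bullet> z)) = exp ((2 *\<^sub>R w) \<bullet> z) / 2 + exp ((- 2 *\<^sub>R w) \<bullet> z) / 2" for z
      by (simp add: cosh_def field_simps)
    show "I (\<lambda>x. cosh (2 * x))"
      unfolding I_def eq
      by (intro Bochner_Integration.integrable_add integrable_divide integrable_std_gauss_exp_inner)
    have "E (\<lambda>x. cosh (2 * x)) = exp ((2 *\<^sub>R w) \<bullet> (2 *\<^sub>R w) / 2) / 2 + exp ((- 2 *\<^sub>R w) \<bullet> (- 2 *\<^sub>R w) / 2) / 2"
      unfolding E_def eq
      by (subst Bochner_Integration.integral_add)
         (simp_all only: integral_divide_zero integral_std_gauss_exp_inner integrable_divide integrable_std_gauss_exp_inner)
    then show "E (\<lambda>x. cosh (2 * x)) = exp (2 * v)" by (simp add: v_def)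
  qed
  have pw: "gap_kernel v x * sinh (2 * x) = cosh (2 * x) + (-1) * 1 + 2 * (x * tanh x) + 2 * (x * f1 x)
      + (2 * v) * ((-1) * f1' x + 4 * (x * tanh x) + (-2) * (x * (tanh x * ?s x)) + 2 * ?s x + (-4) * 1)" for x
  proof -
    let ?t = "tanh x"
    have t2: "?s x = 1 - ?t\<^sup>2" by (simp add: sech_sq_def)
    have "gap_kernel v x * sinh (2 * x) = ?t * sinh (2 * x) + (sinh (2 * x) * ?s x) * (x + 2 * x * (x * ?t - 1)
        - 2 * v * (3 * ?t + x * ?s x - 2 * x * ?t\<^sup>2))"
      by (simp add: gap_kernel_def gap_factor_def gap_factor_deriv_def algebra_simps)
    also have "\<dots> = cosh (2 * x) - 1 + 2 * ?t * (x + 2 * x * (x * ?t - 1)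
        - 2 * v * (3 * ?t + x * ?s x - 2 * x * ?t\<^sup>2))"
      by (simp only: sinh_double_sech_sq tanh_sinh_double)
    also have "\<dots> = cosh (2 * x) + (-1) * 1 + 2 * (x * tanh x) + 2 * (x * f1 x)
      + (2 * v) * ((-1) * f1' x + 4 * (x * tanh x) + (-2) * (x * (tanh x * ?s x)) + 2 * ?s x + (-4) * 1)"
      unfolding f1_def f1'_def t2 by (simp add: algebra_simps power2_eq_square)
    finally show ?thesis .
  qed
  have "E (\<lambda>x. gap_kernel v x * sinh (2 * x)) = exp (2 * v) + (-1) * 1 + 2 * (v * E ?s) + 2 * (v * E f1')
      + (2 * v) * ((-1) * E f1' + 4 * (v * E ?s) + (-2) * (v * (3 * E (\<lambda>x. (?s x)\<^sup>2) - 2 * E ?s)) + 2 * E ?s + (-4) * 1)"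
    unfolding pw
    by (simp only: I_add I_cmult I1 E1 C xt xts' xts(2) xf1 Is If1')
  also have "\<dots> = exp (2 * v) - 1 - 8 * v + (6 * v + 16 * v\<^sup>2) * E ?s - 12 * v\<^sup>2 * E (\<lambda>x. (?s x)\<^sup>2)"
    by (simp add: algebra_simps power2_eq_square)
  finally have J: "E (\<lambda>x. gap_kernel v x * sinh (2 * x))
      = exp (2 * v) - 1 - 8 * v + (6 * v + 16 * v\<^sup>2) * E ?s - 12 * v\<^sup>2 * E (\<lambda>x. (?s x)\<^sup>2)" .
  have "E (\<lambda>x. (?s x)\<^sup>2) \<le> E ?s"
    unfolding E_def using Is Is2 s2 by (intro integral_mono) (auto simp: I_def)
  then have "12 * v\<^sup>2 * E (\<lambda>x. (?s x)\<^sup>2) \<le> 12 * v\<^sup>2 * E ?s" by (intro mult_left_mono) auto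
  with J have J2: "exp (2 * v) - 1 - 8 * v + (6 * v + 4 * v\<^sup>2) * E ?s \<le> E (\<lambda>x. gap_kernel v x * sinh (2 * x))"
    by (simp add: algebra_simps)
  \<comment> \<open>A lower bound for \<open>E ?s\<close>:
    \<open>1 - ?s x = (tanh x)\<^sup>2 \<le> x * tanh x\<close>, and the right-hand side has
    expectation \<open>v * E ?s\<close> by Stein.\<close>
  have "E (\<lambda>x. 1 + (-1) * ?s x) \<le> E (\<lambda>x. x * tanh x)"
    unfolding E_def
  proof (rule integral_mono)
    show "1 + (-1) * ?s (w \<bullet> z) \<le> (w \<bullet> z) * tanh (w \<bullet> z)" for z
      using tanh_square_le[of "w \<bullet> z"] by (simp add: sech_sq_def)
    show "integrable std_gauss (\<lambda>z. 1 + (-1) * ?s (w \<bullet> z))"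
      using I_add(1)[OF I1 I_cmult(1)[OF Is, of "-1"]] unfolding I_def .
    show "integrable std_gauss (\<lambda>z. (w \<bullet> z) * tanh (w \<bullet> z))"
      using xt(2) unfolding I_def .
  qed
  moreover have "E (\<lambda>x. 1 + (-1) * ?s x) = 1 + (-1) * E ?s"
    by (simp only: I_add I_cmult I1 E1 Is)
  ultimately have "1 \<le> (1 + v) * E ?s" using xt(1) by (simp add: algebra_simps)
  then have s_lower: "1 / (1 + v) \<le> E ?s" using v by (simp add: divide_le_eq mult.commute)
  \<comment> \<open>With this Taylor bound the terms of order v and \<open>v\<^sup>2\<close> cancel
    exactly; what remains is \<open>2 * v * (v\<^sup>2 / (1 + v))\<close>.\<close>
  have "exp (2 * v) \<ge> 1 + 2 * v + (2 * v)\<^sup>2 / 2"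
    using v by (intro exp_lower_Taylor_quadratic) auto
  moreover have "(6 * v + 4 * v\<^sup>2) * (1 / (1 + v)) \<le> (6 * v + 4 * v\<^sup>2) * E ?s"
    using v s_lower by (intro mult_left_mono) auto
  moreover have "(6 * v + 4 * v\<^sup>2) * (1 / (1 + v)) = 4 * v + 2 * v * (1 - v + v\<^sup>2 / (1 + v))"
    using v by (simp add: field_simps power2_eq_square)
  moreover have "0 < 2 * v * (v\<^sup>2 / (1 + v))" using v by simp
  ultimately have "0 < E (\<lambda>x. gap_kernel v x * sinh (2 * x))"
    using J2 by (simp add: algebra_simps power2_eq_square)
  then show ?thesis by (simp add: E_def v_def)
qed

lemma abs_sinh_le_exp: "\<bar>sinh x\<bar> \<le> exp \<bar>x::real\<bar>"
proof -
  have "sinh \<bar>x\<bar> \<le> exp \<bar>x\<bar>" by (simp add: sinh_def field_simps)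
  then show ?thesis by (cases "0 \<le> x") auto
qed

lemma integrable_gap_kernel_sinh:
  "integrable std_gauss (\<lambda>z. gap_kernel v (w \<bullet> z) * sinh (a * (w \<bullet> z)))"
proof (rule integrable_std_gauss_dominated)
  show "\<bar>gap_kernel v (w \<bullet> z) * sinh (a * (w \<bullet> z))\<bar> \<le> (6 + 12 * \<bar>v\<bar>) * exp (\<bar>(a *\<^sub>R w) \<bullet> z\<bar> + \<bar>0 \<bullet> z\<bar>)" for z
    using mult_mono[OF gap_kernel_bound[of v "w \<bullet> z"] abs_sinh_le_exp[of "a * (w \<bullet> z)"]]
    by (simp add: abs_mult)
qed measurable

text \<open>Since \<open>gap_kernel_quotient v\<close> is increasing, \<open>gap_kernel v\<close> changes sign at most once on the positive half-line, from
  negative to positive; so replacing the weight \<open>sinh (2 x)\<close> by the relatively faster growing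
  \<open>sinh (a x)\<close> preserves positivity.\<close>

lemma integral_gap_kernel_sinh_pos:
  fixes w :: "real^'n"
  assumes w: "w \<noteq> 0" and a: "2 \<le> a"
  shows "0 < (\<integral>z. gap_kernel (w \<bullet> w) (w \<bullet> z) * sinh (a * (w \<bullet> z)) \<partial>std_gauss)"
proof -
  define v where "v = w \<bullet> w"
  have v: "0 \<le> v" by (simp add: v_def)
  have pos: "0 < (\<integral>z. gap_kernel v (w \<bullet> z) * sinh (2 * (w \<bullet> z)) \<partial>std_gauss)"
    using integral_gap_kernel_sinh_double_pos[OF w] by (simp add: v_def)
  \<comment> \<open>If S is nonempty, its supremum will be the sign change of the kernel.\<close>
  define S where "S = {x. 0 < x \<and> gap_kernel_quotient v x < 0}"
  have sgn: "gap_kernel v x \<ge> 0 \<longleftrightarrow> gap_kernel_quotient v x \<ge> 0" if "x > 0" for x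
  proof -
    have "0 < sech_sq x * x" using that sech_sq_pos[of x] by simp
    then show ?thesis
      unfolding gap_kernel_eq[OF that] by (metis mult_nonneg_nonneg mult_pos_neg not_le less_imp_le)
  qed
  have "\<exists>r0>0. \<forall>x>0. r0 * (gap_kernel v x * sinh (2 * x)) \<le> gap_kernel v x * sinh (a * x)"
  proof (cases "S = {}")
    case True
    have "1 * (gap_kernel v x * sinh (2 * x)) \<le> gap_kernel v x * sinh (a * x)" if "x > 0" for x
    proof -
      have "0 \<le> gap_kernel_quotient v x" using True that unfolding S_def by (metis (mono_tags, lifting) empty_Collect_eq not_le)
      then have "0 \<le> gap_kernel v x" using sgn that by blast
      moreover have "sinh (2 * x) \<le> sinh (a * x)" using a that by simp
      ultimately show ?thesis by (simp add: mult_left_mono)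
    qed
    then show ?thesis by (intro exI[of _ 1]) auto
  next
    case False
    \<comment> \<open>A quotient negative on the whole half-line would contradict the positive
      integral for the weight \<open>sinh (2 * x)\<close>; so S is bounded.\<close>
    have "\<exists>y>0. 0 \<le> gap_kernel_quotient v y"
    proof (rule ccontr)
      assume "\<not> (\<exists>y>0. 0 \<le> gap_kernel_quotient v y)"
      then have *: "gap_kernel v x * sinh (2 * x) \<le> 0" if "x > 0" for x
        using that sgn[of x] by (intro mult_nonpos_nonneg) (auto simp: not_le less_imp_le)
      have **: "gap_kernel v x * sinh (2 * x) \<le> 0" for x
        using *[of x] *[of "- x"] gap_kernel_minus[of v x] by (cases "x = 0"; cases "x > 0") auto
      have "(\<integral>z. gap_kernel v (w \<bullet> z) * sinh (2 * (w \<bullet> z)) \<partial>std_gauss) \<le> 0"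
        using integral_nonneg_AE[of "\<lambda>z. - (gap_kernel v (w \<bullet> z) * sinh (2 * (w \<bullet> z)))" std_gauss] ** by simp
      with pos show False by simp
    qed
    then obtain y where y: "y > 0" "0 \<le> gap_kernel_quotient v y" by blast
    have bdd: "x \<le> y" if "x \<in> S" for x
      using that y gap_kernel_quotient_mono[OF v y(1), of x] by (auto simp: S_def not_le[symmetric] intro: linear less_imp_le)
    define u0 where "u0 = Sup S"
    have bdd': "bdd_above S" using bdd by (auto simp: bdd_above_def)
    obtain s0 where "s0 \<in> S" using False by blast
    then have u0: "0 < u0" using cSup_upper[OF _ bdd', of s0] by (auto simp: u0_def S_def)
    have below: "gap_kernel_quotient v x \<le> 0" if x: "0 < x" "x < u0" for x
    proof -
      obtain s where "s \<in> S" "x < s"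
        using x(2) less_cSup_iff[OF False bdd', of x] unfolding u0_def by blast
      then show ?thesis using gap_kernel_quotient_mono[OF v x(1), of s] by (auto simp: S_def)
    qed
    have above: "0 \<le> gap_kernel_quotient v x" if "u0 < x" for x
      using that u0 cSup_upper[OF _ bdd', of x] by (force simp: u0_def S_def not_less)
    define r where "r x = sinh (a * x) / sinh (2 * x)" for x
    \<comment> \<open>Left of \<open>u0\<close> the kernel is nonpositive and the ratio of the
      weights at most \<open>r u0\<close>; right of it both inequalities reverse. Either way
      freezing the ratio at \<open>r u0\<close> lowers the product.\<close>
    have "r u0 * (gap_kernel v x * sinh (2 * x)) \<le> gap_kernel v x * sinh (a * x)" if x: "x > 0" for x
    proof -
      have eq: "gap_kernel v x * sinh (a * x) = r x * (gap_kernel v x * sinh (2 * x))"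
        using x by (simp add: r_def)
      have sh: "0 < sinh (2 * x)" using x by simp
      consider "x < u0" | "x = u0" | "u0 < x" by linarith
      then show ?thesis
      proof cases
        case 1
        have "gap_kernel v x * sinh (2 * x) \<le> 0"
          using below[OF x 1] x sh sech_sq_pos[of x]
          by (intro mult_nonpos_nonneg) (auto simp: gap_kernel_eq mult_nonneg_nonpos)
        moreover have "r x \<le> r u0" unfolding r_def using 1 x a by (intro sinh_ratio_mono) auto
        ultimately show ?thesis unfolding eq by (simp add: mult_right_mono_neg)
      next
        case 3
        have "0 \<le> gap_kernel v x * sinh (2 * x)"
          using above[OF 3] x sh sgn[of x] by simp
        moreover have "r u0 \<le> r x" unfolding r_def using 3 u0 a by (intro sinh_ratio_mono) auto
        ultimately show ?thesis unfolding eq by (simp add: mult_right_mono)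
      next
        case 2
        then show ?thesis unfolding eq by simp
      qed
    qed
    moreover have "0 < r u0" using u0 a by (simp add: r_def)
    ultimately show ?thesis by blast
  qed
  then obtain r0 where r0: "r0 > 0"
    "\<And>x. x > 0 \<Longrightarrow> r0 * (gap_kernel v x * sinh (2 * x)) \<le> gap_kernel v x * sinh (a * x)" by blast
  \<comment> \<open>Both sides are even in x, since the kernel and \<open>sinh\<close> are odd, and
    both vanish at 0.\<close>
  have all: "r0 * (gap_kernel v x * sinh (2 * x)) \<le> gap_kernel v x * sinh (a * x)" for x
    using r0(2)[of x] r0(2)[of "- x"] gap_kernel_minus[of v x] by (cases "x = 0"; cases "x > 0") auto
  have "0 < r0 * (\<integral>z. gap_kernel v (w \<bullet> z) * sinh (2 * (w \<bullet> z)) \<partial>std_gauss)"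
    using r0(1) pos by simp
  also have "\<dots> = (\<integral>z. r0 * (gap_kernel v (w \<bullet> z) * sinh (2 * (w \<bullet> z))) \<partial>std_gauss)" by simp
  also have "\<dots> \<le> (\<integral>z. gap_kernel v (w \<bullet> z) * sinh (a * (w \<bullet> z)) \<partial>std_gauss)"
    by (intro integral_mono integrable_mult_right integrable_gap_kernel_sinh all)
  finally show ?thesis by (simp add: v_def)
qed

text \<open>With \<open>u = m + w \<bullet> z\<close> and \<open>\<phi> x = x * tanh x\<close> this
  is \<open>E (\<phi>' u) - m * E (\<phi>'' u)\<close>, because
  \<open>\<phi>'' = - 2 * gap_factor\<close>.\<close>

definition stein_gap :: "real \<Rightarrow> real^'n \<Rightarrow> real" where
  "stein_gap m w = (\<integral>z. tanh (m + w \<bullet> z) + (m + w \<bullet> z) * sech_sq (m + w \<bullet> z)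
     + 2 * m * gap_factor (m + w \<bullet> z) \<partial>std_gauss)"

text \<open>Writing \<open>m = u - w \<bullet> z\<close> and applying Stein to the second part
  trades the explicit m for \<open>gap_kernel v\<close>. Recentring gives the weight
  \<open>exp (m / v * x)\<close>, of which an odd kernel retains the \<open>sinh\<close> part; the
  hypothesis says \<open>2 \<le> m / v\<close>.\<close>

lemma stein_gap_pos:
  fixes w :: "real^'n"
  assumes w: "w \<noteq> 0" and m: "2 * (w \<bullet> w) \<le> m"
  shows "0 < stein_gap m w"
proof -
  define v where "v = w \<bullet> w"
  have v: "0 < v" using w by (simp add: v_def)
  have stein: "(\<integral>z. (w \<bullet> z) * gap_factor (m + w \<bullet> z) \<partial>std_gauss) = v * (\<integral>z. gap_factor_deriv (m + w \<bullet> z) \<partial>std_gauss)"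
    and int1: "integrable std_gauss (\<lambda>z. (w \<bullet> z) * gap_factor (m + w \<bullet> z))"
    using std_gauss_stein[OF gap_factor_has_derivative gap_factor_deriv_bound, of w m w] by (auto simp: v_def)
  have int2: "integrable std_gauss (\<lambda>z. gap_factor_deriv (m + w \<bullet> z))"
    by (rule integrable_std_gauss_bounded[where C = 6]) (auto simp: gap_factor_deriv_bound)
  have int3: "integrable std_gauss (\<lambda>z. gap_kernel v (m + w \<bullet> z))"
    by (rule integrable_std_gauss_bounded[where C = "6 + 12 * \<bar>v\<bar>"]) (auto simp: gap_kernel_bound)
  have "stein_gap m w = (\<integral>z. gap_kernel v (m + w \<bullet> z)
      - 2 * ((w \<bullet> z) * gap_factor (m + w \<bullet> z)) + 2 * v * gap_factor_deriv (m + w \<bullet> z) \<partial>std_gauss)"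
    unfolding stein_gap_def gap_kernel_def by (intro Bochner_Integration.integral_cong) (auto simp: algebra_simps)
  also have "\<dots> = (\<integral>z. gap_kernel v (m + w \<bullet> z) \<partial>std_gauss)"
    using int1 int2 int3 stein by simp
  \<comment> \<open>The shift is chosen so that its inner product with w is m.\<close>
  also have "\<dots> = (\<integral>z. gap_kernel v (w \<bullet> (z + (m / v) *\<^sub>R w)) \<partial>std_gauss)"
    using v by (simp add: inner_simps v_def[symmetric] add.commute)
  also have "\<dots> = (\<integral>z. gap_kernel v (w \<bullet> z) * exp (((m / v) *\<^sub>R w) \<bullet> z
      - ((m / v) *\<^sub>R w) \<bullet> ((m / v) *\<^sub>R w) / 2) \<partial>std_gauss)"
    by (rule std_gauss_translate) measurable
  also have "\<dots> = exp (- (m\<^sup>2 / (2 * v))) * (\<integral>z. gap_kernel v (w \<bullet> z) * exp (m / v * (w \<bullet> z)) \<partial>std_gauss)"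
  proof -
    have "((m / v) *\<^sub>R w) \<bullet> ((m / v) *\<^sub>R w) / 2 = m\<^sup>2 / (2 * v)"
      using v by (simp add: v_def[symmetric] power2_eq_square)
    then have "exp (((m / v) *\<^sub>R w) \<bullet> z - ((m / v) *\<^sub>R w) \<bullet> ((m / v) *\<^sub>R w) / 2)
        = exp (- (m\<^sup>2 / (2 * v))) * exp (m / v * (w \<bullet> z))" for z
      by (simp flip: exp_add)
    then show ?thesis
      by (simp only: mult.left_commute[of "gap_kernel _ _"] integral_mult_right_zero)
  qed
  also have "(\<integral>z. gap_kernel v (w \<bullet> z) * exp (m / v * (w \<bullet> z)) \<partial>std_gauss)
      = (\<integral>z. gap_kernel v (w \<bullet> z) * sinh (m / v * (w \<bullet> z)) \<partial>std_gauss)"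
  proof -
    let ?f = "\<lambda>x. gap_kernel v x * exp (m / v * x)"
    have exp_le_abs: "exp y \<le> exp \<bar>y\<bar>" for y :: real by simp
    have int: "integrable std_gauss (\<lambda>z. ?f (w \<bullet> z))" for w :: "real^'n"
    proof (rule integrable_std_gauss_dominated)
      show "\<bar>?f (w \<bullet> z)\<bar> \<le> (6 + 12 * \<bar>v\<bar>) * exp (\<bar>((m / v) *\<^sub>R w) \<bullet> z\<bar> + \<bar>0 \<bullet> z\<bar>)" for z
      proof -
        have "\<bar>gap_kernel v (w \<bullet> z)\<bar> * exp (m / v * (w \<bullet> z)) \<le> (6 + 12 * \<bar>v\<bar>) * exp \<bar>m / v * (w \<bullet> z)\<bar>"
          by (intro mult_mono gap_kernel_bound exp_le_abs) auto
        then show ?thesis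
          by (simp only: abs_mult[of "gap_kernel _ _"] abs_exp_cancel inner_scaleR_left inner_zero_left abs_zero add_0_right)
      qed
    qed measurable
    \<comment> \<open>The law of \<open>w \<bullet> z\<close> is symmetric; averaging over w and
      \<open>- w\<close> turns \<open>exp\<close> into \<open>sinh\<close> because the kernel is
      odd.\<close>
    have "(\<integral>z. ?f (w \<bullet> z) \<partial>std_gauss) = (\<integral>z. ?f ((- w) \<bullet> z) \<partial>std_gauss)"
      by (rule integral_std_gauss_inner_eq) auto
    then have "2 * (\<integral>z. ?f (w \<bullet> z) \<partial>std_gauss) = (\<integral>z. ?f (w \<bullet> z) \<partial>std_gauss) + (\<integral>z. ?f ((- w) \<bullet> z) \<partial>std_gauss)"
      by simp
    also have "\<dots> = (\<integral>z. ?f (w \<bullet> z) + ?f ((- w) \<bullet> z) \<partial>std_gauss)"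
      using int by (intro Bochner_Integration.integral_add[symmetric])
    also have "\<dots> = (\<integral>z. 2 * (gap_kernel v (w \<bullet> z) * sinh (m / v * (w \<bullet> z))) \<partial>std_gauss)"
      by (intro Bochner_Integration.integral_cong) (auto simp: gap_kernel_minus sinh_def algebra_simps)
    also have "\<dots> = 2 * (\<integral>z. gap_kernel v (w \<bullet> z) * sinh (m / v * (w \<bullet> z)) \<partial>std_gauss)"
      by simp
    finally show ?thesis by simp
  qed
  finally have "stein_gap m w = exp (- (m\<^sup>2 / (2 * v))) * (\<integral>z. gap_kernel v (w \<bullet> z) * sinh (m / v * (w \<bullet> z)) \<partial>std_gauss)" .
  moreover have "2 \<le> m / v" using m v by (simp add: v_def field_simps)
  ultimately show ?thesis
    using integral_gap_kernel_sinh_pos[OF w, of "m / v"] by (simp add: v_def)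
qed

section \<open>Gaussian expectations of hyperbolic functions\<close>

text \<open>Concerns a real Gaussian of mean m and variance \<open>w \<bullet> w\<close>. Keeping
  the standard deviation as a vector lets every expectation live on
  \<open>std_gauss\<close>.\<close>

definition gauss_tanh :: "real \<Rightarrow> real^'n \<Rightarrow> real" where
  "gauss_tanh m w = (\<integral>z. tanh (m + w \<bullet> z) \<partial>std_gauss)"

definition gauss_sech_sq :: "real \<Rightarrow> real^'n \<Rightarrow> real" where
  "gauss_sech_sq m w = (\<integral>z. sech_sq (m + w \<bullet> z) \<partial>std_gauss)"

definition gauss_mult_tanh :: "real \<Rightarrow> real^'n \<Rightarrow> real" where
  "gauss_mult_tanh m w = (\<integral>z. (m + w \<bullet> z) * tanh (m + w \<bullet> z) \<partial>std_gauss)"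

lemma abs_sech_sq: "\<bar>sech_sq x\<bar> \<le> 1"
  using sech_sq_pos[of x] sech_sq_le_1[of x] by simp

lemma integrable_std_gauss_tanh: "integrable std_gauss (\<lambda>z. tanh (m + w \<bullet> z))"
  by (rule integrable_std_gauss_bounded[where C = 1]) (auto simp: abs_tanh_le_1)

lemma integrable_std_gauss_sech_sq: "integrable std_gauss (\<lambda>z. sech_sq (m + w \<bullet> z))"
  by (rule integrable_std_gauss_bounded[where C = 1]) (auto simp: abs_sech_sq)

lemma integrable_std_gauss_inner: "integrable std_gauss (\<lambda>z. w \<bullet> z)"
proof (rule integrable_std_gauss_dominated)
  show "\<bar>w \<bullet> z\<bar> \<le> 1 * exp (\<bar>w \<bullet> z\<bar> + \<bar>0 \<bullet> z\<bar>)" for z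
    using abs_le_exp_abs[of "w \<bullet> z"] by simp
qed measurable

lemma gauss_tanh_stein:
  "(\<integral>z. (a \<bullet> z) * tanh (m + w \<bullet> z) \<partial>std_gauss) = (a \<bullet> w) * gauss_sech_sq m w"
  "integrable std_gauss (\<lambda>z. (a \<bullet> z) * tanh (m + w \<bullet> z))"
  using std_gauss_stein[OF has_field_derivative_tanh_sech_sq abs_sech_sq, of a m w]
  by (auto simp: gauss_sech_sq_def)

lemma gauss_mult_tanh_eq:
  "gauss_mult_tanh m w = m * gauss_tanh m w + (w \<bullet> w) * gauss_sech_sq m w"
  unfolding gauss_mult_tanh_def gauss_tanh_def
  using gauss_tanh_stein[of w m w] integrable_std_gauss_tanh[of m w]
  by (simp add: distrib_right)

lemma gauss_norm_cong:
  fixes w w' :: "real^'n"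
  assumes "norm w = norm w'"
  shows "gauss_tanh m w = gauss_tanh m w'"
    and "gauss_sech_sq m w = gauss_sech_sq m w'"
    and "gauss_mult_tanh m w = gauss_mult_tanh m w'"
  unfolding gauss_tanh_def gauss_sech_sq_def gauss_mult_tanh_def
  by (rule integral_std_gauss_inner_eq[OF assms, of "\<lambda>x. tanh (m + x)"]
      integral_std_gauss_inner_eq[OF assms, of "\<lambda>x. sech_sq (m + x)"]
      integral_std_gauss_inner_eq[OF assms, of "\<lambda>x. (m + x) * tanh (m + x)"]; measurable)+

lemma gauss_minus:
  "gauss_tanh (- m) w = - gauss_tanh m w" "gauss_sech_sq (- m) w = gauss_sech_sq m w"
  "gauss_mult_tanh (- m) w = gauss_mult_tanh m w"
proof -
  have eq: "- m + w \<bullet> z = - (m + (- w) \<bullet> z)" for z by simp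
  have "gauss_tanh (- m) w = - gauss_tanh m (- w)" "gauss_sech_sq (- m) w = gauss_sech_sq m (- w)"
    "gauss_mult_tanh (- m) w = gauss_mult_tanh m (- w)"
    unfolding gauss_tanh_def gauss_sech_sq_def gauss_mult_tanh_def eq
    by (simp_all only: tanh_minus sech_sq_minus integral_minus mult_minus_left mult_minus_right minus_minus)
  then show "gauss_tanh (- m) w = - gauss_tanh m w" "gauss_sech_sq (- m) w = gauss_sech_sq m w"
    "gauss_mult_tanh (- m) w = gauss_mult_tanh m w"
    using gauss_norm_cong[of w "- w" m] by simp_all
qed

text \<open>The h of the overview: \<open>E (f u) - E u * E (f' u)\<close> for
  \<open>f = tanh\<close>.\<close>

definition gauss_defect :: "real \<Rightarrow> real^'n \<Rightarrow> real" where
  "gauss_defect m w = gauss_tanh m w - m * gauss_sech_sq m w"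

lemma gauss_defect_minus: "gauss_defect (- m) w = - gauss_defect m w"
  by (simp add: gauss_defect_def gauss_minus)

text \<open>Under the expectation stands
  \<open>k * tanh (k * u) - k\<^sup>2 * m * sech_sq (k * u)\<close> with
  \<open>u = m + w \<bullet> z\<close>; the derivative of its second term is what creates
  \<open>gap_factor\<close>.\<close>

lemma gauss_defect_scaled_deriv:
  "((\<lambda>k. k * gauss_defect (k * m) (k *\<^sub>R w)) has_real_derivative stein_gap (k * m) (k *\<^sub>R w)) (at k)"
proof -
  let ?u = "\<lambda>z. m + w \<bullet> z"
  define F where "F = (\<lambda>k z. k * tanh (k * ?u z) - k\<^sup>2 * m * sech_sq (k * ?u z))"
  define F' where "F' = (\<lambda>k z. tanh (k * ?u z) + (k * ?u z) * sech_sq (k * ?u z) + 2 * (k * m) * gap_factor (k * ?u z))"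
  have u: "k * m + (k *\<^sub>R w) \<bullet> z = k * ?u z" for k z by (simp add: algebra_simps)
  have int: "integrable std_gauss (\<lambda>z. tanh (k * ?u z))" "integrable std_gauss (\<lambda>z. sech_sq (k * ?u z))" for k
    using integrable_std_gauss_tanh[of "k * m" "k *\<^sub>R w"] integrable_std_gauss_sech_sq[of "k * m" "k *\<^sub>R w"]
    unfolding u by auto
  have eq: "k * gauss_defect (k * m) (k *\<^sub>R w) = (\<integral>z. F k z \<partial>std_gauss)" for k
    unfolding gauss_defect_def gauss_tanh_def gauss_sech_sq_def u F_def
    using int[of k] by (simp add: algebra_simps power2_eq_square)
  have "((\<lambda>k. \<integral>z. F k z \<partial>std_gauss) has_real_derivative (\<integral>z. F' k z \<partial>std_gauss)) (at k)"
  proof (rule has_real_derivative_integral[where F' = F' and e = 1 and g = "\<lambda>_. 2 + 4 * ((\<bar>k\<bar> + 1) * \<bar>m\<bar>)"])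
    show "F' k \<in> borel_measurable std_gauss"
      unfolding F'_def by measurable
    fix t assume t: "\<bar>t - k\<bar> < 1"
    show "integrable std_gauss (F t)"
      unfolding F_def using int[of t] by simp
    show "((\<lambda>k. F k z) has_real_derivative F' t z) (at t)" for z
      unfolding F_def F'_def gap_factor_def
      by (auto intro!: derivative_eq_intros simp: algebra_simps power2_eq_square)
    show "\<bar>F' t z\<bar> \<le> 2 + 4 * ((\<bar>k\<bar> + 1) * \<bar>m\<bar>)" for z
    proof -
      let ?x = "t * ?u z"
      have "\<bar>gap_factor ?x\<bar> \<le> 2" by (rule gap_factor_bound)
      moreover have "\<bar>t * m\<bar> \<le> (\<bar>k\<bar> + 1) * \<bar>m\<bar>"
        unfolding abs_mult using t by (intro mult_right_mono) auto
      ultimately have "\<bar>(t * m) * gap_factor ?x\<bar> \<le> ((\<bar>k\<bar> + 1) * \<bar>m\<bar>) * 2"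
        unfolding abs_mult[of "t * m"] by (intro mult_mono) auto
      then show ?thesis unfolding F'_def using abs_tanh_add_bound[of ?x] by linarith
    qed
  qed auto
  moreover have "(\<integral>z. F' k z \<partial>std_gauss) = stein_gap (k * m) (k *\<^sub>R w)"
    unfolding stein_gap_def u F'_def ..
  ultimately show ?thesis by (simp only: eq)
qed

text \<open>The variance scales with \<open>k\<^sup>2\<close> but the mean with k, so separability
  at the scale l passes to every smaller scale.\<close>

lemma stein_gap_scaled_pos:
  fixes w :: "real^'n"
  assumes w: "w \<noteq> 0" and l: "2 * l * (w \<bullet> w) \<le> m" and k: "0 < k" "k \<le> l"
  shows "0 < stein_gap (k * m) (k *\<^sub>R w)"
proof (rule stein_gap_pos)
  have "2 * k * (w \<bullet> w) \<le> 2 * l * (w \<bullet> w)" using k by (intro mult_right_mono) auto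
  with l have "k * (2 * k * (w \<bullet> w)) \<le> k * m" using k by (intro mult_left_mono) auto
  then show "2 * ((k *\<^sub>R w) \<bullet> (k *\<^sub>R w)) \<le> k * m" by (simp add: mult_ac)
qed (use w k in auto)

lemma gauss_defect_scaled_strict_mono:
  fixes w :: "real^'n"
  assumes w: "w \<noteq> 0" and l: "2 * l * (w \<bullet> w) \<le> m" and k: "0 < k" "k < l"
  shows "k * gauss_defect (k * m) (k *\<^sub>R w) < l * gauss_defect (l * m) (l *\<^sub>R w)"
proof (rule DERIV_pos_imp_increasing[where f = "\<lambda>k. k * gauss_defect (k * m) (k *\<^sub>R w)", OF k(2)])
  fix x assume "k \<le> x" "x \<le> l"
  then show "\<exists>D. ((\<lambda>k. k * gauss_defect (k * m) (k *\<^sub>R w)) has_real_derivative D) (at x) \<and> 0 < D"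
    using gauss_defect_scaled_deriv stein_gap_scaled_pos[OF w l, of x] k by fastforce
qed

text \<open>The scaled defect vanishes at \<open>k = 0\<close> and increases up to
  \<open>k = 1\<close>. Its derivative is positive only for \<open>k > 0\<close>, as the Gaussian
  degenerates at 0; hence the open interval.\<close>

lemma gauss_defect_pos:
  fixes w :: "real^'n"
  assumes w: "w \<noteq> 0" and m: "2 * (w \<bullet> w) \<le> m"
  shows "0 < gauss_defect m w"
proof -
  let ?H = "\<lambda>k. k * gauss_defect (k * m) (k *\<^sub>R w)"
  have "?H 0 < ?H 1"
  proof (rule DERIV_pos_imp_increasing_open[where f = ?H])
    show "\<exists>D. (?H has_real_derivative D) (at x) \<and> 0 < D" if "0 < x" "x < 1" for x
      using gauss_defect_scaled_deriv stein_gap_scaled_pos[OF w, of 1 m x] m that by fastforce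
    show "continuous_on {0..1} ?H"
      using gauss_defect_scaled_deriv DERIV_isCont by (blast intro: continuous_at_imp_continuous_on)
  qed simp
  then show ?thesis by simp
qed

lemma gauss_defect_nonzero:
  fixes w :: "real^'n"
  assumes "w \<noteq> 0" "2 * (w \<bullet> w) \<le> \<bar>m\<bar>"
  shows "gauss_defect m w \<noteq> 0"
  using gauss_defect_pos[OF assms(1), of m] gauss_defect_pos[OF assms(1), of "- m"] assms(2)
    gauss_defect_minus[of m w] by (cases "0 \<le> m") auto

text \<open>Strict monotonicity up to the separable scale l; a negative m is reduced to a positive
  one by oddness.\<close>

lemma gauss_defect_scaled_inj:
  fixes w :: "real^'n"
  assumes w: "w \<noteq> 0" and l: "2 * (l\<^sup>2 * (w \<bullet> w)) \<le> \<bar>l * m\<bar>" and k: "0 < k" "k < l"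
  shows "k * gauss_defect (k * m) (k *\<^sub>R w) \<noteq> l * gauss_defect (l * m) (l *\<^sub>R w)"
proof -
  have "l * (2 * l * (w \<bullet> w)) \<le> l * \<bar>m\<bar>"
    using l k by (simp add: power2_eq_square abs_mult mult_ac)
  then have le: "2 * l * (w \<bullet> w) \<le> \<bar>m\<bar>" using k by simp
  show ?thesis
  proof (cases "0 \<le> m")
    case True
    then show ?thesis using gauss_defect_scaled_strict_mono[OF w _ k, of m] le by simp
  next
    case False
    then show ?thesis using gauss_defect_scaled_strict_mono[OF w _ k, of "- m"] le
      by (simp add: gauss_defect_minus)
  qed
qed

text \<open>Both pairs lie on the circle of radius r, as \<open>m = r * cos t\<close> and
  \<open>norm w = r * sin t\<close>, along which the derivative is
  \<open>- (r * sin t) * stein_gap\<close>. Towards m' the mean grows and the variance shrinks, so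
  separability at m extends to the whole arc.\<close>

lemma gauss_mult_tanh_strict_mono:
  fixes w w' :: "real^'n"
  assumes w: "w \<noteq> 0" and w': "w' \<noteq> 0" and m: "2 * (w \<bullet> w) \<le> m"
    and eq: "m\<^sup>2 + w \<bullet> w = m'\<^sup>2 + w' \<bullet> w'" and less: "m < m'"
  shows "gauss_mult_tanh m w < gauss_mult_tanh m' w'"
proof -
  define q where "q = m\<^sup>2 + w \<bullet> w"
  have v: "0 < w \<bullet> w" "0 < w' \<bullet> w'" using w w' by auto
  have mpos: "0 < m" using m v by linarith
  have q: "0 < q" "m\<^sup>2 < q" "m'\<^sup>2 < q"
  proof -
    have "0 \<le> m\<^sup>2" by simp
    then show "0 < q" "m\<^sup>2 < q" "m'\<^sup>2 < q" unfolding q_def using v eq by linarith+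
  qed
  define r where "r = sqrt q"
  have r: "0 < r" "r\<^sup>2 = q" using q by (auto simp: r_def)
  have mr: "m < r" "m' < r"
    using q(2,3) r power_less_imp_less_base[of _ 2 r] by auto
  define \<theta> where "\<theta> = arccos (m / r)"
  define \<theta>' where "\<theta>' = arccos (m' / r)"
  have frac: "0 < m / r" "m / r < 1" "0 < m' / r" "m' / r < 1" "m / r < m' / r"
    using mpos less mr r by (auto simp: divide_strict_right_mono)
  have \<theta>: "cos \<theta> = m / r" "cos \<theta>' = m' / r" "0 < \<theta>'" "\<theta>' < \<theta>" "\<theta> < pi / 2"
  proof -
    show "cos \<theta> = m / r" "cos \<theta>' = m' / r" using frac by (auto simp: \<theta>_def \<theta>'_def cos_arccos)
    show "0 < \<theta>'" using arccos_less_arccos[of "m' / r" 1] frac by (simp add: \<theta>'_def)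
    show "\<theta>' < \<theta>" using arccos_less_arccos[of "m / r" "m' / r"] frac by (simp add: \<theta>_def \<theta>'_def)
    show "\<theta> < pi / 2" using arccos_less_arccos[of 0 "m / r"] frac by (simp add: \<theta>_def)
  qed
  \<comment> \<open>Only the norm of w matters, so one fixed unit direction serves the whole arc,
    including the endpoint w'.\<close>
  define e where "e = w /\<^sub>R norm w"
  have ee: "e \<bullet> e = 1" and ne: "norm e = 1" using w by (auto simp: e_def dot_square_norm power2_eq_square)
  define W where "W t = (r * sin t) *\<^sub>R e" for t
  have norm_W: "norm (W t) = r * sin t" if "0 \<le> sin t" for t
    using that r by (simp add: W_def ne)
  have sin_pos: "0 < sin t" if "\<theta>' \<le> t" "t \<le> \<theta>" for t
    using that \<theta> by (intro sin_gt_zero) auto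
  have WW: "W t \<bullet> W t = q - (r * cos t)\<^sup>2" for t
  proof -
    have "W t \<bullet> W t = q * (sin t)\<^sup>2"
      by (simp add: W_def ee r(2)[symmetric] power2_eq_square)
    then show ?thesis by (simp add: power_mult_distrib r(2) sin_squared_eq algebra_simps)
  qed
  have norms: "norm w = norm (W \<theta>)" "norm w' = norm (W \<theta>')"
    using WW[of \<theta>] WW[of \<theta>'] \<theta>(1,2) r eq by (auto simp: norm_eq q_def)
  let ?G = "\<lambda>t. gauss_mult_tanh (r * cos t) (W t)"
  have deriv: "(?G has_real_derivative - (r * sin t) * stein_gap (r * cos t) (W t)) (at t)" for t
  proof -
    let ?u = "\<lambda>t z. r * cos t + W t \<bullet> z"
    let ?f' = "\<lambda>x. tanh x + x * sech_sq x"
    have f'_deriv: "(?f' has_real_derivative - 2 * gap_factor x) (at x)" for x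
      by (auto intro!: derivative_eq_intros simp: gap_factor_def algebra_simps)
    have f'_bound: "\<bar>- 2 * gap_factor x\<bar> \<le> 4" for x using gap_factor_bound[of x] by (simp add: abs_mult)
    \<comment> \<open>The factor \<open>e \<bullet> z\<close> stems from the moving standard
      deviation. Stein converts it into \<open>r * sin t\<close> times the derivative of
      \<open>?f'\<close>, so that \<open>- (r * sin t)\<close> can be factored out of both
      contributions.\<close>
    have st: "(\<integral>z. (e \<bullet> z) * ?f' (?u t z) \<partial>std_gauss) = (r * sin t) * (\<integral>z. - 2 * gap_factor (?u t z) \<partial>std_gauss)"
      "integrable std_gauss (\<lambda>z. (e \<bullet> z) * ?f' (?u t z))"
      using std_gauss_stein[OF f'_deriv f'_bound, of e "r * cos t" "W t"] by (auto simp: W_def ee)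
    have int_f': "integrable std_gauss (\<lambda>z. ?f' (?u t z))"
      by (rule integrable_std_gauss_bounded[where C = 2]) (auto simp: abs_tanh_add_bound)
    have int_g: "integrable std_gauss (\<lambda>z. gap_factor (?u t z))"
      by (rule integrable_std_gauss_bounded[where C = 2]) (auto simp: gap_factor_bound)
    have "((\<lambda>t. \<integral>z. ?u t z * tanh (?u t z) \<partial>std_gauss) has_real_derivative
        (\<integral>z. ?f' (?u t z) * (- (r * sin t) + r * cos t * (e \<bullet> z)) \<partial>std_gauss)) (at t)"
    proof (rule has_real_derivative_integral[where e = 1 and g = "\<lambda>z. 2 * (r + r * \<bar>e \<bullet> z\<bar>)"])
      fix t
      show "integrable std_gauss (\<lambda>z. ?u t z * tanh (?u t z))"
        by (rule integrable_std_gauss_lipschitz[OF mult_tanh_deriv abs_tanh_add_bound])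
      show "((\<lambda>t. ?u t z * tanh (?u t z)) has_real_derivative
          ?f' (?u t z) * (- (r * sin t) + r * cos t * (e \<bullet> z))) (at t)" for z
        by (rule DERIV_chain2[OF mult_tanh_deriv]) (auto intro!: derivative_eq_intros simp: W_def)
      show "\<bar>?f' (?u t z) * (- (r * sin t) + r * cos t * (e \<bullet> z))\<bar> \<le> 2 * (r + r * \<bar>e \<bullet> z\<bar>)" for z
      proof -
        have "\<bar>r * sin t\<bar> \<le> r * 1" "\<bar>r * cos t * (e \<bullet> z)\<bar> \<le> r * 1 * \<bar>e \<bullet> z\<bar>"
          unfolding abs_mult abs_of_pos[OF r(1)]
          using r(1) by (intro mult_left_mono mult_right_mono; simp)+
        then have "\<bar>- (r * sin t) + r * cos t * (e \<bullet> z)\<bar> \<le> r + r * \<bar>e \<bullet> z\<bar>" by linarith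
        then show ?thesis
          unfolding abs_mult[of "?f' _"] by (intro mult_mono abs_tanh_add_bound) auto
      qed
      show "integrable std_gauss (\<lambda>z. 2 * (r + r * \<bar>e \<bullet> z\<bar>))"
        by (intro integrable_mult_right Bochner_Integration.integrable_add integrable_abs integrable_std_gauss_inner) simp
    qed simp_all
    moreover have "(\<integral>z. ?f' (?u t z) * (- (r * sin t) + r * cos t * (e \<bullet> z)) \<partial>std_gauss)
        = - (r * sin t) * stein_gap (r * cos t) (W t)"
    proof -
      define A where "A = (\<integral>z. ?f' (?u t z) \<partial>std_gauss)"
      define B where "B = (\<integral>z. gap_factor (?u t z) \<partial>std_gauss)"
      have "(\<integral>z. ?f' (?u t z) * (- (r * sin t) + r * cos t * (e \<bullet> z)) \<partial>std_gauss)
          = (\<integral>z. - (r * sin t) * ?f' (?u t z) + r * cos t * ((e \<bullet> z) * ?f' (?u t z)) \<partial>std_gauss)"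
        by (intro Bochner_Integration.integral_cong) (auto simp: algebra_simps)
      also have "\<dots> = - (r * sin t) * A + r * cos t * ((r * sin t) * (- 2 * B))"
        unfolding A_def B_def
        by (subst Bochner_Integration.integral_add)
           (simp_all only: integrable_mult_right st int_f' integral_mult_right_zero)
      also have "\<dots> = - (r * sin t) * (A + 2 * (r * cos t) * B)"
        by (simp add: algebra_simps)
      also have "A + 2 * (r * cos t) * B = stein_gap (r * cos t) (W t)"
        unfolding stein_gap_def A_def B_def using int_f' int_g
        by (subst Bochner_Integration.integral_add) auto
      finally show ?thesis .
    qed
    ultimately show ?thesis
      unfolding gauss_mult_tanh_def by (simp only:)
  qed
  have "?G \<theta> < ?G \<theta>'"
  proof (rule DERIV_neg_imp_decreasing[where f = ?G, OF \<theta>(4)])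
    fix t assume t: "\<theta>' \<le> t" "t \<le> \<theta>"
    have "cos \<theta> \<le> cos t" using t \<theta> by (intro cos_monotone_0_pi_le) auto
    then have "m \<le> r * cos t" using \<theta>(1) r by (simp add: field_simps)
    moreover from this have "m\<^sup>2 \<le> (r * cos t)\<^sup>2" using mpos by (intro power_mono) auto
    ultimately have "2 * (W t \<bullet> W t) \<le> r * cos t" using m WW[of t] by (simp add: q_def)
    moreover have "W t \<noteq> 0" using sin_pos[OF t] norm_W[of t] r by force
    ultimately have "0 < stein_gap (r * cos t) (W t)" by (rule stein_gap_pos[rotated])
    then have "- (r * sin t) * stein_gap (r * cos t) (W t) < 0"
      using sin_pos[OF t] r by simp
    with deriv show "\<exists>D. (?G has_real_derivative D) (at t) \<and> D < 0" by blast
  qed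
  moreover have "r * cos \<theta> = m" "r * cos \<theta>' = m'" using \<theta>(1,2) r by auto
  ultimately show ?thesis
    using gauss_norm_cong(3)[OF norms(1)] gauss_norm_cong(3)[OF norms(2)] by simp
qed

lemma gauss_mult_tanh_inj:
  fixes w w' :: "real^'n"
  assumes "w \<noteq> 0" "w' \<noteq> 0" "2 * (w \<bullet> w) \<le> \<bar>m\<bar>" "2 * (w' \<bullet> w') \<le> \<bar>m'\<bar>"
    and "m\<^sup>2 + w \<bullet> w = m'\<^sup>2 + w' \<bullet> w'" "gauss_mult_tanh m w = gauss_mult_tanh m' w'"
  shows "\<bar>m\<bar> = \<bar>m'\<bar>"
proof -
  have "gauss_mult_tanh m w = gauss_mult_tanh \<bar>m\<bar> w" "gauss_mult_tanh m' w' = gauss_mult_tanh \<bar>m'\<bar> w'"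
    by (simp_all add: abs_if gauss_minus)
  with assms show ?thesis
    using gauss_mult_tanh_strict_mono[of w w' "\<bar>m\<bar>" "\<bar>m'\<bar>"]
      gauss_mult_tanh_strict_mono[of w' w "\<bar>m'\<bar>" "\<bar>m\<bar>"]
    by (cases "\<bar>m\<bar>" "\<bar>m'\<bar>" rule: linorder_cases) auto
qed

section \<open>Reduction of the loss to the even part of the discriminator\<close>

lemma norm_matrix_vector_mult_le:
  fixes A :: "real^'n^'m"
  shows "norm (A *v x) \<le> norm A * norm x"
proof -
  have "norm (A *v x) \<le> L2_set (\<lambda>i. norm (A $ i) * norm x) UNIV"
    unfolding norm_vec_def[of "A *v x"]
    by (intro L2_set_mono) (auto simp: matrix_vector_mul_component Cauchy_Schwarz_ineq2)
  also have "\<dots> = norm A * norm x"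
    by (simp add: norm_vec_def[of A] L2_set_left_distrib)
  finally show ?thesis .
qed

lemma abs_bilinear_le:
  fixes A :: "real^'n^'n"
  shows "\<bar>x \<bullet> (A *v y)\<bar> \<le> norm A * (norm x * norm y)"
proof -
  have "\<bar>x \<bullet> (A *v y)\<bar> \<le> norm x * norm (A *v y)" by (rule Cauchy_Schwarz_ineq2)
  also have "\<dots> \<le> norm x * (norm A * norm y)" by (intro mult_left_mono norm_matrix_vector_mult_le) auto
  finally show ?thesis by (simp add: mult_ac)
qed

lemma ln_cosh_lipschitz: "\<bar>ln (cosh x) - ln (cosh y)\<bar> \<le> \<bar>x - y :: real\<bar>"
proof -
  have "((\<lambda>x. ln (cosh x)) has_real_derivative tanh x) (at x)" for x :: real
    using has_field_derivative_ln_cosh[OF DERIV_ident] by simp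
  from bounded_derivative_imp_lipschitz[OF this abs_tanh_le_1] show ?thesis by simp
qed

text \<open>The exponential of the average is factored out. With \<open>a = b1 \<bullet> x\<close>
  and \<open>b = b2 \<bullet> x\<close> this splits the logarithm into a linear and an even function
  of x.\<close>

lemma ln_exp_add_exp:
  fixes a b :: real
  shows "ln (exp a + exp b) = (a + b) / 2 + ln 2 + ln (cosh ((a - b) / 2))"
proof -
  have "exp a + exp b = exp ((a + b) / 2) * (2 * cosh ((a - b) / 2))"
    by (simp add: cosh_def ring_distribs field_simps flip: exp_add)
  then show ?thesis
    by (simp add: ln_mult cosh_real_pos)
qed

text \<open>The even part of the discriminator with \<open>p = (b1 - b2) / 2\<close> and \<open>q = (b3 - b4) / 2\<close>; the odd part
  is linear and has expectation 0.\<close>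

definition even_discriminator :: "real^'n^'n \<Rightarrow> real^'n \<Rightarrow> real^'n \<Rightarrow> real^'n \<Rightarrow> real" where
  "even_discriminator A p q x = 1 / 2 * (x \<bullet> (A *v x)) + ln (cosh (p \<bullet> x)) - ln (cosh (q \<bullet> x))"

lemma discriminator_eq:
  "discriminator A b1 b2 b3 b4 x =
    even_discriminator A ((1/2) *\<^sub>R (b1 - b2)) ((1/2) *\<^sub>R (b3 - b4)) x + ((1/2) *\<^sub>R (b1 + b2 - b3 - b4)) \<bullet> x"
proof -
  have "exp (b1 \<bullet> x) + exp (b2 \<bullet> x) > 0" "exp (b3 \<bullet> x) + exp (b4 \<bullet> x) > 0"
    by (simp_all add: add_pos_pos)
  then show ?thesis
    by (simp add: discriminator_def even_discriminator_def ln_div ln_exp_add_exp inner_simps field_simps)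
qed

lemma ln_cosh_measurable [measurable]: "(\<lambda>x::real. ln (cosh x)) \<in> borel_measurable borel"
  by (intro borel_measurable_continuous_onI continuous_intros) (auto simp: cosh_real_pos less_imp_neq[symmetric])

lemma even_discriminator_measurable [measurable]: "even_discriminator A p q \<in> borel_measurable borel"
  unfolding even_discriminator_def[abs_def] by measurable

lemma even_discriminator_minus: "even_discriminator A p q (- x) = even_discriminator A p q x"
  by (simp add: even_discriminator_def linear_neg[OF matrix_vector_mul_linear])

text \<open>A Lipschitz estimate in the parameters whose weight
  \<open>norm x + (norm x)\<^sup>2\<close> is integrable, so that expectations inherit it.\<close>

lemma even_discriminator_diff_le:
  "\<bar>even_discriminator A p q x - even_discriminator A' p' q' x\<bar>
    \<le> (norm (A - A') + norm (p - p') + norm (q - q')) * (norm x + (norm x)\<^sup>2)"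
proof -
  have 1: "\<bar>1 / 2 * (x \<bullet> (A *v x)) - 1 / 2 * (x \<bullet> (A' *v x))\<bar> \<le> norm (A - A') * (norm x)\<^sup>2"
  proof -
    have "1 / 2 * (x \<bullet> (A *v x)) - 1 / 2 * (x \<bullet> (A' *v x)) = 1 / 2 * (x \<bullet> ((A - A') *v x))"
      by (simp add: matrix_vector_mult_diff_rdistrib inner_simps)
    moreover have "\<bar>x \<bullet> ((A - A') *v x)\<bar> \<le> norm (A - A') * (norm x)\<^sup>2"
      using abs_bilinear_le[of x "A - A'" x] by (simp add: power2_eq_square)
    ultimately show ?thesis by simp
  qed
  have 2: "\<bar>ln (cosh (p \<bullet> x)) - ln (cosh (p' \<bullet> x))\<bar> \<le> norm (p - p') * norm x" for p p'
    using ln_cosh_lipschitz[of "p \<bullet> x" "p' \<bullet> x"] Cauchy_Schwarz_ineq2[of "p - p'" x]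
    by (simp add: inner_simps)
  have 3: "norm (A - A') * (norm x)\<^sup>2 \<le> norm (A - A') * (norm x + (norm x)\<^sup>2)"
    and 4: "\<And>c. 0 \<le> c \<Longrightarrow> c * norm x \<le> c * (norm x + (norm x)\<^sup>2)"
    by (auto intro!: mult_left_mono)
  then show ?thesis
    using 1 2[of p p'] 2[of q q'] 3 4[of "norm (p - p')", OF norm_ge_zero] 4[of "norm (q - q')", OF norm_ge_zero]
    unfolding even_discriminator_def distrib_right[of _ _ "norm x + (norm x)\<^sup>2"] by linarith
qed

lemma even_discriminator_le:
  "\<bar>even_discriminator A p q x\<bar> \<le> (norm A + norm p + norm q) * (norm x + (norm x)\<^sup>2)"
  using even_discriminator_diff_le[of A p q x 0 0 0] by (simp add: even_discriminator_def)

text \<open>\<open>U z\<close> is a sample before its random sign. Square integrability gives the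
  quadratic discriminator a finite expectation.\<close>

locale square_integrable_map =
  fixes U :: "real^'n \<Rightarrow> real^'n"
  assumes meas [measurable]: "U \<in> borel_measurable borel"
    and sq: "integrable std_gauss (\<lambda>z. (norm (U z))\<^sup>2)"
begin

lemma integrable_norm: "integrable std_gauss (\<lambda>z. norm (U z))"
proof (rule Bochner_Integration.integrable_bound)
  show "integrable std_gauss (\<lambda>z. 1 + (norm (U z))\<^sup>2)"
    by (intro Bochner_Integration.integrable_add sq) simp
  show "AE z in std_gauss. norm (norm (U z)) \<le> norm (1 + (norm (U z))\<^sup>2)"
    by (intro AE_I2) (simp add: le_one_add_square)
qed measurable

lemma integrable_even_discriminator: "integrable std_gauss (\<lambda>z. even_discriminator A p q (U z))"
proof (rule Bochner_Integration.integrable_bound)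
  show "integrable std_gauss (\<lambda>z. (norm A + norm p + norm q) * (norm (U z) + (norm (U z))\<^sup>2))"
    by (intro integrable_mult_right Bochner_Integration.integrable_add sq integrable_norm)
  show "AE z in std_gauss. norm (even_discriminator A p q (U z))
      \<le> norm ((norm A + norm p + norm q) * (norm (U z) + (norm (U z))\<^sup>2))"
    by (intro AE_I2) (simp only: real_norm_def, rule order_trans[OF even_discriminator_le abs_ge_self])
qed measurable

definition K where "K = (\<integral>z. norm (U z) + (norm (U z))\<^sup>2 \<partial>std_gauss)"

lemma K_nonneg: "0 \<le> K"
  unfolding K_def by (intro integral_nonneg_AE AE_I2) auto

lemma integral_even_discriminator_lipschitz:
  "\<bar>(\<integral>z. even_discriminator A p q (U z) \<partial>std_gauss) - (\<integral>z. even_discriminator A' p' q' (U z) \<partial>std_gauss)\<bar>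
    \<le> K * (norm (A - A') + norm (p - p') + norm (q - q'))"
proof -
  have "\<bar>(\<integral>z. even_discriminator A p q (U z) \<partial>std_gauss) - (\<integral>z. even_discriminator A' p' q' (U z) \<partial>std_gauss)\<bar>
      = \<bar>\<integral>z. even_discriminator A p q (U z) - even_discriminator A' p' q' (U z) \<partial>std_gauss\<bar>"
    by (simp add: integrable_even_discriminator)
  also have "\<dots> \<le> (\<integral>z. (norm (A - A') + norm (p - p') + norm (q - q')) * (norm (U z) + (norm (U z))\<^sup>2) \<partial>std_gauss)"
    using integral_abs_bound
    by (rule order_trans)
       (intro integral_mono integrable_abs Bochner_Integration.integrable_diff integrable_even_discriminator
          integrable_mult_right Bochner_Integration.integrable_add sq integrable_norm even_discriminator_diff_le)
  finally show ?thesis by (simp add: K_def mult.commute)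
qed

lemma symmetrized_law_discriminator:
  assumes law: "has_symmetrized_law M X U"
  shows "(\<integral>\<omega>. discriminator A b1 b2 b3 b4 (X \<omega>) \<partial>M) =
    (\<integral>z. even_discriminator A ((1/2) *\<^sub>R (b1 - b2)) ((1/2) *\<^sub>R (b3 - b4)) (U z) \<partial>std_gauss)"
proof -
  have [measurable]: "X \<in> borel_measurable M" using law by (simp add: has_symmetrized_law_def)
  let ?e = "even_discriminator A ((1/2) *\<^sub>R (b1 - b2)) ((1/2) *\<^sub>R (b3 - b4))"
  let ?c = "(1/2) *\<^sub>R (b1 + b2 - b3 - b4)"
  have e: "integrable M (\<lambda>\<omega>. ?e (X \<omega>))" "(\<integral>\<omega>. ?e (X \<omega>) \<partial>M) = (\<integral>z. ?e (U z) \<partial>std_gauss)"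
    using has_symmetrized_law_even[OF law even_discriminator_measurable even_discriminator_minus]
      integrable_even_discriminator by blast+
  have n: "integrable M (\<lambda>\<omega>. norm (X \<omega>))"
    using has_symmetrized_law_even[OF law, of norm] integrable_norm by simp
  have c: "integrable M (\<lambda>\<omega>. ?c \<bullet> X \<omega>)"
    by (rule Bochner_Integration.integrable_bound[OF integrable_mult_right[OF n, of "norm ?c"]])
       (auto intro!: AE_I2 simp only: real_norm_def Cauchy_Schwarz_ineq2 abs_mult abs_norm_cancel, measurable)
  have "(\<integral>\<omega>. ?c \<bullet> X \<omega> \<partial>M) = 0"
    by (rule has_symmetrized_law_odd[OF law]) auto
  then show ?thesis
    unfolding discriminator_eq using e c by simp
qed

end

text \<open>The objective at \<open>b1 = p\<close>, \<open>b2 = - p\<close>, \<open>b3 = q\<close>,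
  \<open>b4 = - q\<close>; p and q are penalized twice each, hence \<open>lam\<close> in place of
  \<open>lam / 2\<close>.\<close>

definition reduced_objective where
  "reduced_objective lam d U0 U A p q =
     (\<integral>z. even_discriminator A p q (U0 z) \<partial>std_gauss) - (\<integral>z. even_discriminator A p q (U z) \<partial>std_gauss)
     - lam / 2 * (norm A)\<^sup>2 - lam * (norm (p - d))\<^sup>2 - lam * (norm (q - d))\<^sup>2"

text \<open>The parallelogram identity splits the penalty into one on the half differences and one
  on the sums. The expectations do not see the sums, so these are best taken to be 0.\<close>

lemma regularized_objective_eq:
  assumes "square_integrable_map U0" "square_integrable_map U"
    and X: "has_symmetrized_law M X U0" and G: "has_symmetrized_law M G U"
  shows "regularized_objective M lam d X G A b1 b2 b3 b4 =
    reduced_objective lam d U0 U A ((1/2) *\<^sub>R (b1 - b2)) ((1/2) *\<^sub>R (b3 - b4))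
    - lam * (norm ((1/2) *\<^sub>R (b1 + b2)))\<^sup>2 - lam * (norm ((1/2) *\<^sub>R (b3 + b4)))\<^sup>2"
proof -
  have par: "(norm (b - d))\<^sup>2 + (norm (c + d))\<^sup>2
      = 2 * (norm ((1/2) *\<^sub>R (b - c) - d))\<^sup>2 + 2 * (norm ((1/2) *\<^sub>R (b + c)))\<^sup>2" for b c :: "real^'a"
    unfolding power2_norm_eq_inner by (simp add: inner_simps inner_commute field_simps)
  have "lam / 2 * ((norm A)\<^sup>2 + (norm (b1 - d))\<^sup>2 + (norm (b2 + d))\<^sup>2 + (norm (b3 - d))\<^sup>2 + (norm (b4 + d))\<^sup>2)
      = lam / 2 * ((norm A)\<^sup>2 + ((norm (b1 - d))\<^sup>2 + (norm (b2 + d))\<^sup>2) + ((norm (b3 - d))\<^sup>2 + (norm (b4 + d))\<^sup>2))"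
    by simp
  then show ?thesis
    unfolding regularized_objective_def reduced_objective_def
      square_integrable_map.symmetrized_law_discriminator[OF assms(1) X]
      square_integrable_map.symmetrized_law_discriminator[OF assms(2) G]
    by (simp only: par) (simp add: algebra_simps)
qed

text \<open>Outside the ball of radius \<open>K / c\<close> around \<open>x0\<close> the penalty
  outweighs any Lipschitz gain, so a maximum over this compact ball is global.\<close>

lemma attains_max_of_lipschitz_minus_quadratic:
  fixes f R :: "'a::euclidean_space \<Rightarrow> real"
  assumes lip: "\<And>x y. \<bar>f x - f y\<bar> \<le> K * norm (x - y)" and K: "0 \<le> K"
    and R: "continuous_on UNIV R" "R x0 = 0" "\<And>x. c * (norm (x - x0))\<^sup>2 \<le> R x" and c: "0 < c"
  obtains x where "\<And>y. f y - R y \<le> f x - R x"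
proof -
  have "continuous_on UNIV f"
    unfolding continuous_on_iff dist_real_def
  proof (intro ballI allI impI)
    fix x :: 'a and e :: real assume "0 < e"
    show "\<exists>\<delta>>0. \<forall>x'\<in>UNIV. dist x' x < \<delta> \<longrightarrow> \<bar>f x' - f x\<bar> < e"
    proof (intro exI[of _ "e / (K + 1)"] conjI ballI impI)
      show "0 < e / (K + 1)" using \<open>0 < e\<close> K by simp
      fix x' assume "dist x' x < e / (K + 1)"
      then have "(K + 1) * norm (x' - x) < e" using K by (simp add: dist_norm field_simps)
      moreover have "K * norm (x' - x) \<le> (K + 1) * norm (x' - x)" by (simp add: mult_right_mono)
      ultimately show "\<bar>f x' - f x\<bar> < e" using lip[of x' x] by linarith
    qed
  qed
  then have cont: "continuous_on (cball x0 (K / c)) (\<lambda>x. f x - R x)"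
    using R(1) by (intro continuous_intros) (auto intro: continuous_on_subset)
  obtain x where x: "x \<in> cball x0 (K / c)" "\<And>y. y \<in> cball x0 (K / c) \<Longrightarrow> f y - R y \<le> f x - R x"
    using continuous_attains_sup[OF compact_cball _ cont] K c by (force simp: not_less)
  have "f y - R y \<le> f x - R x" for y
  proof (cases "y \<in> cball x0 (K / c)")
    case False
    then have "K < c * norm (y - x0)" using c by (simp add: dist_norm norm_minus_commute field_simps)
    then have "K * norm (y - x0) \<le> c * norm (y - x0) * norm (y - x0)" by (intro mult_right_mono) auto
    then have "f y - R y \<le> f x0 - R x0"
      using lip[of y x0] R(2) R(3)[of y] by (simp add: power2_eq_square mult.assoc)
    also have "\<dots> \<le> f x - R x" using x(2)[of x0] K c by simp
    finally show ?thesis .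
  qed (rule x(2))
  then show thesis by (rule that)
qed

lemma reduced_objective_attains_max:
  fixes U0 U :: "real^'n \<Rightarrow> real^'n"
  assumes "square_integrable_map U0" "square_integrable_map U" and lam: "0 < lam"
  obtains A p q where "\<And>A' p' q'. reduced_objective lam d U0 U A' p' q' \<le> reduced_objective lam d U0 U A p q"
proof -
  interpret U0: square_integrable_map U0 by fact
  interpret U: square_integrable_map U by fact
  define f where "f = (\<lambda>(A, p, q). (\<integral>z. even_discriminator A p q (U0 z) \<partial>std_gauss)
      - (\<integral>z. even_discriminator A p q (U z) \<partial>std_gauss))"
  define R where "R = (\<lambda>(A :: real^'n^'n, p :: real^'n, q :: real^'n).
      lam / 2 * (norm A)\<^sup>2 + lam * (norm (p - d))\<^sup>2 + lam * (norm (q - d))\<^sup>2)"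
  have red: "reduced_objective lam d U0 U A p q = f (A, p, q) - R (A, p, q)" for A p q
    by (simp add: reduced_objective_def f_def R_def)
  have "\<exists>x. \<forall>y. f y - R y \<le> f x - R x"
  \<comment> \<open>\<open>(0, d, d)\<close> is the zero of the regularizer, \<open>lam / 2\<close>
    its smallest coefficient, and 3 bounds the sum of three block norms by the norm of the
    triple.\<close>
  proof (rule attains_max_of_lipschitz_minus_quadratic[of f "3 * (U0.K + U.K)" R "(0, d, d)" "lam / 2"])
    fix x y :: "(real^'n^'n) \<times> (real^'n) \<times> (real^'n)"
    obtain A p q A' p' q' where xy: "x = (A, p, q)" "y = (A', p', q')" by (metis surj_pair)
    have "norm (A - A') \<le> norm (x - y)"
      using norm_fst_le[of "A - A'" "(p - p', q - q')"] by (simp add: xy)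
    moreover have "norm (p - p', q - q') \<le> norm (x - y)"
      using norm_snd_le[of "(p - p', q - q')" "A - A'"] by (simp add: xy)
    then have "norm (p - p') \<le> norm (x - y)" "norm (q - q') \<le> norm (x - y)"
      using norm_fst_le[of "p - p'" "q - q'"] norm_snd_le[of "q - q'" "p - p'"] by linarith+
    ultimately have n: "norm (A - A') + norm (p - p') + norm (q - q') \<le> 3 * norm (x - y)" by linarith
    have "\<bar>f x - f y\<bar> \<le> (U0.K + U.K) * (norm (A - A') + norm (p - p') + norm (q - q'))"
      using U0.integral_even_discriminator_lipschitz[of A p q A' p' q']
        U.integral_even_discriminator_lipschitz[of A p q A' p' q']
      unfolding xy f_def by (simp add: distrib_right[of U0.K])
    also have "\<dots> \<le> (U0.K + U.K) * (3 * norm (x - y))"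
      using U0.K_nonneg U.K_nonneg n by (intro mult_left_mono) auto
    finally show "\<bar>f x - f y\<bar> \<le> 3 * (U0.K + U.K) * norm (x - y)" by (simp add: algebra_simps)
    show "lam / 2 * (norm (x - (0, d, d)))\<^sup>2 \<le> R x"
      using lam by (simp add: R_def xy norm_Pair algebra_simps) (intro add_mono; simp)
  next
    show "continuous_on UNIV R" unfolding R_def case_prod_unfold by (intro continuous_intros)
  qed (use lam U0.K_nonneg U.K_nonneg in \<open>auto simp: R_def\<close>)
  then obtain A p q where "\<And>y. f y - R y \<le> f (A, p, q) - R (A, p, q)" by (metis surj_pair)
  then show thesis using that[of A p q] by (simp add: red)
qed

text \<open>The supremum is attained at an antisymmetric choice of the b's. Each fixed discriminator
  thus gives a lower bound of the loss for every generator, and a maximizing one touches it.\<close>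

lemma gan_loss_reduced:
  fixes U0 U :: "real^'n \<Rightarrow> real^'n"
  assumes U: "square_integrable_map U0" "square_integrable_map U"
    and law: "has_symmetrized_law M X U0" "has_symmetrized_law M G U" and lam: "0 < lam"
  shows "reduced_objective lam d U0 U A p q \<le> gan_loss M lam d X G"
    and "\<exists>A p q. (\<forall>A' p' q'. reduced_objective lam d U0 U A' p' q' \<le> reduced_objective lam d U0 U A p q) \<and>
      gan_loss M lam d X G = reduced_objective lam d U0 U A p q"
proof -
  obtain A p q where max: "\<And>A' p' q'. reduced_objective lam d U0 U A' p' q' \<le> reduced_objective lam d U0 U A p q"
    using reduced_objective_attains_max[OF U lam] by blast
  let ?obj = "\<lambda>(A, b1, b2, b3, b4). regularized_objective M lam d X G A b1 b2 b3 b4"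
  have at: "?obj (A, p, - p, q, - q) = reduced_objective lam d U0 U A p q"
    by (simp add: regularized_objective_eq[OF U law] flip: scaleR_2)
  have le: "?obj x \<le> reduced_objective lam d U0 U A p q" for x
  proof -
    obtain A' b1 b2 b3 b4 where x: "x = (A', b1, b2, b3, b4)" by (metis surj_pair)
    have "0 \<le> lam * (norm ((1/2) *\<^sub>R (b1 + b2)))\<^sup>2" "0 \<le> lam * (norm ((1/2) *\<^sub>R (b3 + b4)))\<^sup>2"
      using lam by auto
    then show ?thesis
      using max[of A' "(1/2) *\<^sub>R (b1 - b2)" "(1/2) *\<^sub>R (b3 - b4)"]
      unfolding x prod.case regularized_objective_eq[OF U law] by linarith
  qed
  have eq: "gan_loss M lam d X G = reduced_objective lam d U0 U A p q"
    unfolding gan_loss_def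
    by (rule cSup_eq_maximum) (use at le in \<open>auto intro!: image_eqI[where x = "(A, p, - p, q, - q)"]\<close>)
  show "\<exists>A p q. (\<forall>A' p' q'. reduced_objective lam d U0 U A' p' q' \<le> reduced_objective lam d U0 U A p q) \<and>
      gan_loss M lam d X G = reduced_objective lam d U0 U A p q"
    using max eq by blast
  show "reduced_objective lam d U0 U A p q \<le> gan_loss M lam d X G" for A p q
    using max eq by simp
qed

section \<open>First-order conditions\<close>

lemma square_integrable_affine:
  fixes \<Lambda> :: "real^'n^'n"
  shows "square_integrable_map (\<lambda>z. \<Lambda> *v z + \<mu>)"
proof
  show "integrable std_gauss (\<lambda>z. (norm (\<Lambda> *v z + \<mu>))\<^sup>2)"
  proof (rule Bochner_Integration.integrable_bound)
    show "integrable std_gauss (\<lambda>z::real^'n. 2 * (norm \<Lambda>)\<^sup>2 * (norm z)\<^sup>2 + 2 * (norm \<mu>)\<^sup>2)"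
      by (intro Bochner_Integration.integrable_add integrable_mult_right integrable_std_gauss_norm_squared) simp
    show "AE z in std_gauss. norm ((norm (\<Lambda> *v z + \<mu>))\<^sup>2) \<le> norm (2 * (norm \<Lambda>)\<^sup>2 * (norm z)\<^sup>2 + 2 * (norm \<mu>)\<^sup>2)"
    proof (rule AE_I2)
      fix z :: "real^'n"
      have "norm (\<Lambda> *v z + \<mu>) \<le> norm \<Lambda> * norm z + norm \<mu>"
        using norm_triangle_ineq[of "\<Lambda> *v z" \<mu>] norm_matrix_vector_mult_le[of \<Lambda> z] by linarith
      then have "(norm (\<Lambda> *v z + \<mu>))\<^sup>2 \<le> (norm \<Lambda> * norm z + norm \<mu>)\<^sup>2" by (intro power_mono) auto
      also have "\<dots> \<le> 2 * (norm \<Lambda>)\<^sup>2 * (norm z)\<^sup>2 + 2 * (norm \<mu>)\<^sup>2"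
        using sum_squares_bound[of "norm \<Lambda> * norm z" "norm \<mu>"]
        by (simp add: power2_sum power_mult_distrib mult_ac)
      finally show "norm ((norm (\<Lambda> *v z + \<mu>))\<^sup>2) \<le> norm (2 * (norm \<Lambda>)\<^sup>2 * (norm z)\<^sup>2 + 2 * (norm \<mu>)\<^sup>2)"
        by simp
    qed
  qed measurable
qed measurable

lemma inner_affine:
  fixes \<Lambda> :: "real^'n^'n"
  shows "x \<bullet> (\<Lambda> *v z + \<mu>) = x \<bullet> \<mu> + (x v* \<Lambda>) \<bullet> z"
  by (simp add: inner_simps dot_lmul_matrix)

lemma integral_affine_mult_tanh:
  fixes \<Lambda> :: "real^'n^'n"
  shows
  "(\<integral>z. (y \<bullet> (\<Lambda> *v z + \<mu>)) * tanh (p \<bullet> (\<Lambda> *v z + \<mu>)) \<partial>std_gauss)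
    = (y \<bullet> \<mu>) * gauss_tanh (p \<bullet> \<mu>) (p v* \<Lambda>)
    + ((y v* \<Lambda>) \<bullet> (p v* \<Lambda>)) * gauss_sech_sq (p \<bullet> \<mu>) (p v* \<Lambda>)"
  unfolding inner_affine
  using gauss_tanh_stein[of "y v* \<Lambda>" "p \<bullet> \<mu>" "p v* \<Lambda>"] integrable_std_gauss_tanh[of "p \<bullet> \<mu>" "p v* \<Lambda>"]
  by (simp add: distrib_right gauss_tanh_def)

lemma integral_inner_mult_affine:
  "(\<integral>z. (a \<bullet> z) * (m + w \<bullet> z) \<partial>std_gauss) = a \<bullet> w"
  "integrable std_gauss (\<lambda>z. (a \<bullet> z) * (m + w \<bullet> z))"
  using std_gauss_stein[of "\<lambda>x. x" "\<lambda>_. 1" 1 a m w] by (auto simp: std_gauss.prob_space[simplified])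

lemma integral_inner_0: "(\<integral>z. a \<bullet> z \<partial>std_gauss) = 0"
  using std_gauss_stein[of "\<lambda>x. 1" "\<lambda>_. 0" 0 a 0 0] by auto

lemma integral_affine_square:
  fixes \<Lambda> :: "real^'n^'n"
  shows
  "(\<integral>z. (y \<bullet> (\<Lambda> *v z + \<mu>))\<^sup>2 \<partial>std_gauss) = (y \<bullet> \<mu>)\<^sup>2 + (y v* \<Lambda>) \<bullet> (y v* \<Lambda>)"
  unfolding inner_affine power2_eq_square
  using integral_inner_mult_affine[of "y v* \<Lambda>" "y \<bullet> \<mu>" "y v* \<Lambda>"] integrable_std_gauss_inner[of "y v* \<Lambda>"]
    integral_inner_0[of "y v* \<Lambda>"]
  by (simp add: distrib_right[of "y \<bullet> \<mu>"] distrib_left[of "y \<bullet> \<mu>"] std_gauss.prob_space[simplified])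

context square_integrable_map
begin

lemma integrable_inner_square: "integrable std_gauss (\<lambda>z. (y \<bullet> U z)\<^sup>2)"
proof (rule Bochner_Integration.integrable_bound)
  show "integrable std_gauss (\<lambda>z. (norm y)\<^sup>2 * (norm (U z))\<^sup>2)" using sq by simp
  show "AE z in std_gauss. norm ((y \<bullet> U z)\<^sup>2) \<le> norm ((norm y)\<^sup>2 * (norm (U z))\<^sup>2)"
  proof (rule AE_I2)
    fix z
    have "\<bar>y \<bullet> U z\<bar>\<^sup>2 \<le> (norm y * norm (U z))\<^sup>2" by (intro power_mono Cauchy_Schwarz_ineq2) simp
    then show "norm ((y \<bullet> U z)\<^sup>2) \<le> norm ((norm y)\<^sup>2 * (norm (U z))\<^sup>2)" by (simp add: power_mult_distrib)
  qed
qed measurable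

lemma abs_inner_integrable: "integrable std_gauss (\<lambda>z. \<bar>y \<bullet> U z\<bar>)"
proof (rule Bochner_Integration.integrable_bound)
  show "integrable std_gauss (\<lambda>z. norm y * norm (U z))" using integrable_norm by simp
  show "AE z in std_gauss. norm \<bar>y \<bullet> U z\<bar> \<le> norm (norm y * norm (U z))"
    by (intro AE_I2) (simp add: Cauchy_Schwarz_ineq2)
qed measurable

lemma even_discriminator_deriv_p:
  "((\<lambda>t. \<integral>z. even_discriminator A (p + t *\<^sub>R y) q (U z) \<partial>std_gauss) has_real_derivative
    (\<integral>z. (y \<bullet> U z) * tanh (p \<bullet> U z) \<partial>std_gauss)) (at 0)"
proof -
  have "((\<lambda>t. \<integral>z. even_discriminator A (p + t *\<^sub>R y) q (U z) \<partial>std_gauss) has_real_derivative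
    (\<integral>z. (y \<bullet> U z) * tanh ((p + 0 *\<^sub>R y) \<bullet> U z) \<partial>std_gauss)) (at 0)"
  proof (rule has_real_derivative_integral[where e = 1 and g = "\<lambda>z. \<bar>y \<bullet> U z\<bar>"
        and F' = "\<lambda>t z. (y \<bullet> U z) * tanh ((p + t *\<^sub>R y) \<bullet> U z)"])
    show "((\<lambda>t. even_discriminator A (p + t *\<^sub>R y) q (U z)) has_real_derivative
        (y \<bullet> U z) * tanh ((p + t *\<^sub>R y) \<bullet> U z)) (at t)" for t z
      unfolding even_discriminator_def inner_add_left inner_scaleR_left
      by (auto intro!: derivative_eq_intros)
  qed (auto intro: integrable_even_discriminator abs_inner_integrable abs_mult_tanh_le)
  then show ?thesis by simp
qed

text \<open>The discriminator is a sum of terms in A, p and q separately, so this is the derivative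
  in p with the opposite sign.\<close>

lemma even_discriminator_deriv_q:
  "((\<lambda>t. \<integral>z. even_discriminator A p (q + t *\<^sub>R y) (U z) \<partial>std_gauss) has_real_derivative
    - (\<integral>z. (y \<bullet> U z) * tanh (q \<bullet> U z) \<partial>std_gauss)) (at 0)"
proof -
  have split: "even_discriminator A p q x = even_discriminator A 0 0 x + even_discriminator 0 p 0 x - even_discriminator 0 q 0 x" for A p q x
    by (simp add: even_discriminator_def)
  have eq: "(\<integral>z. even_discriminator A p q (U z) \<partial>std_gauss) = (\<integral>z. even_discriminator A 0 0 (U z) \<partial>std_gauss)
      + (\<integral>z. even_discriminator 0 p 0 (U z) \<partial>std_gauss) - (\<integral>z. even_discriminator 0 q 0 (U z) \<partial>std_gauss)" for q
    using integrable_even_discriminator by (subst split) simp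
  show ?thesis
    unfolding eq by (auto intro!: derivative_eq_intros even_discriminator_deriv_p)
qed

text \<open>W is the velocity of the moving map, later \<open>N *v z + \<eta>\<close> for a
  variation of the generator parameters.\<close>

lemma even_discriminator_deriv_map:
  assumes "square_integrable_map W"
  shows "((\<lambda>t. \<integral>z. even_discriminator A p q (U z + t *\<^sub>R W z) \<partial>std_gauss) has_real_derivative
    (\<integral>z. 1 / 2 * (W z \<bullet> (A *v U z) + U z \<bullet> (A *v W z)) + (p \<bullet> W z) * tanh (p \<bullet> U z)
      - (q \<bullet> W z) * tanh (q \<bullet> U z) \<partial>std_gauss)) (at 0)"
proof -
  interpret W: square_integrable_map W by fact
  let ?V = "\<lambda>t z. U z + t *\<^sub>R W z"
  define F' where "F' = (\<lambda>t z. 1 / 2 * (W z \<bullet> (A *v ?V t z) + ?V t z \<bullet> (A *v W z)) + (p \<bullet> W z) * tanh (p \<bullet> ?V t z)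
      - (q \<bullet> W z) * tanh (q \<bullet> ?V t z))"
  have sqV: "square_integrable_map (?V t)" for t
  proof
    show "integrable std_gauss (\<lambda>z. (norm (?V t z))\<^sup>2)"
    proof (rule Bochner_Integration.integrable_bound)
      show "integrable std_gauss (\<lambda>z. 2 * (norm (U z))\<^sup>2 + 2 * t\<^sup>2 * (norm (W z))\<^sup>2)"
        by (intro Bochner_Integration.integrable_add integrable_mult_right sq W.sq)
      have "(norm (?V t z))\<^sup>2 \<le> 2 * (norm (U z))\<^sup>2 + 2 * t\<^sup>2 * (norm (W z))\<^sup>2" for z
      proof -
        have "(norm (?V t z))\<^sup>2 \<le> (norm (U z) + norm (t *\<^sub>R W z))\<^sup>2"
          by (intro power_mono norm_triangle_ineq) auto
        then show ?thesis
          using sum_squares_bound[of "norm (U z)" "norm (t *\<^sub>R W z)"]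
          by (simp add: power2_sum power_mult_distrib)
      qed
      then show "AE z in std_gauss. norm ((norm (?V t z))\<^sup>2) \<le> norm (2 * (norm (U z))\<^sup>2 + 2 * t\<^sup>2 * (norm (W z))\<^sup>2)"
        by (intro AE_I2) simp
    qed measurable
  qed measurable
  have "((\<lambda>t. \<integral>z. even_discriminator A p q (?V t z) \<partial>std_gauss) has_real_derivative
    (\<integral>z. F' 0 z \<partial>std_gauss)) (at 0)"
  proof (rule has_real_derivative_integral[where e = 1 and F' = F' and
        g = "\<lambda>z. norm A * ((norm (U z))\<^sup>2 + 2 * (norm (W z))\<^sup>2) + (norm p + norm q) * norm (W z)"])
    show "integrable std_gauss (\<lambda>z. norm A * ((norm (U z))\<^sup>2 + 2 * (norm (W z))\<^sup>2) + (norm p + norm q) * norm (W z))"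
      by (intro Bochner_Integration.integrable_add integrable_mult_right sq W.sq W.integrable_norm)
    show "F' 0 \<in> borel_measurable std_gauss"
      unfolding F'_def by measurable
    fix t :: real assume t: "\<bar>t - 0\<bar> < 1"
    show "integrable std_gauss (\<lambda>z. even_discriminator A p q (?V t z))"
      by (rule square_integrable_map.integrable_even_discriminator[OF sqV])
    show "((\<lambda>t. even_discriminator A p q (?V t z)) has_real_derivative F' t z) (at t)" for z
      unfolding even_discriminator_def F'_def inner_add_left inner_scaleR_left inner_add_right inner_scaleR_right
        matrix_vector_right_distrib matrix_vector_mult_scaleR
      by (auto intro!: derivative_eq_intros simp: algebra_simps)
    show "\<bar>F' t z\<bar> \<le> norm A * ((norm (U z))\<^sup>2 + 2 * (norm (W z))\<^sup>2) + (norm p + norm q) * norm (W z)" for z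
    proof -
      have "norm (?V t z) \<le> norm (U z) + \<bar>t\<bar> * norm (W z)"
        using norm_triangle_ineq[of "U z" "t *\<^sub>R W z"] by simp
      moreover have "\<bar>t\<bar> * norm (W z) \<le> 1 * norm (W z)" using t by (intro mult_right_mono) auto
      ultimately have "norm (W z) * norm (?V t z) \<le> norm (W z) * (norm (U z) + norm (W z))"
        by (intro mult_left_mono) auto
      also have "\<dots> \<le> (norm (U z))\<^sup>2 + 2 * (norm (W z))\<^sup>2"
        using sum_squares_bound[of "norm (W z)" "norm (U z)"] zero_le_power2[of "norm (U z)"] zero_le_power2[of "norm (W z)"]
        unfolding distrib_left power2_eq_square by linarith
      finally have *: "norm A * (norm (W z) * norm (?V t z)) \<le> norm A * ((norm (U z))\<^sup>2 + 2 * (norm (W z))\<^sup>2)"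
        by (intro mult_left_mono) auto
      have tanh_le: "\<bar>(r \<bullet> W z) * tanh (r \<bullet> ?V t z)\<bar> \<le> norm r * norm (W z)" for r
        using abs_mult_tanh_le Cauchy_Schwarz_ineq2 by (rule order_trans)
      moreover have "\<bar>?V t z \<bullet> (A *v W z)\<bar> \<le> norm A * (norm (W z) * norm (?V t z))"
        using abs_bilinear_le[of "?V t z" A "W z"] by (simp only: mult.commute[of "norm (?V t z)"])
      moreover have "\<bar>1 / 2 * (a + b) + c - e\<bar> \<le> k + (k1 + k2)"
        if "\<bar>a\<bar> \<le> l" "\<bar>b\<bar> \<le> l" "l \<le> k" "\<bar>c\<bar> \<le> k1" "\<bar>e\<bar> \<le> k2" for a b c e k l k1 k2 :: real
        using that by argo
      ultimately show ?thesis
        unfolding F'_def distrib_right[of _ _ "norm (W z)"]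
        using abs_bilinear_le[of "W z" A "?V t z"] * tanh_le by blast
    qed
  qed simp
  then show ?thesis by (simp add: F'_def)
qed

end

text \<open>\<open>g - f\<close> has a maximum at 0. This takes the place of differentiating the
  maximum and works with any maximizing discriminator.\<close>

lemma DERIV_zero_of_touching_below:
  fixes f g :: "real \<Rightarrow> real"
  assumes "(f has_real_derivative 0) (at 0)" "(g has_real_derivative D) (at 0)"
    and le: "\<And>t. g t \<le> f t" and eq: "g 0 = f 0"
  shows "D = 0"
proof -
  have "((\<lambda>t. g t - f t) has_real_derivative D - 0) (at 0)"
    using assms by (intro DERIV_diff)
  then have "D - 0 = 0"
    by (rule DERIV_local_max[of _ _ _ 1]) (use le eq in auto)
  then show ?thesis by simp
qed

definition maximizes_reduced_objective where
  "maximizes_reduced_objective lam d U0 U A p q \<longleftrightarrow>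
    (\<forall>A' p' q'. reduced_objective lam d U0 U A' p' q' \<le> reduced_objective lam d U0 U A p q)"

lemma norm_add_scaleR_sq_deriv:
  fixes a y :: "'a::real_inner"
  shows "((\<lambda>t. (norm (a + t *\<^sub>R y))\<^sup>2) has_real_derivative 2 * (a \<bullet> y)) (at 0)"
proof -
  have "(norm (a + t *\<^sub>R y))\<^sup>2 = a \<bullet> a + 2 * t * (a \<bullet> y) + t\<^sup>2 * (y \<bullet> y)" for t
    unfolding power2_norm_eq_inner by (simp add: inner_simps inner_commute power2_eq_square algebra_simps)
  then show ?thesis by (auto intro!: derivative_eq_intros)
qed

lemma maximizer_first_order:
  fixes U0 U :: "real^'n \<Rightarrow> real^'n"
  assumes "square_integrable_map U0" "square_integrable_map U"
    and max: "maximizes_reduced_objective lam d U0 U A p q"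
  shows "(\<integral>z. (y \<bullet> U0 z) * tanh (p \<bullet> U0 z) \<partial>std_gauss) - (\<integral>z. (y \<bullet> U z) * tanh (p \<bullet> U z) \<partial>std_gauss)
      = 2 * lam * ((p - d) \<bullet> y)" (is ?p)
    and "(\<integral>z. (y \<bullet> U z) * tanh (q \<bullet> U z) \<partial>std_gauss) - (\<integral>z. (y \<bullet> U0 z) * tanh (q \<bullet> U0 z) \<partial>std_gauss)
      = 2 * lam * ((q - d) \<bullet> y)" (is ?q)
    and "(\<integral>z. (y \<bullet> U0 z)\<^sup>2 \<partial>std_gauss) - (\<integral>z. (y \<bullet> U z)\<^sup>2 \<partial>std_gauss) = 2 * lam * (y \<bullet> (A *v y))" (is ?A)
proof -
  interpret U0: square_integrable_map U0 by fact
  interpret U: square_integrable_map U by fact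
  have crit: "D = 0" if "(g has_real_derivative D) (at 0)"
    "\<And>t. g t \<le> reduced_objective lam d U0 U A p q" "g 0 = reduced_objective lam d U0 U A p q" for g D
    by (rule DERIV_zero_of_touching_below[OF DERIV_const that(1)]) (use that in auto)
  have shift: "p + t *\<^sub>R y - d = (p - d) + t *\<^sub>R y" for p :: "real^'n" and t by simp
  have "((\<lambda>t. reduced_objective lam d U0 U A (p + t *\<^sub>R y) q) has_real_derivative
      (\<integral>z. (y \<bullet> U0 z) * tanh (p \<bullet> U0 z) \<partial>std_gauss) - (\<integral>z. (y \<bullet> U z) * tanh (p \<bullet> U z) \<partial>std_gauss)
      - 0 - lam * (2 * ((p - d) \<bullet> y)) - 0) (at 0)"
    unfolding reduced_objective_def shift
    by (intro DERIV_diff DERIV_const DERIV_cmult U0.even_discriminator_deriv_p U.even_discriminator_deriv_p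
        norm_add_scaleR_sq_deriv)
  from crit[OF this] show ?p
    using max by (auto simp: maximizes_reduced_objective_def)
  have "((\<lambda>t. reduced_objective lam d U0 U A p (q + t *\<^sub>R y)) has_real_derivative
      - (\<integral>z. (y \<bullet> U0 z) * tanh (q \<bullet> U0 z) \<partial>std_gauss) - - (\<integral>z. (y \<bullet> U z) * tanh (q \<bullet> U z) \<partial>std_gauss)
      - 0 - 0 - lam * (2 * ((q - d) \<bullet> y))) (at 0)"
    unfolding reduced_objective_def shift
    by (intro DERIV_diff DERIV_const DERIV_cmult U0.even_discriminator_deriv_q U.even_discriminator_deriv_q
        norm_add_scaleR_sq_deriv)
  from crit[OF this] show ?q
    using max by (auto simp: maximizes_reduced_objective_def)
  \<comment> \<open>The rank-one direction y times its transpose: varying A along it probes the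
    second moment in the direction y.\<close>
  define B :: "real^'n^'n" where "B = (\<chi> i j. y $ i * y $ j)"
  have B: "x \<bullet> (B *v x) = (y \<bullet> x)\<^sup>2" for x
    by (simp add: B_def inner_vec_def matrix_vector_mult_def power2_eq_square sum_product sum_distrib_left mult_ac)
  have AB: "A \<bullet> B = y \<bullet> (A *v y)"
    by (simp add: B_def inner_vec_def matrix_vector_mult_def sum_distrib_left mult_ac)
  have lin: "(\<integral>z. even_discriminator (A + t *\<^sub>R B) p q (V z) \<partial>std_gauss)
      = (\<integral>z. even_discriminator A p q (V z) \<partial>std_gauss) + t / 2 * (\<integral>z. (y \<bullet> V z)\<^sup>2 \<partial>std_gauss)"
    if "square_integrable_map V" for V :: "real^'n \<Rightarrow> real^'n" and t
  proof -
    have "even_discriminator (A + t *\<^sub>R B) p q x = even_discriminator A p q x + t / 2 * (y \<bullet> x)\<^sup>2" for x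
      by (simp add: even_discriminator_def matrix_vector_mult_add_rdistrib inner_simps B
          scaleR_matrix_vector_assoc[symmetric] algebra_simps)
    then show ?thesis
      using square_integrable_map.integrable_even_discriminator[OF that, of A p q]
        square_integrable_map.integrable_inner_square[OF that, of y] by simp
  qed
  have half: "((\<lambda>t. c + t / 2 * e) has_real_derivative e / 2) (at 0)" for c e :: real
    by (auto intro!: derivative_eq_intros)
  have "((\<lambda>t. reduced_objective lam d U0 U (A + t *\<^sub>R B) p q) has_real_derivative
      (\<integral>z. (y \<bullet> U0 z)\<^sup>2 \<partial>std_gauss) / 2 - (\<integral>z. (y \<bullet> U z)\<^sup>2 \<partial>std_gauss) / 2
      - lam / 2 * (2 * (A \<bullet> B)) - 0 - 0) (at 0)"
    unfolding reduced_objective_def lin[OF assms(1)] lin[OF assms(2)]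
    by (intro DERIV_diff DERIV_const DERIV_cmult half norm_add_scaleR_sq_deriv)
  from crit[OF this] show ?A
    using max unfolding AB by (auto simp: maximizes_reduced_objective_def)
qed

text \<open>The discriminator is frozen at a maximizer for the given generator while the parameters
  move along the line with direction \<open>(\<eta>, N)\<close>; its objective stays below the loss
  and meets it at \<open>t = 0\<close>.\<close>

lemma maximizer_first_order_generator:
  fixes \<Lambda> N :: "real^'n^'n"
  assumes U0: "square_integrable_map U0"
    and law: "has_symmetrized_law M X U0" "\<And>\<mu> \<Lambda>. has_symmetrized_law M (G \<Lambda> \<mu>) (\<lambda>z. \<Lambda> *v z + \<mu>)"
    and lam: "0 < lam"
    and stat: "GDERIV (\<lambda>(\<mu>, \<Lambda>). gan_loss M lam d X (G \<Lambda> \<mu>)) (\<mu>, \<Lambda>) :> 0"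
    and eq: "gan_loss M lam d X (G \<Lambda> \<mu>) = reduced_objective lam d U0 (\<lambda>z. \<Lambda> *v z + \<mu>) A p q"
  shows "(\<integral>z. 1 / 2 * ((N *v z + \<eta>) \<bullet> (A *v (\<Lambda> *v z + \<mu>)) + (\<Lambda> *v z + \<mu>) \<bullet> (A *v (N *v z + \<eta>)))
      + (p \<bullet> (N *v z + \<eta>)) * tanh (p \<bullet> (\<Lambda> *v z + \<mu>))
      - (q \<bullet> (N *v z + \<eta>)) * tanh (q \<bullet> (\<Lambda> *v z + \<mu>)) \<partial>std_gauss) = 0" (is "?I = 0")
proof -
  let ?f = "\<lambda>(\<mu>, \<Lambda>). gan_loss M lam d X (G \<Lambda> \<mu>)"
  let ?line = "\<lambda>t. (\<mu> + t *\<^sub>R \<eta>, \<Lambda> + t *\<^sub>R N)"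
  have "(?line has_derivative (\<lambda>t. (t *\<^sub>R \<eta>, t *\<^sub>R N))) (at 0)"
    by (auto intro!: derivative_eq_intros)
  moreover have "(?f has_derivative (\<lambda>h. h \<bullet> 0)) (at (?line 0))"
    using stat by (simp add: gderiv_def)
  ultimately have "((\<lambda>t. ?f (?line t)) has_derivative (\<lambda>t. (t *\<^sub>R \<eta>, t *\<^sub>R N) \<bullet> 0)) (at 0)"
    by (rule has_derivative_compose)
  moreover have "(\<lambda>t. (t *\<^sub>R \<eta>, t *\<^sub>R N) \<bullet> 0) = (*) 0" by auto
  ultimately have D0: "((\<lambda>t. ?f (?line t)) has_real_derivative 0) (at 0)"
    by (simp only: has_field_derivative_def)
  let ?g = "\<lambda>t. reduced_objective lam d U0 (\<lambda>z. (\<Lambda> + t *\<^sub>R N) *v z + (\<mu> + t *\<^sub>R \<eta>)) A p q"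
  have split: "(\<Lambda> + t *\<^sub>R N) *v z + (\<mu> + t *\<^sub>R \<eta>) = (\<Lambda> *v z + \<mu>) + t *\<^sub>R (N *v z + \<eta>)" for t z
    by (simp add: matrix_vector_mult_add_rdistrib scaleR_matrix_vector_assoc[symmetric] scaleR_add_right)
  note deriv = square_integrable_map.even_discriminator_deriv_map[OF square_integrable_affine square_integrable_affine,
      of A p q \<Lambda> \<mu> N \<eta>]
  have "(?g has_real_derivative 0 - ?I - 0 - 0 - 0) (at 0)"
    unfolding reduced_objective_def split
    by (intro DERIV_diff DERIV_const deriv)
  then have "(?g has_real_derivative - ?I) (at 0)" by simp
  then have "- ?I = 0"
  proof (rule DERIV_zero_of_touching_below[OF D0])
    show "?g t \<le> ?f (?line t)" for t
      using gan_loss_reduced(1)[OF U0 square_integrable_affine law(1) law(2) lam] by simp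
  qed (use eq in simp)
  then show ?thesis by simp
qed

section \<open>Minima of the loss\<close>

text \<open>Of first order in \<open>p - d\<close> and in \<open>x - y\<close> at once, as the
  quadratic bound on the loss requires; the mean value inequality is applied on the segment from y
  to x.\<close>

lemma ln_cosh_gap_lipschitz:
  fixes x y p d :: "'a::real_inner"
  shows "\<bar>(ln (cosh (p \<bullet> x)) - ln (cosh (d \<bullet> x))) - (ln (cosh (p \<bullet> y)) - ln (cosh (d \<bullet> y)))\<bar>
    \<le> norm (p - d) * ((1 + norm d * (norm x + norm y)) * norm (x - y))"
proof -
  define u where "u t = y + t *\<^sub>R (x - y)" for t :: real
  define f where "f t = ln (cosh (p \<bullet> u t)) - ln (cosh (d \<bullet> u t))" for t
  define f' where "f' t = tanh (p \<bullet> u t) * (p \<bullet> (x - y)) - tanh (d \<bullet> u t) * (d \<bullet> (x - y))" for t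
  have deriv: "(f has_real_derivative f' t) (at t)" for t
    unfolding f_def[abs_def] f'_def u_def inner_add_right inner_scaleR_right
    by (auto intro!: derivative_eq_intros)
  have tanh_lip: "\<bar>tanh a - tanh b\<bar> \<le> 1 * \<bar>a - b\<bar>" for a b :: real
    by (rule bounded_derivative_imp_lipschitz[OF has_field_derivative_tanh_sech_sq abs_sech_sq])
  have bound: "\<bar>f' t\<bar> \<le> norm (p - d) * ((1 + norm d * (norm x + norm y)) * norm (x - y))"
    if t: "0 \<le> t" "t \<le> 1" for t
  proof -
    have "u t = t *\<^sub>R x + (1 - t) *\<^sub>R y" by (simp add: u_def algebra_simps)
    then have "norm (u t) \<le> t * norm x + (1 - t) * norm y"
      using norm_triangle_ineq[of "t *\<^sub>R x" "(1 - t) *\<^sub>R y"] t by simp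
    also have "\<dots> \<le> norm x + norm y"
      using t by (intro add_mono mult_left_le_one_le) auto
    finally have u: "norm (u t) \<le> norm x + norm y" .
    have "f' t = tanh (p \<bullet> u t) * ((p - d) \<bullet> (x - y)) + (tanh (p \<bullet> u t) - tanh (d \<bullet> u t)) * (d \<bullet> (x - y))"
      by (simp add: f'_def algebra_simps inner_diff_left)
    moreover have "\<bar>tanh (p \<bullet> u t) * ((p - d) \<bullet> (x - y))\<bar> \<le> 1 * (norm (p - d) * norm (x - y))"
      unfolding abs_mult by (intro mult_mono abs_tanh_le_1 Cauchy_Schwarz_ineq2) auto
    moreover have "\<bar>(tanh (p \<bullet> u t) - tanh (d \<bullet> u t)) * (d \<bullet> (x - y))\<bar>
        \<le> (norm (p - d) * (norm x + norm y)) * (norm d * norm (x - y))"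
      unfolding abs_mult
    proof (intro mult_mono Cauchy_Schwarz_ineq2)
      have "\<bar>tanh (p \<bullet> u t) - tanh (d \<bullet> u t)\<bar> \<le> \<bar>(p - d) \<bullet> u t\<bar>"
        using tanh_lip[of "p \<bullet> u t" "d \<bullet> u t"] by (simp add: inner_diff_left)
      also have "\<dots> \<le> norm (p - d) * norm (u t)" by (rule Cauchy_Schwarz_ineq2)
      also have "\<dots> \<le> norm (p - d) * (norm x + norm y)" using u by (intro mult_left_mono) auto
      finally show "\<bar>tanh (p \<bullet> u t) - tanh (d \<bullet> u t)\<bar> \<le> norm (p - d) * (norm x + norm y)" .
    qed auto
    ultimately have "\<bar>f' t\<bar> \<le> 1 * (norm (p - d) * norm (x - y)) + (norm (p - d) * (norm x + norm y)) * (norm d * norm (x - y))"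
      by linarith
    then show ?thesis by (simp add: algebra_simps)
  qed
  have "norm (f 1 - f 0) \<le> norm (p - d) * ((1 + norm d * (norm x + norm y)) * norm (x - y)) * norm (1 - 0 :: real)"
    by (rule field_differentiable_bound[of "{0..1}" f f'])
       (auto intro: bound has_field_derivative_at_within[OF deriv])
  then show ?thesis by (simp add: f_def u_def)
qed

text \<open>The even discriminator with parameters \<open>(0, d, d)\<close> vanishes identically, so
  increments are proportional to the distance of \<open>(A, p, q)\<close> from it.\<close>

lemma even_discriminator_increment_le:
  "\<bar>even_discriminator A p q x - even_discriminator A p q y\<bar>
    \<le> (norm A + norm (p - d) + norm (q - d)) * ((1 + (1 + norm d) * (norm x + norm y)) * norm (x - y))"
proof -
  let ?L = "(1 + (1 + norm d) * (norm x + norm y)) * norm (x - y)"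
  have 1: "\<bar>1 / 2 * (x \<bullet> (A *v x)) - 1 / 2 * (y \<bullet> (A *v y))\<bar> \<le> norm A * ?L"
  proof -
    have "x \<bullet> (A *v x) - y \<bullet> (A *v y) = (x - y) \<bullet> (A *v x) + y \<bullet> (A *v (x - y))"
      by (simp add: matrix_vector_mult_diff_distrib inner_simps)
    then have "\<bar>x \<bullet> (A *v x) - y \<bullet> (A *v y)\<bar> \<le> norm A * (norm (x - y) * norm x) + norm A * (norm y * norm (x - y))"
      using abs_bilinear_le[of "x - y" A x] abs_bilinear_le[of y A "x - y"] by linarith
    also have "\<dots> = norm A * ((norm x + norm y) * norm (x - y))" by (simp add: algebra_simps)
    finally have "\<bar>x \<bullet> (A *v x) - y \<bullet> (A *v y)\<bar> \<le> norm A * ((norm x + norm y) * norm (x - y))" .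
    moreover have "norm A * ((norm x + norm y) * norm (x - y)) \<le> norm A * ?L"
      by (intro mult_left_mono mult_right_mono) (auto simp: algebra_simps)
    ultimately show ?thesis by linarith
  qed
  have 2: "\<bar>(ln (cosh (p \<bullet> x)) - ln (cosh (d \<bullet> x))) - (ln (cosh (p \<bullet> y)) - ln (cosh (d \<bullet> y)))\<bar>
      \<le> norm (p - d) * ?L" for p
  proof -
    have "norm (p - d) * ((1 + norm d * (norm x + norm y)) * norm (x - y)) \<le> norm (p - d) * ?L"
      by (intro mult_left_mono mult_right_mono) (auto simp: algebra_simps)
    then show ?thesis using ln_cosh_gap_lipschitz[of p x d y] by linarith
  qed
  show ?thesis
    using 1 2[of p] 2[of q] unfolding even_discriminator_def distrib_right[of _ _ ?L] by linarith
qed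

text \<open>With n the distance of \<open>(A, p, q)\<close> from \<open>(0, d, d)\<close>, a move of
  the generator by h gains at most of order \<open>n * h\<close>, whereas the penalty costs of order
  \<open>lam * n\<^sup>2\<close>; the best n leaves order \<open>h\<^sup>2\<close>.\<close>

lemma reduced_objective_quadratic_bound:
  fixes \<Lambda> :: "real^'n^'n"
  assumes lam: "0 < lam"
  obtains C where "\<And>\<mu>' \<Lambda>' A p q. norm ((\<mu>', \<Lambda>') - (\<mu>, \<Lambda>)) \<le> 1 \<Longrightarrow>
    reduced_objective lam d (\<lambda>z. \<Lambda> *v z + \<mu>) (\<lambda>z. \<Lambda>' *v z + \<mu>') A p q \<le> C * (norm ((\<mu>', \<Lambda>') - (\<mu>, \<Lambda>)))\<^sup>2"
proof -
  define B where "B = 2 * norm \<Lambda> + 2 * norm \<mu> + 1"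
  define c where "c z = (1 + (1 + norm d) * (B * (norm z + 1))) * (norm z + 1)" for z :: "real^'n"
  have B: "0 \<le> B" by (simp add: B_def)
  define C where "C = (\<integral>z. c z \<partial>std_gauss)"
  have c_int: "integrable std_gauss c"
  proof -
    have "c = (\<lambda>z. (1 + norm d) * B * (norm z)\<^sup>2 + (1 + 2 * (1 + norm d) * B) * norm z + (1 + (1 + norm d) * B))"
      by (simp add: c_def fun_eq_iff algebra_simps power2_eq_square)
    then show ?thesis
      by (simp only:) (intro Bochner_Integration.integrable_add std_gauss.integrable_const
        integrable_mult_right[OF integrable_std_gauss_norm_squared] integrable_mult_right[OF integrable_std_gauss_norm])
  qed
  show thesis
  proof
    fix \<mu>' p q :: "real^'n" and \<Lambda>' A :: "real^'n^'n"
    define h where "h = norm ((\<mu>', \<Lambda>') - (\<mu>, \<Lambda>))"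
    assume "norm ((\<mu>', \<Lambda>') - (\<mu>, \<Lambda>)) \<le> 1"
    then have h: "h \<le> 1" "0 \<le> h" by (simp_all add: h_def)
    have hh: "norm (\<mu>' - \<mu>) \<le> h" "norm (\<Lambda>' - \<Lambda>) \<le> h"
      unfolding h_def using norm_fst_le[of "\<mu>' - \<mu>" "\<Lambda>' - \<Lambda>"] norm_snd_le[of "\<Lambda>' - \<Lambda>" "\<mu>' - \<mu>"] by simp_all
    let ?U = "\<lambda>z. \<Lambda> *v z + \<mu>" and ?U' = "\<lambda>z. \<Lambda>' *v z + \<mu>'"
    let ?n = "norm A + norm (p - d) + norm (q - d)"
    interpret U: square_integrable_map ?U by (rule square_integrable_affine)
    interpret U': square_integrable_map ?U' by (rule square_integrable_affine)
    have pw: "even_discriminator A p q (?U z) - even_discriminator A p q (?U' z) \<le> ?n * h * c z" for z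
    proof -
      have "?U z - ?U' z = - ((\<Lambda>' - \<Lambda>) *v z + (\<mu>' - \<mu>))"
        by (simp add: matrix_vector_mult_diff_rdistrib)
      then have "norm (?U z - ?U' z) = norm ((\<Lambda>' - \<Lambda>) *v z + (\<mu>' - \<mu>))" by (metis norm_minus_cancel)
      also have "\<dots> \<le> norm (\<Lambda>' - \<Lambda>) * norm z + norm (\<mu>' - \<mu>)"
        using norm_triangle_ineq[of "(\<Lambda>' - \<Lambda>) *v z" "\<mu>' - \<mu>"] norm_matrix_vector_mult_le[of "\<Lambda>' - \<Lambda>" z] by linarith
      also have "\<dots> \<le> h * norm z + h" using hh by (intro add_mono mult_right_mono) auto
      finally have diff: "norm (?U z - ?U' z) \<le> h * (norm z + 1)" by (simp add: algebra_simps)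
      have "norm \<Lambda>' \<le> norm \<Lambda> + 1" "norm \<mu>' \<le> norm \<mu> + 1"
        using hh h norm_triangle_sub[of \<Lambda>' \<Lambda>] norm_triangle_sub[of \<mu>' \<mu>] by linarith+
      then have "norm \<Lambda>' * norm z \<le> (norm \<Lambda> + 1) * norm z" by (intro mult_right_mono) auto
      then have "norm (?U z) + norm (?U' z) \<le> (2 * norm \<Lambda> + 1) * norm z + (2 * norm \<mu> + 1)"
        using norm_triangle_ineq[of "\<Lambda> *v z" \<mu>] norm_triangle_ineq[of "\<Lambda>' *v z" \<mu>']
          norm_matrix_vector_mult_le[of \<Lambda> z] norm_matrix_vector_mult_le[of \<Lambda>' z] \<open>norm \<mu>' \<le> norm \<mu> + 1\<close>
        by (simp add: algebra_simps)
      also have "\<dots> \<le> B * norm z + B * 1" by (intro add_mono mult_right_mono) (auto simp: B_def)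
      finally have sum: "norm (?U z) + norm (?U' z) \<le> B * (norm z + 1)" by (simp add: algebra_simps)
      have "even_discriminator A p q (?U z) - even_discriminator A p q (?U' z)
          \<le> ?n * ((1 + (1 + norm d) * (norm (?U z) + norm (?U' z))) * norm (?U z - ?U' z))"
        using even_discriminator_increment_le[of A p q "?U z" "?U' z" d] by linarith
      also have "\<dots> \<le> ?n * ((1 + (1 + norm d) * (B * (norm z + 1))) * (h * (norm z + 1)))"
        using B diff sum by (intro mult_left_mono mult_mono add_left_mono) (auto intro!: add_nonneg_nonneg mult_nonneg_nonneg)
      finally show ?thesis by (simp add: c_def mult_ac)
    qed
    have "(\<integral>z. even_discriminator A p q (?U z) \<partial>std_gauss) - (\<integral>z. even_discriminator A p q (?U' z) \<partial>std_gauss)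
        = (\<integral>z. even_discriminator A p q (?U z) - even_discriminator A p q (?U' z) \<partial>std_gauss)"
      using U.integrable_even_discriminator U'.integrable_even_discriminator by simp
    also have "\<dots> \<le> (\<integral>z. ?n * h * c z \<partial>std_gauss)"
      by (intro integral_mono Bochner_Integration.integrable_diff U.integrable_even_discriminator
          U'.integrable_even_discriminator integrable_mult_right c_int pw)
    also have "\<dots> = ?n * (h * C)" by (simp add: C_def)
    finally have le: "(\<integral>z. even_discriminator A p q (?U z) \<partial>std_gauss) - (\<integral>z. even_discriminator A p q (?U' z) \<partial>std_gauss)
        \<le> norm A * (h * C) + norm (p - d) * (h * C) + norm (q - d) * (h * C)"
      by (simp add: algebra_simps)
    \<comment> \<open>Completing the square. It is applied to A, p and q separately, which gives the
      factor 3 below.\<close>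
    have amgm: "a * (h * C) - lam / 2 * a\<^sup>2 \<le> (h * C)\<^sup>2 / (2 * lam)" for a
    proof -
      have "0 \<le> (h * C - lam * a)\<^sup>2 / (2 * lam)" using lam by simp
      also have "\<dots> = (h * C)\<^sup>2 / (2 * lam) - a * (h * C) + lam / 2 * a\<^sup>2"
        using lam by (simp add: power2_diff field_simps) (simp add: power2_eq_square)
      finally show ?thesis by simp
    qed
    have half: "lam / 2 * a\<^sup>2 \<le> lam * a\<^sup>2" for a using lam by simp
    have arith: "t1 - t2 - l - m' - n' \<le> 3 * k"
      if "t1 - t2 \<le> a + b + c" "a - l \<le> k" "b - m \<le> k" "c - n \<le> k" "m \<le> m'" "n \<le> n'"
      for t1 t2 a b c l m n m' n' k :: real
      using that by linarith
    have "reduced_objective lam d ?U ?U' A p q \<le> 3 * ((h * C)\<^sup>2 / (2 * lam))"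
      unfolding reduced_objective_def by (rule arith[OF le amgm amgm amgm half half])
    then show "reduced_objective lam d ?U ?U' A p q
        \<le> (3 * C\<^sup>2 / (2 * lam)) * (norm ((\<mu>', \<Lambda>') - (\<mu>, \<Lambda>)))\<^sup>2"
      unfolding h_def[symmetric] by (simp add: power_mult_distrib mult_ac)
  qed
qed

text \<open>At a generator reproducing the law of \<open>X\<close> the loss attains its minimum 0; differentiability there
  follows from a quadratic upper bound.\<close>

lemma gan_loss_gderiv_zero:
  fixes \<Lambda> :: "real^'n^'n"
  assumes X: "has_symmetrized_law M X (\<lambda>z. \<Lambda> *v z + \<mu>)"
    and G: "\<And>\<Lambda> \<mu>. has_symmetrized_law M (G \<Lambda> \<mu>) (\<lambda>z. \<Lambda> *v z + \<mu>)"
    and lam: "0 < lam"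
  shows "GDERIV (\<lambda>(\<mu>, \<Lambda>). gan_loss M lam d X (G \<Lambda> \<mu>)) (\<mu>, \<Lambda>) :> 0"
proof -
  let ?f = "\<lambda>(\<mu>, \<Lambda>). gan_loss M lam d X (G \<Lambda> \<mu>)"
  let ?x = "(\<mu>, \<Lambda>)"
  obtain C where C: "\<And>\<mu>' \<Lambda>' A p q. norm ((\<mu>', \<Lambda>') - (\<mu>, \<Lambda>)) \<le> 1 \<Longrightarrow>
    reduced_objective lam d (\<lambda>z. \<Lambda> *v z + \<mu>) (\<lambda>z. \<Lambda>' *v z + \<mu>') A p q \<le> C * (norm ((\<mu>', \<Lambda>') - (\<mu>, \<Lambda>)))\<^sup>2"
    using reduced_objective_quadratic_bound[OF lam] by blast
  have upper: "?f y \<le> C * (norm (y - ?x))\<^sup>2" if "norm (y - ?x) \<le> 1" for y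
  proof -
    obtain \<mu>' \<Lambda>' where y: "y = (\<mu>', \<Lambda>')" by fastforce
    show ?thesis
      using gan_loss_reduced(2)[OF square_integrable_affine square_integrable_affine X G[of \<Lambda>' \<mu>'] lam, of d]
        C that unfolding y prod.case by metis
  qed
  have lower: "0 \<le> ?f y" for y
  proof -
    obtain \<mu>' \<Lambda>' where y: "y = (\<mu>', \<Lambda>')" by fastforce
    have "reduced_objective lam d (\<lambda>z. \<Lambda> *v z + \<mu>) (\<lambda>z. \<Lambda>' *v z + \<mu>') 0 d d = 0"
      by (simp add: reduced_objective_def even_discriminator_def)
    then show ?thesis
      using gan_loss_reduced(1)[OF square_integrable_affine square_integrable_affine X G[of \<Lambda>' \<mu>'] lam, of d 0 d d]
      unfolding y by simp
  qed
  have zero: "?f ?x = 0"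
    using upper[of ?x] lower[of ?x] by (simp only: diff_self norm_zero) simp
  have "((\<lambda>y. norm (?f y - ?f ?x - 0) / norm (y - ?x)) \<longlongrightarrow> 0) (at ?x)"
  proof (rule tendsto_sandwich[where f = "\<lambda>_. 0" and h = "\<lambda>y. C * norm (y - ?x)"])
    show "\<forall>\<^sub>F y in at ?x. norm (?f y - ?f ?x - 0) / norm (y - ?x) \<le> C * norm (y - ?x)"
      unfolding eventually_at
    proof (intro exI[of _ 1] conjI ballI impI)
      fix y assume y: "y \<noteq> ?x \<and> dist y ?x < 1"
      then have "?f y \<le> C * (norm (y - ?x))\<^sup>2" using upper[of y] by (simp only: dist_norm) simp
      moreover have "norm (?f y - ?f ?x - 0) = ?f y" using lower[of y] zero by (simp only:) simp
      moreover have "0 < norm (y - ?x)" using y by simp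
      ultimately show "norm (?f y - ?f ?x - 0) / norm (y - ?x) \<le> C * norm (y - ?x)"
        by (simp only: divide_le_eq power2_eq_square mult.assoc) simp
    qed simp
    have "((\<lambda>y. C * norm (y - ?x)) \<longlongrightarrow> C * norm (?x - ?x)) (at ?x)"
      by (intro tendsto_intros)
    then show "((\<lambda>y. C * norm (y - ?x)) \<longlongrightarrow> 0) (at ?x)" by simp
  qed (auto intro!: always_eventually)
  then have "(?f has_derivative (\<lambda>_. 0)) (at ?x)"
    unfolding has_derivative_iff_norm by simp
  then show ?thesis by (simp add: gderiv_def)
qed

text \<open>\<open>cosh\<close> is even, so only the distance to d notices the sign.\<close>

lemma reduced_objective_uminus:
  "reduced_objective lam d U0 U A (- p) q = reduced_objective lam d U0 U A p q - 4 * lam * (p \<bullet> d)"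
  "reduced_objective lam d U0 U A p (- q) = reduced_objective lam d U0 U A p q - 4 * lam * (q \<bullet> d)"
proof -
  have "even_discriminator A (- p) q x = even_discriminator A p q x"
    "even_discriminator A p (- q) x = even_discriminator A p q x" for x
    by (simp_all add: even_discriminator_def)
  moreover have "(norm (- r - d))\<^sup>2 = (norm (r - d))\<^sup>2 + 4 * (r \<bullet> d)" for r
    unfolding power2_norm_eq_inner by (simp add: inner_simps inner_commute)
  ultimately show "reduced_objective lam d U0 U A (- p) q = reduced_objective lam d U0 U A p q - 4 * lam * (p \<bullet> d)"
    "reduced_objective lam d U0 U A p (- q) = reduced_objective lam d U0 U A p q - 4 * lam * (q \<bullet> d)"
    by (simp_all add: reduced_objective_def algebra_simps)
qed

text \<open>Comparison with \<open>- p\<close> gives \<open>0 \<le> p \<bullet> d\<close>. In case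
  of equality \<open>- p\<close> is a maximizer as well; the left sides of the two first-order
  conditions along d are opposite, which forces \<open>d \<bullet> d = 0\<close>. Likewise for q.
  The signs later make the factor between p and q positive.\<close>

lemma maximizer_inner_pos:
  fixes U0 U :: "real^'n \<Rightarrow> real^'n"
  assumes U: "square_integrable_map U0" "square_integrable_map U"
    and max: "maximizes_reduced_objective lam d U0 U A p q" and lam: "0 < lam" and d: "d \<noteq> 0"
  shows "0 < p \<bullet> d" and "0 < q \<bullet> d"
proof -
  have dd: "0 < d \<bullet> d" using d by simp
  have "0 \<le> 4 * lam * (p \<bullet> d)" "0 \<le> 4 * lam * (q \<bullet> d)"
    using max reduced_objective_uminus[of lam d U0 U A p q] unfolding maximizes_reduced_objective_def
    by (metis add_le_cancel_left diff_add_cancel add.commute le_add_same_cancel1)+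
  then have nonneg: "0 \<le> p \<bullet> d" "0 \<le> q \<bullet> d" using lam by (auto simp: zero_le_mult_iff)
  have "p \<bullet> d \<noteq> 0"
  proof
    assume "p \<bullet> d = 0"
    then have "maximizes_reduced_objective lam d U0 U A (- p) q"
      using max by (simp add: maximizes_reduced_objective_def reduced_objective_uminus)
    from maximizer_first_order(1)[OF U this, of d] maximizer_first_order(1)[OF U max, of d]
    have "2 * lam * ((- p - d) \<bullet> d) = - (2 * lam * ((p - d) \<bullet> d))" by simp
    then have "lam * (d \<bullet> d) = 0" by (simp add: inner_simps algebra_simps)
    then show False using lam dd by simp
  qed
  moreover have "q \<bullet> d \<noteq> 0"
  proof
    assume "q \<bullet> d = 0"
    then have "maximizes_reduced_objective lam d U0 U A p (- q)"
      using max by (simp add: maximizes_reduced_objective_def reduced_objective_uminus)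
    from maximizer_first_order(2)[OF U this, of d] maximizer_first_order(2)[OF U max, of d]
    have "2 * lam * ((- q - d) \<bullet> d) = - (2 * lam * ((q - d) \<bullet> d))" by simp
    then have "lam * (d \<bullet> d) = 0" by (simp add: inner_simps algebra_simps)
    then show False using lam dd by simp
  qed
  ultimately show "0 < p \<bullet> d" "0 < q \<bullet> d" using nonneg by auto
qed

section \<open>Uniqueness of the stationary point\<close>

lemma vector_matrix_mult_nonzero:
  fixes \<Lambda> :: "real^'n^'n"
  assumes "invertible \<Lambda>" "x \<noteq> 0"
  shows "x v* \<Lambda> \<noteq> 0"
proof
  assume 0: "x v* \<Lambda> = 0"
  obtain V where "\<Lambda> ** V = mat 1" using assms(1) by (auto simp: invertible_def)
  then have "(x v* \<Lambda>) \<bullet> (V *v x) = x \<bullet> x"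
    by (simp add: dot_lmul_matrix matrix_vector_mul_assoc)
  with 0 assms(2) show False by simp
qed

lemma inner_matrix_mult_transpose:
  fixes \<Lambda> :: "real^'n^'n"
  shows "x \<bullet> ((\<Lambda> ** transpose \<Lambda>) *v y) = (x v* \<Lambda>) \<bullet> (y v* \<Lambda>)"
  by (simp add: dot_lmul_matrix matrix_vector_mul_assoc[symmetric])

lemma separable_along_imp:
  fixes \<Lambda> :: "real^'n^'n"
  assumes "separable_along \<mu> (\<Lambda> ** transpose \<Lambda>) d"
  shows "2 * ((d v* \<Lambda>) \<bullet> (d v* \<Lambda>)) \<le> \<bar>d \<bullet> \<mu>\<bar>"
proof -
  have "0 \<le> sqrt ((d v* \<Lambda>) \<bullet> (d v* \<Lambda>))" by simp
  with assms show ?thesis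
    unfolding separable_along_def inner_matrix_mult_transpose inner_commute[of \<mu>] by linarith
qed

text \<open>Nonzero defects make p and q proportional, and the inner products with d make the factor
  positive. Were it not 1, separability of the longer vector would contradict injectivity of the
  scaled defect on the common ray.\<close>

lemma gauss_defect_collinear_eq:
  fixes \<Lambda> :: "real^'n^'n"
  assumes inv: "invertible \<Lambda>"
    and pd: "0 < p \<bullet> d" and qd: "0 < q \<bullet> d"
    and sep_p: "2 * ((p v* \<Lambda>) \<bullet> (p v* \<Lambda>)) \<le> \<bar>p \<bullet> \<mu>\<bar>"
    and sep_q: "2 * ((q v* \<Lambda>) \<bullet> (q v* \<Lambda>)) \<le> \<bar>q \<bullet> \<mu>\<bar>"
    and eq: "gauss_defect (p \<bullet> \<mu>) (p v* \<Lambda>) *\<^sub>R p = gauss_defect (q \<bullet> \<mu>) (q v* \<Lambda>) *\<^sub>R q"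
  shows "p = q"
proof -
  define h where "h x = gauss_defect (x \<bullet> \<mu>) (x v* \<Lambda>)" for x
  have scale: "h (l *\<^sub>R x) = gauss_defect (l * (x \<bullet> \<mu>)) (l *\<^sub>R (x v* \<Lambda>))" for l x
    by (simp add: h_def scaleR_vector_matrix_assoc)
  have *: False if l: "1 < l" and a: "a = l *\<^sub>R b" and b: "b \<noteq> 0" and ab: "h a *\<^sub>R a = h b *\<^sub>R b"
    and sep: "2 * ((a v* \<Lambda>) \<bullet> (a v* \<Lambda>)) \<le> \<bar>a \<bullet> \<mu>\<bar>" for a b l
  proof -
    have "(l * h a - h b) *\<^sub>R b = 0" using ab by (simp add: a algebra_simps)
    then have "l * h (l *\<^sub>R b) = 1 * h (1 *\<^sub>R b)" using b by (simp add: a)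
    moreover have "1 * gauss_defect (1 * (b \<bullet> \<mu>)) (1 *\<^sub>R (b v* \<Lambda>)) \<noteq> l * gauss_defect (l * (b \<bullet> \<mu>)) (l *\<^sub>R (b v* \<Lambda>))"
      using sep l by (intro gauss_defect_scaled_inj vector_matrix_mult_nonzero[OF inv b])
        (simp_all add: a scaleR_vector_matrix_assoc power2_eq_square mult.assoc)
    ultimately show False by (simp only: scale)
  qed
  have nz: "p \<noteq> 0" "q \<noteq> 0" using pd qd by auto
  have hp: "h p \<noteq> 0" "h q \<noteq> 0"
    unfolding h_def
    by (rule gauss_defect_nonzero[OF vector_matrix_mult_nonzero[OF inv nz(1)] sep_p]
        gauss_defect_nonzero[OF vector_matrix_mult_nonzero[OF inv nz(2)] sep_q])+
  have eq': "h p *\<^sub>R p = h q *\<^sub>R q" using eq by (simp add: h_def)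
  define l where "l = h q / h p"
  have p: "p = l *\<^sub>R q"
  proof -
    have "h p *\<^sub>R p = h p *\<^sub>R (l *\<^sub>R q)" using eq' hp by (simp add: l_def)
    then show ?thesis using hp(1) by (metis scaleR_cancel_left)
  qed
  have "p \<bullet> d = l * (q \<bullet> d)" by (simp add: p)
  then have l: "0 < l" using pd qd by (simp add: zero_less_mult_iff)
  have q: "q = (1 / l) *\<^sub>R p" using l by (simp add: p)
  consider "1 < l" | "l = 1" | "1 < 1 / l" using l by (metis less_divide_eq_1_pos linorder_neqE_linordered_idom)
  then show ?thesis
  proof cases
    case 1
    then show ?thesis using *[OF 1 p nz(2) eq' sep_p] by simp
  next
    case 3
    then show ?thesis using *[OF 3 q nz(1) eq'[symmetric] sep_q] by simp
  qed (simp add: p)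
qed

text \<open>For \<open>y = d\<close> the \<open>tanh\<close> condition is equality of
  \<open>gauss_mult_tanh\<close>, so the mean along d is fixed up to sign, and then the variance
  along d. Eliminating the covariance with d from the two conditions determines every
  \<open>y \<bullet> \<mu>\<close>, because the defect is nonzero.\<close>

lemma moment_matching_imp_eq:
  fixes \<Lambda> \<Lambda>0 :: "real^'n^'n"
  assumes inv: "invertible \<Lambda>" "invertible \<Lambda>0" and d: "d \<noteq> 0"
    and sep: "2 * ((d v* \<Lambda>) \<bullet> (d v* \<Lambda>)) \<le> \<bar>d \<bullet> \<mu>\<bar>" "2 * ((d v* \<Lambda>0) \<bullet> (d v* \<Lambda>0)) \<le> \<bar>d \<bullet> \<mu>0\<bar>"
    and second: "\<And>y. (y \<bullet> \<mu>)\<^sup>2 + (y v* \<Lambda>) \<bullet> (y v* \<Lambda>) = (y \<bullet> \<mu>0)\<^sup>2 + (y v* \<Lambda>0) \<bullet> (y v* \<Lambda>0)"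
    and tanh: "\<And>y. (y \<bullet> \<mu>) * gauss_tanh (d \<bullet> \<mu>) (d v* \<Lambda>) + ((y v* \<Lambda>) \<bullet> (d v* \<Lambda>)) * gauss_sech_sq (d \<bullet> \<mu>) (d v* \<Lambda>)
      = (y \<bullet> \<mu>0) * gauss_tanh (d \<bullet> \<mu>0) (d v* \<Lambda>0) + ((y v* \<Lambda>0) \<bullet> (d v* \<Lambda>0)) * gauss_sech_sq (d \<bullet> \<mu>0) (d v* \<Lambda>0)"
  shows "\<Lambda> ** transpose \<Lambda> = \<Lambda>0 ** transpose \<Lambda>0 \<and> (\<mu> = \<mu>0 \<or> \<mu> = - \<mu>0)"
proof -
  let ?w = "d v* \<Lambda>" and ?wX = "d v* \<Lambda>0" and ?m = "d \<bullet> \<mu>" and ?mX = "d \<bullet> \<mu>0"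
  have nz: "?w \<noteq> 0" "?wX \<noteq> 0" using vector_matrix_mult_nonzero inv d by auto
  have add: "(x + y) v* L = x v* L + y v* L" for x y :: "real^'n" and L :: "real^'n^'n"
    by (simp add: vector_matrix_left_distrib)
  \<comment> \<open>Polarization; the pair y, d supplies the covariance that occurs in the
    \<open>tanh\<close> condition.\<close>
  have polar: "(x \<bullet> \<mu>) * (y \<bullet> \<mu>) + (x v* \<Lambda>) \<bullet> (y v* \<Lambda>) = (x \<bullet> \<mu>0) * (y \<bullet> \<mu>0) + (x v* \<Lambda>0) \<bullet> (y v* \<Lambda>0)" for x y
    using second[of "x + y"] second[of x] second[of y]
    by (simp add: add inner_add_left inner_add_right power2_sum inner_commute)
  have "gauss_mult_tanh ?m ?w = gauss_mult_tanh ?mX ?wX"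
    using tanh[of d] by (simp add: gauss_mult_tanh_eq)
  then have abs: "\<bar>?m\<bar> = \<bar>?mX\<bar>"
    using gauss_mult_tanh_inj[OF nz sep] second[of d] by blast
  then have "?m\<^sup>2 = ?mX\<^sup>2" by (metis power2_abs)
  then have norms: "norm ?w = norm ?wX" using second[of d] by (simp add: norm_eq)
  have h: "gauss_defect ?m ?w \<noteq> 0" by (rule gauss_defect_nonzero[OF nz(1) sep(1)])
  note cong = gauss_norm_cong[OF norms]
  have "\<mu> = \<mu>0 \<or> \<mu> = - \<mu>0"
  proof (cases "?mX = ?m")
    case True
    have "(y \<bullet> \<mu>) = (y \<bullet> \<mu>0)" for y
    proof -
      \<comment> \<open>Subtracting the polarized identity, multiplied by
        \<open>gauss_sech_sq\<close>, from the \<open>tanh\<close> condition cancels the covariances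
        and leaves the defect as coefficient.\<close>
      have "((y \<bullet> \<mu>) - (y \<bullet> \<mu>0)) * gauss_defect ?m ?w = 0"
        using arg_cong[OF polar[of y d], of "\<lambda>t. t * gauss_sech_sq ?m ?w"] tanh[of y]
        unfolding True cong[symmetric] gauss_defect_def by (simp add: algebra_simps)
      with h show ?thesis by simp
    qed
    then show ?thesis by (metis vector_eq_ldot)
  next
    case False
    with abs have m0: "?mX = - ?m" by (auto simp: abs_if split: if_splits)
    have "(y \<bullet> \<mu>) = (y \<bullet> - \<mu>0)" for y
    proof -
      have "((y \<bullet> \<mu>) + (y \<bullet> \<mu>0)) * gauss_defect ?m ?w = 0"
        using arg_cong[OF polar[of y d], of "\<lambda>t. t * gauss_sech_sq ?m ?w"] tanh[of y]
        unfolding m0 cong[symmetric] gauss_defect_def gauss_minus by (simp add: algebra_simps)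
      with h show ?thesis by (simp add: add_eq_0_iff)
    qed
    then show ?thesis by (metis vector_eq_ldot)
  qed
  moreover have "\<Lambda> ** transpose \<Lambda> = \<Lambda>0 ** transpose \<Lambda>0"
  proof -
    have "(x \<bullet> \<mu>) * (y \<bullet> \<mu>) = (x \<bullet> \<mu>0) * (y \<bullet> \<mu>0)" for x y
      using \<open>\<mu> = \<mu>0 \<or> \<mu> = - \<mu>0\<close> by auto
    then have "x \<bullet> ((\<Lambda> ** transpose \<Lambda>) *v y) = x \<bullet> ((\<Lambda>0 ** transpose \<Lambda>0) *v y)" for x y
      using polar[of x y] by (simp add: inner_matrix_mult_transpose)
    then show ?thesis unfolding matrix_eq by (metis vector_eq_ldot)
  qed
  ultimately show ?thesis by blast
qed

lemma critical_point_unique: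
  fixes \<Lambda> \<Lambda>0 :: "real^'n^'n" and \<mu> \<mu>0 :: "real^'n"
  defines "U \<equiv> \<lambda>z. \<Lambda> *v z + \<mu>" and "U0 \<equiv> \<lambda>z. \<Lambda>0 *v z + \<mu>0"
  assumes inv: "invertible \<Lambda>" "invertible \<Lambda>0" and d: "d \<noteq> 0" and lam: "0 < lam"
    and norms: "(\<integral>z. norm (U z) \<partial>std_gauss) \<le> \<rho>" "(\<integral>z. norm (U0 z) \<partial>std_gauss) \<le> \<rho>"
    and sep0: "2 * ((d v* \<Lambda>0) \<bullet> (d v* \<Lambda>0)) \<le> \<bar>d \<bullet> \<mu>0\<bar>"
    and sep: "\<And>d'. norm (d' - d) \<le> \<rho> / lam \<Longrightarrow> 2 * ((d' v* \<Lambda>) \<bullet> (d' v* \<Lambda>)) \<le> \<bar>d' \<bullet> \<mu>\<bar>"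
    and max: "maximizes_reduced_objective lam d U0 U A p q"
    and crit: "\<And>N \<eta>. (\<integral>z. 1 / 2 * ((N *v z + \<eta>) \<bullet> (A *v U z) + U z \<bullet> (A *v (N *v z + \<eta>)))
      + (p \<bullet> (N *v z + \<eta>)) * tanh (p \<bullet> U z) - (q \<bullet> (N *v z + \<eta>)) * tanh (q \<bullet> U z) \<partial>std_gauss) = 0"
  shows "\<Lambda> ** transpose \<Lambda> = \<Lambda>0 ** transpose \<Lambda>0 \<and> (\<mu> = \<mu>0 \<or> \<mu> = - \<mu>0)"
proof -
  interpret U: square_integrable_map U unfolding U_def by (rule square_integrable_affine)
  interpret U0: square_integrable_map U0 unfolding U0_def by (rule square_integrable_affine)
  note sq = U0.square_integrable_map_axioms U.square_integrable_map_axioms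
  note fo = maximizer_first_order[OF sq max]
  define E where "E L m y r = (\<integral>z. (y \<bullet> (L *v z + m)) * tanh (r \<bullet> (L *v z + m)) \<partial>std_gauss)"
    for L :: "real^'n^'n" and m y r
  have E: "E L m y r = (y \<bullet> m) * gauss_tanh (r \<bullet> m) (r v* L)
    + ((y v* L) \<bullet> (r v* L)) * gauss_sech_sq (r \<bullet> m) (r v* L)" for L m y r
    unfolding E_def by (rule integral_affine_mult_tanh)
  have fo_p: "E \<Lambda>0 \<mu>0 y p - E \<Lambda> \<mu> y p = 2 * lam * ((p - d) \<bullet> y)" for y
    using fo(1)[of y] by (simp add: E_def U_def U0_def)
  have fo_q: "E \<Lambda> \<mu> y q - E \<Lambda>0 \<mu>0 y q = 2 * lam * ((q - d) \<bullet> y)" for y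
    using fo(2)[of y] by (simp add: E_def U_def U0_def)
  have E_le: "\<bar>E L m y r\<bar> \<le> norm y * \<rho>" if "(\<integral>z. norm (L *v z + m) \<partial>std_gauss) \<le> \<rho>" for L m y r
  proof -
    interpret V: square_integrable_map "\<lambda>z. L *v z + m" by (rule square_integrable_affine)
    have "\<bar>(y \<bullet> (L *v z + m)) * tanh (r \<bullet> (L *v z + m))\<bar> \<le> norm y * norm (L *v z + m)" for z
      using abs_mult_tanh_le Cauchy_Schwarz_ineq2 by (rule order_trans)
    then have "(\<integral>z. \<bar>(y \<bullet> (L *v z + m)) * tanh (r \<bullet> (L *v z + m))\<bar> \<partial>std_gauss)
        \<le> (\<integral>z. norm y * norm (L *v z + m) \<partial>std_gauss)"
      by (intro integral_mono' integrable_mult_right V.integrable_norm) auto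
    also have "\<dots> \<le> norm y * \<rho>" using that by (simp add: mult_left_mono)
    finally show ?thesis unfolding E_def by (rule order_trans[OF integral_abs_bound])
  qed
  \<comment> \<open>Origin of the radius \<open>\<rho> / lam\<close>: tested with
    \<open>y = r - d\<close>, a first-order condition bounds
    \<open>2 * lam * (norm (r - d))\<^sup>2\<close> by \<open>2 * (norm (r - d) * \<rho>)\<close>,
    one \<open>\<rho>\<close> each for data and generator.\<close>
  have near: "norm (r - d) \<le> \<rho> / lam"
    if "\<bar>2 * lam * ((r - d) \<bullet> (r - d))\<bar> \<le> 2 * (norm (r - d) * \<rho>)" for r
  proof (cases "r = d")
    case True
    have "0 \<le> (\<integral>z. norm (U z) \<partial>std_gauss)" by (intro integral_nonneg_AE AE_I2) auto
    with norms(1) have "0 \<le> \<rho>" by linarith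
    then show ?thesis using True lam by simp
  next
    case False
    have "norm (r - d) * (lam * norm (r - d)) \<le> norm (r - d) * \<rho>"
      using that lam by (simp add: dot_square_norm power2_eq_square abs_mult mult_ac)
    then show ?thesis using False lam by (simp add: le_divide_eq mult.commute)
  qed
  have near_p: "norm (p - d) \<le> \<rho> / lam"
    using fo_p[of "p - d"] E_le[OF norms(1)[unfolded U_def], of "p - d" p]
      E_le[OF norms(2)[unfolded U0_def], of "p - d" p] by (intro near) linarith
  have near_q: "norm (q - d) \<le> \<rho> / lam"
    using fo_q[of "q - d"] E_le[OF norms(1)[unfolded U_def], of "q - d" q]
      E_le[OF norms(2)[unfolded U0_def], of "q - d" q] by (intro near) linarith
  have pos: "0 < p \<bullet> d" "0 < q \<bullet> d"
    using maximizer_inner_pos[OF sq max lam d] by auto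
  \<comment> \<open>The symmetric part of A applied to x.\<close>
  define S where "S x = (1 / 2) *\<^sub>R (x v* A + A *v x)" for x
  have S: "1 / 2 * (x \<bullet> (A *v u) + u \<bullet> (A *v x)) = S x \<bullet> u" for x u
    by (simp add: S_def inner_simps dot_lmul_matrix inner_commute[of u])
  have S_aff: "S x \<bullet> U z = S x \<bullet> \<mu> + (S x v* \<Lambda>) \<bullet> z" for x z
    unfolding U_def by (rule inner_affine)
  have tanh_aff: "tanh (r \<bullet> U z) = tanh (r \<bullet> \<mu> + (r v* \<Lambda>) \<bullet> z)" for r z
    unfolding U_def by (simp only: inner_affine)
  have crit1: "S \<eta> \<bullet> \<mu> + (p \<bullet> \<eta>) * gauss_tanh (p \<bullet> \<mu>) (p v* \<Lambda>) - (q \<bullet> \<eta>) * gauss_tanh (q \<bullet> \<mu>) (q v* \<Lambda>) = 0" for \<eta>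
  proof -
    have "0 = (\<integral>z. (S \<eta> \<bullet> \<mu> + (S \<eta> v* \<Lambda>) \<bullet> z) + (p \<bullet> \<eta>) * tanh (p \<bullet> \<mu> + (p v* \<Lambda>) \<bullet> z)
        - (q \<bullet> \<eta>) * tanh (q \<bullet> \<mu> + (q v* \<Lambda>) \<bullet> z) \<partial>std_gauss)"
      using crit[of 0 \<eta>] by (simp only: matrix_vector_mult_0 add_0 S S_aff tanh_aff)
    also have "\<dots> = S \<eta> \<bullet> \<mu> + (p \<bullet> \<eta>) * gauss_tanh (p \<bullet> \<mu>) (p v* \<Lambda>) - (q \<bullet> \<eta>) * gauss_tanh (q \<bullet> \<mu>) (q v* \<Lambda>)"
      using integrable_std_gauss_inner[of "S \<eta> v* \<Lambda>"] integral_inner_0[of "S \<eta> v* \<Lambda>"]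
        integrable_std_gauss_tanh[of "p \<bullet> \<mu>" "p v* \<Lambda>"] integrable_std_gauss_tanh[of "q \<bullet> \<mu>" "q v* \<Lambda>"]
      by (simp add: gauss_tanh_def std_gauss.prob_space[simplified])
    finally show ?thesis by simp
  qed
  have crit2: "S \<xi> \<bullet> y + (p \<bullet> \<xi>) * ((p \<bullet> y) * gauss_sech_sq (p \<bullet> \<mu>) (p v* \<Lambda>))
      - (q \<bullet> \<xi>) * ((q \<bullet> y) * gauss_sech_sq (q \<bullet> \<mu>) (q v* \<Lambda>)) = 0" for \<xi> y
  proof -
    \<comment> \<open>Varying \<open>\<Lambda>\<close> by \<open>\<xi>\<close> times the transpose
      of \<open>\<zeta>\<close> brings the factor \<open>\<zeta> \<bullet> z\<close> into the
      integrand; \<open>\<zeta> = V *v y\<close> is chosen so that Stein's identity produces inner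
      products with y.\<close>
    obtain V where V: "\<Lambda> ** V = mat 1" using inv(1) by (auto simp: invertible_def)
    define \<zeta> where "\<zeta> = V *v y"
    have y: "\<zeta> \<bullet> (x v* \<Lambda>) = x \<bullet> y" for x
      unfolding inner_commute[of \<zeta>] by (simp add: \<zeta>_def dot_lmul_matrix matrix_vector_mul_assoc V)
    define N :: "real^'n^'n" where "N = (\<chi> i j. \<xi> $ i * \<zeta> $ j)"
    have N: "N *v z + 0 = (\<zeta> \<bullet> z) *\<^sub>R \<xi>" for z
      by (simp add: N_def vec_eq_iff matrix_vector_mult_def inner_vec_def sum_distrib_left mult_ac)
    have "1 / 2 * (((\<zeta> \<bullet> z) *\<^sub>R \<xi>) \<bullet> (A *v U z) + U z \<bullet> (A *v ((\<zeta> \<bullet> z) *\<^sub>R \<xi>)))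
        + (p \<bullet> ((\<zeta> \<bullet> z) *\<^sub>R \<xi>)) * tanh (p \<bullet> U z) - (q \<bullet> ((\<zeta> \<bullet> z) *\<^sub>R \<xi>)) * tanh (q \<bullet> U z)
      = (\<zeta> \<bullet> z) * (1 / 2 * (\<xi> \<bullet> (A *v U z) + U z \<bullet> (A *v \<xi>)))
        + (p \<bullet> \<xi>) * ((\<zeta> \<bullet> z) * tanh (p \<bullet> U z)) - (q \<bullet> \<xi>) * ((\<zeta> \<bullet> z) * tanh (q \<bullet> U z))" for z
      by (simp add: matrix_vector_mult_scaleR algebra_simps)
    then have "0 = (\<integral>z. (\<zeta> \<bullet> z) * (S \<xi> \<bullet> \<mu> + (S \<xi> v* \<Lambda>) \<bullet> z)
        + (p \<bullet> \<xi>) * ((\<zeta> \<bullet> z) * tanh (p \<bullet> \<mu> + (p v* \<Lambda>) \<bullet> z))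
        - (q \<bullet> \<xi>) * ((\<zeta> \<bullet> z) * tanh (q \<bullet> \<mu> + (q v* \<Lambda>) \<bullet> z)) \<partial>std_gauss)"
      using crit[of N 0] by (simp only: N S S_aff tanh_aff)
    also have "\<dots> = S \<xi> \<bullet> y + (p \<bullet> \<xi>) * ((p \<bullet> y) * gauss_sech_sq (p \<bullet> \<mu>) (p v* \<Lambda>))
      - (q \<bullet> \<xi>) * ((q \<bullet> y) * gauss_sech_sq (q \<bullet> \<mu>) (q v* \<Lambda>))"
      using integral_inner_mult_affine[of \<zeta> "S \<xi> \<bullet> \<mu>" "S \<xi> v* \<Lambda>"]
        gauss_tanh_stein[of \<zeta> "p \<bullet> \<mu>" "p v* \<Lambda>"] gauss_tanh_stein[of \<zeta> "q \<bullet> \<mu>" "q v* \<Lambda>"]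
      by (simp add: y)
    finally show ?thesis by simp
  qed
  have "gauss_defect (p \<bullet> \<mu>) (p v* \<Lambda>) *\<^sub>R p = gauss_defect (q \<bullet> \<mu>) (q v* \<Lambda>) *\<^sub>R q"
  proof -
    have "(gauss_defect (p \<bullet> \<mu>) (p v* \<Lambda>) *\<^sub>R p) \<bullet> \<eta> = (gauss_defect (q \<bullet> \<mu>) (q v* \<Lambda>) *\<^sub>R q) \<bullet> \<eta>" for \<eta>
      \<comment> \<open>For \<open>y = \<mu>\<close> the second condition contains the same
        \<open>S\<close>-term as the first; subtracting eliminates A.\<close>
      using crit1[of \<eta>] crit2[of \<eta> \<mu>] by (simp add: gauss_defect_def algebra_simps)
    then show ?thesis by (metis vector_eq_rdot)
  qed
  then have pq: "p = q"
    by (rule gauss_defect_collinear_eq[OF inv(1) pos sep[OF near_p] sep[OF near_q]])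
  \<comment> \<open>Once p and q coincide, the left sides of the two first-order conditions are
    opposite, while the right sides are equal.\<close>
  have "2 * lam * ((p - d) \<bullet> (p - d)) = 0"
    using fo_p[of "p - d"] fo_q[of "p - d"] unfolding pq by linarith
  then have pd: "p = d" using lam by simp
  \<comment> \<open>The \<open>sech_sq\<close> terms of \<open>crit2\<close> now cancel. It is the
    quadratic form of A that the second-moment condition sees.\<close>
  have A0: "y \<bullet> (A *v y) = 0" for y
    using crit2[of y y] S[of y y] unfolding pq by simp
  have second: "(y \<bullet> \<mu>)\<^sup>2 + (y v* \<Lambda>) \<bullet> (y v* \<Lambda>) = (y \<bullet> \<mu>0)\<^sup>2 + (y v* \<Lambda>0) \<bullet> (y v* \<Lambda>0)" for y
    using fo(3)[of y] unfolding A0 U_def U0_def integral_affine_square by simp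
  have tanh: "E \<Lambda> \<mu> y d = E \<Lambda>0 \<mu>0 y d" for y
    using fo_p[of y] by (simp add: pd)
  have "0 \<le> \<rho> / lam" using near_p norm_ge_zero[of "p - d"] by linarith
  then show ?thesis
    by (intro moment_matching_imp_eq[OF inv d _ sep0 second tanh[unfolded E]] sep) simp
qed

text \<open>The random sign gives \<open>\<mu>\<close> and \<open>- \<mu>\<close> the same law, and
  \<open>\<Lambda>\<close> enters the law only through
  \<open>\<Lambda> ** transpose \<Lambda>\<close>; hence the form of the right-hand side.
  \<open>d_nonzero\<close> enters through \<open>maximizer_inner_pos\<close> and the positive
  variance along d, \<open>nondegenerate\<close> through the substitution in the density,
  \<open>vector_matrix_mult_nonzero\<close> and the rank-one variations.\<close>

theorem theorem4:
  fixes M :: "'w measure"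
    and X Z :: "'w \<Rightarrow> real^'n" and Y :: "'w \<Rightarrow> real"
    and \<mu>X d :: "real^'n" and \<Sigma>X :: "real^'n^'n"
    and lam \<rho> :: real
    and F :: "((real^'n) \<times> (real^'n^'n)) set"
  assumes "prob_space M"
    and X_law: "distributed M lborel X (\<lambda>x. ennreal (symmetric_mixture_density \<mu>X \<Sigma>X x))"
    and Z_law: "distributed M lborel Z (\<lambda>z. ennreal (gaussian_density 0 (mat 1) z))"
    and Y_meas: "Y \<in> borel_measurable M"
    and Y_pos: "measure M {\<omega> \<in> space M. Y \<omega> = 1} = 1 / 2"
    and Y_neg: "measure M {\<omega> \<in> space M. Y \<omega> = - 1} = 1 / 2"
    and YZ_indep: "prob_space.indep_set M
                     {Y -` S \<inter> space M | S. S \<in> sets borel}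
                     {Z -` S \<inter> space M | S. S \<in> sets borel}"
    and lam_pos: "lam > 0"
    and d_nonzero: "d \<noteq> 0"
    and nondegenerate: "\<And>\<mu> \<Lambda>. (\<mu>, \<Lambda>) \<in> F \<Longrightarrow> invertible \<Lambda>"
    and X_feasible: "\<exists>\<Lambda>. (\<mu>X, \<Lambda>) \<in> F \<and> \<Lambda> ** transpose \<Lambda> = \<Sigma>X"
    and X_separable: "separable_along \<mu>X \<Sigma>X d"
    and rho_attained: "\<exists>\<mu> \<Lambda>. (\<mu>, \<Lambda>) \<in> F \<and> (\<integral>\<omega>. norm (generator Y Z \<Lambda> \<mu> \<omega>) \<partial>M) = \<rho>"
    and rho_upper: "\<And>\<mu> \<Lambda>. (\<mu>, \<Lambda>) \<in> F \<Longrightarrow> (\<integral>\<omega>. norm (generator Y Z \<Lambda> \<mu> \<omega>) \<partial>M) \<le> \<rho>"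
    and G_separable: "\<And>\<mu> \<Lambda> d'. (\<mu>, \<Lambda>) \<in> F \<Longrightarrow> norm (d' - d) \<le> \<rho> / lam
                        \<Longrightarrow> separable_along \<mu> (\<Lambda> ** transpose \<Lambda>) d'"
    and moments: "\<And>\<mu> \<Lambda>. (\<mu>, \<Lambda>) \<in> F \<Longrightarrow>
                    (\<integral>\<omega>. (norm (X \<omega>))\<^sup>2 \<partial>M) + (\<integral>\<omega>. (norm (generator Y Z \<Lambda> \<mu> \<omega>))\<^sup>2 \<partial>M) \<le> lam"
  shows "\<forall>(\<mu>, \<Lambda>) \<in> F.
           GDERIV (\<lambda>(\<mu>, \<Lambda>). gan_loss M lam d X (generator Y Z \<Lambda> \<mu>)) (\<mu>, \<Lambda>) :> 0
           \<longleftrightarrow> \<Lambda> ** transpose \<Lambda> = \<Sigma>X \<and> (\<mu> = \<mu>X \<or> \<mu> = - \<mu>X)"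
proof -
  have G_law: "has_symmetrized_law M (generator Y Z \<Lambda> \<mu>) (\<lambda>z. \<Lambda> *v z + \<mu>)" for \<Lambda> \<mu>
    by (rule generator_has_symmetrized_law[OF assms(1) Z_law Y_meas Y_pos Y_neg YZ_indep])
  have X_law': "has_symmetrized_law M X (\<lambda>z. \<Lambda> *v z + \<mu>)"
    if "(\<mu>', \<Lambda>) \<in> F" "\<Lambda> ** transpose \<Lambda> = \<Sigma>X" "\<mu> = \<mu>X \<or> \<mu> = - \<mu>X" for \<mu> \<mu>' \<Lambda>
  proof (rule symmetric_mixture_has_symmetrized_law[OF assms(1) _ nondegenerate[OF that(1)]])
    have "symmetric_mixture_density \<mu> \<Sigma>X = symmetric_mixture_density \<mu>X \<Sigma>X"
      using that(3) by (auto simp: symmetric_mixture_density_def fun_eq_iff)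
    then show "distributed M lborel X (\<lambda>x. ennreal (symmetric_mixture_density \<mu> (\<Lambda> ** transpose \<Lambda>) x))"
      using X_law by (simp add: that(2))
  qed
  \<comment> \<open>Representing the data by a feasible factor makes \<open>\<rho>\<close> bound its
    first absolute moment too.\<close>
  obtain \<Lambda>0 where \<Lambda>0: "(\<mu>X, \<Lambda>0) \<in> F" "\<Lambda>0 ** transpose \<Lambda>0 = \<Sigma>X" using X_feasible by blast
  have norm_le: "(\<integral>z. norm (\<Lambda> *v z + \<mu>) \<partial>std_gauss) \<le> \<rho>" if "(\<mu>, \<Lambda>) \<in> F" for \<mu> \<Lambda>
    using rho_upper[OF that] has_symmetrized_law_even(2)[OF G_law, of norm \<Lambda> \<mu>] by simp
  show ?thesis
  proof (clarify, rule iffI)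
    fix \<mu> \<Lambda> assume F: "(\<mu>, \<Lambda>) \<in> F"
    assume stat: "GDERIV (\<lambda>(\<mu>, \<Lambda>). gan_loss M lam d X (generator Y Z \<Lambda> \<mu>)) (\<mu>, \<Lambda>) :> 0"
    have X0: "has_symmetrized_law M X (\<lambda>z. \<Lambda>0 *v z + \<mu>X)" using X_law'[OF \<Lambda>0] by simp
    obtain A p q where max: "maximizes_reduced_objective lam d (\<lambda>z. \<Lambda>0 *v z + \<mu>X) (\<lambda>z. \<Lambda> *v z + \<mu>) A p q"
      and eq: "gan_loss M lam d X (generator Y Z \<Lambda> \<mu>)
        = reduced_objective lam d (\<lambda>z. \<Lambda>0 *v z + \<mu>X) (\<lambda>z. \<Lambda> *v z + \<mu>) A p q"
      unfolding maximizes_reduced_objective_def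
      using gan_loss_reduced(2)[OF square_integrable_affine square_integrable_affine X0 G_law lam_pos, of d \<Lambda> \<mu>] by blast
    have "\<Lambda> ** transpose \<Lambda> = \<Lambda>0 ** transpose \<Lambda>0 \<and> (\<mu> = \<mu>X \<or> \<mu> = - \<mu>X)"
    proof (rule critical_point_unique[OF nondegenerate[OF F] nondegenerate[OF \<Lambda>0(1)] d_nonzero lam_pos
          norm_le[OF F] norm_le[OF \<Lambda>0(1)] _ _ max])
      show "2 * ((d v* \<Lambda>0) \<bullet> (d v* \<Lambda>0)) \<le> \<bar>d \<bullet> \<mu>X\<bar>"
        using X_separable \<Lambda>0(2) by (intro separable_along_imp) simp
      show "2 * ((d' v* \<Lambda>) \<bullet> (d' v* \<Lambda>)) \<le> \<bar>d' \<bullet> \<mu>\<bar>" if "norm (d' - d) \<le> \<rho> / lam" for d'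
        by (rule separable_along_imp[OF G_separable[OF F that]])
    qed (rule maximizer_first_order_generator[OF square_integrable_affine X0 G_law lam_pos stat eq])
    then show "\<Lambda> ** transpose \<Lambda> = \<Sigma>X \<and> (\<mu> = \<mu>X \<or> \<mu> = - \<mu>X)" using \<Lambda>0(2) by simp
  next
    fix \<mu> \<Lambda> assume F: "(\<mu>, \<Lambda>) \<in> F" and "\<Lambda> ** transpose \<Lambda> = \<Sigma>X \<and> (\<mu> = \<mu>X \<or> \<mu> = - \<mu>X)"
    \<comment> \<open>Here X is represented by \<open>\<mu>\<close> and \<open>\<Lambda>\<close>
      themselves, so data and generator have the same law.\<close>
    then have "has_symmetrized_law M X (\<lambda>z. \<Lambda> *v z + \<mu>)" using X_law'[OF F] by blast
    then show "GDERIV (\<lambda>(\<mu>, \<Lambda>). gan_loss M lam d X (generator Y Z \<Lambda> \<mu>)) (\<mu>, \<Lambda>) :> 0"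
      by (rule gan_loss_gderiv_zero[OF _ G_law lam_pos])
  qed
qed

end
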